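(* Any eigenvalue $\lambda_\theta\in\rho(\mathbf L_0)\cup\rho(\mathbf L_\infty)$ of $\mathbf L(\theta)$, for $\theta$ a self-adjoint linear relation in $\mathbb C^2$ that is not a matrix, belongs to $\Sigma^{\mathcal M}$. In particular, $\Sigma^{\mathcal R}=\emptyset$.
   Context: Setting. Let $-\infty\le a<b\le\infty$, let $p,w>0$ a.e. and $q$ real-valued a.e. on $(a,b)$ with $1/p,q,w\in L^1_{\rm loc}((a,b),dx)$, and put $\ell[f]=-\frac1w\big((pf')'+qf\big)$, acting in $L^2[(a,b),w]$ with $\langle f,g\rangle=\int_a^b f\overline g\,w\,dx$. Let $\mathcal D_{\max}=\{f: f,pf'\in AC_{\rm loc}(a,b),\ f,\ell[f]\in L^2[(a,b),w]\}$ and $[f,g](x)=p(x)\big(f(x)\overline{g'(x)}-f'(x)\overline{g(x)}\big)$; for $f,g\in\mathcal D_{\max}$ the limits at the endpoints exist. Let $\mathcal D_{\min}=\{f\in\mathcal D_{\max}:[f,g](b)-[f,g](a)=0\ \forall g\in\mathcal D_{\max}\}$, and let $\mathbf L_{\max},\mathbf L_{\min}$ be $\ell$ with domains $\mathcal D_{\max},\mathcal D_{\min}$. Standing assumptions: both endpoints are limit-circle, and $\mathbf L_{\min}$ is semi-bounded from below with lower bound $K\in\mathbb R$: $\langle\mathbf L_{\min}f,f\rangle\ge K\langle f,f\rangle$ (so the endpoints are non-oscillating). Quasi-derivatives. Fix $\lambda_0\in\mathbb R$. A real solution $u$ of $(\ell-\lambda_0)y=0$ is principal (non-principal) at an endpoint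 if $1/(pu^2)$ is not integrable (is integrable) there. Let $u_a,v_a$ (resp. $u_b,v_b$) be real principal and non-principal solutions of $(\ell-\lambda_0)y=0$ at $a$ (resp. $b$) with $[u_a,v_a](a)=1$, $[u_b,v_b](b)=1$. For $f\in\mathcal D_{\max}$: $f^{[0]}(a)=[f,v_a](a)$, $f^{[1]}(a)=-[f,u_a](a)$, $f^{[0]}(b)=[f,v_b](b)$, $f^{[1]}(b)=-[f,u_b](b)$. Extensions. $\Gamma_0f=(f^{[0]}(a),f^{[0]}(b))^T$, $\Gamma_1f=(f^{[1]}(a),-f^{[1]}(b))^T$. $\mathbf L_0$ and $\mathbf L_\infty$ are the restrictions of $\mathbf L_{\max}$ to $\ker\Gamma_0$ and $\ker\Gamma_1$. $\mathcal M$ is the set of Hermitian $2\times2$ matrices and $\mathcal R\supset\mathcal M$ (matrices identified with their graphs) the set of self-adjoint linear relations in $\mathbb C^2$. For $\theta\in\mathcal R$, $\mathbf L(\theta)$ is the restriction of $\mathbf L_{\max}$ to $\{f\in\mathcal D_{\max}:\{\Gamma_0f,\Gamma_1f\}\in\theta\}$. $\rho,\sigma$ denote resolvent set and spectrum. Define $$\Sigma^{\mathcal M}=\bigcup_{\theta\in\mathcal M}\sigma(\mathbf L(\theta)),\quad \Sigma^{\mathcal E}=\sigma(\mathbf L_0)\cap\sigma(\mathbf L_\infty),\quad \Sigma^{\mathcal R}=\Big(\bigcup_{\theta\in\mathcal R}\sigma(\mathbf L(\theta))\Big)\setminus\big(\Sigma^{\mathcal M}\cup\Sigma^{\mathcal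 E}\big).$$ *)

theory Defs
  imports "HOL-Analysis.Analysis"
begin

section \<open>Absolute continuity\<close>

definition abs_cont_on :: "real \<Rightarrow> real \<Rightarrow> (real \<Rightarrow> complex) \<Rightarrow> bool" where
  "abs_cont_on c d f \<longleftrightarrow>
     (\<forall>\<epsilon>>0. \<exists>\<delta>>0. \<forall>(n::nat) s t.
        (\<forall>i<n. c \<le> s i \<and> s i \<le> t i \<and> t i \<le> d) \<longrightarrow>
        disjoint_family_on (\<lambda>i. {s i<..<t i}) {..<n} \<longrightarrow>
        (\<Sum>i<n. t i - s i) < \<delta> \<longrightarrow>
        (\<Sum>i<n. cmod (f (t i) - f (s i))) < \<epsilon>)"

definition AC_loc :: "real set \<Rightarrow> (real \<Rightarrow> complex) \<Rightarrow> bool" where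
  "AC_loc I f \<longleftrightarrow> (\<forall>c d. c \<le> d \<longrightarrow> {c..d} \<subseteq> I \<longrightarrow> abs_cont_on c d f)"


section \<open>The Sturm--Liouville expression\<close>

record sl_data =
  lep :: ereal
  rep :: ereal
  cp :: "real \<Rightarrow> real"
  cq :: "real \<Rightarrow> real"
  cw :: "real \<Rightarrow> real"

abbreviation dom_int :: "sl_data \<Rightarrow> real set" where
  "dom_int S \<equiv> einterval (lep S) (rep S)"

definition sl_coefficients :: "sl_data \<Rightarrow> bool" where
  "sl_coefficients S \<longleftrightarrow>
     lep S < rep S \<and>
     (AE x in lebesgue_on (dom_int S). cp S x > 0 \<and> cw S x > 0) \<and>
     (\<forall>c d. {c..d} \<subseteq> dom_int S \<longrightarrow>
        integrable (lebesgue_on {c..d}) (\<lambda>x. 1 / cp S x) \<and>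
        integrable (lebesgue_on {c..d}) (cq S) \<and>
        integrable (lebesgue_on {c..d}) (cw S))"

text \<open>\<open>p f'\<close> is only defined almost everywhere; \<open>p f' \<in> AC\<^sub>l\<^sub>o\<^sub>c\<close> means that it
  agrees a.e. with a locally absolutely continuous function, which is unique on \<open>(a,b)\<close>.
  The quasi-derivative is this continuous representative.\<close>

definition is_quasi_deriv :: "sl_data \<Rightarrow> (real \<Rightarrow> complex) \<Rightarrow> (real \<Rightarrow> complex) \<Rightarrow> bool" where
  "is_quasi_deriv S f h \<longleftrightarrow> AC_loc (dom_int S) h \<and>
     (AE x in lebesgue_on (dom_int S). h x = of_real (cp S x) * vector_derivative f (at x))"

definition quasi_deriv :: "sl_data \<Rightarrow> (real \<Rightarrow> complex) \<Rightarrow> real \<Rightarrow> complex" where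
  "quasi_deriv S f = (SOME h. is_quasi_deriv S f h)"

definition sl_regular :: "sl_data \<Rightarrow> (real \<Rightarrow> complex) \<Rightarrow> bool" where
  "sl_regular S f \<longleftrightarrow> AC_loc (dom_int S) f \<and> (\<exists>h. is_quasi_deriv S f h)"

definition ell :: "sl_data \<Rightarrow> (real \<Rightarrow> complex) \<Rightarrow> real \<Rightarrow> complex" where
  "ell S f x =
     - (1 / of_real (cw S x)) *
       (vector_derivative (quasi_deriv S f) (at x) + of_real (cq S x) * f x)"

definition sl_solution :: "sl_data \<Rightarrow> complex \<Rightarrow> (real \<Rightarrow> complex) \<Rightarrow> bool" where
  "sl_solution S z y \<longleftrightarrow> sl_regular S y \<and>
     (AE x in lebesgue_on (dom_int S). ell S y x - z * y x = 0)"


section \<open>The weighted space of square integrable functions\<close>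

text \<open>Elements of \<open>L\<^sup>2[(a,b),w]\<close> are represented by functions on the real line; equality in
  \<open>L\<^sup>2\<close> is equality a.e. on \<open>(a,b)\<close>, and values outside \<open>(a,b)\<close> are irrelevant.\<close>

definition L2_space :: "sl_data \<Rightarrow> (real \<Rightarrow> complex) set" where
  "L2_space S = {f. f \<in> borel_measurable (lebesgue_on (dom_int S)) \<and>
     integrable (lebesgue_on (dom_int S)) (\<lambda>x. (cmod (f x))\<^sup>2 * cw S x)}"

definition L2_inner :: "sl_data \<Rightarrow> (real \<Rightarrow> complex) \<Rightarrow> (real \<Rightarrow> complex) \<Rightarrow> complex" where
  "L2_inner S f g =
     (LINT x|lebesgue_on (dom_int S). f x * cnj (g x) * of_real (cw S x))"

definition L2_norm :: "sl_data \<Rightarrow> (real \<Rightarrow> complex) \<Rightarrow> real" where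
  "L2_norm S f = sqrt (LINT x|lebesgue_on (dom_int S). (cmod (f x))\<^sup>2 * cw S x)"

definition L2_eq :: "sl_data \<Rightarrow> (real \<Rightarrow> complex) \<Rightarrow> (real \<Rightarrow> complex) \<Rightarrow> bool" where
  "L2_eq S f g \<longleftrightarrow> (AE x in lebesgue_on (dom_int S). f x = g x)"


section \<open>Endpoints\<close>

datatype endpoint = Lend | Rend

fun end_filter :: "sl_data \<Rightarrow> endpoint \<Rightarrow> real filter" where
  "end_filter S Lend = filtermap real_of_ereal (at_right (lep S))"
| "end_filter S Rend = filtermap real_of_ereal (at_left (rep S))"

fun end_part :: "sl_data \<Rightarrow> endpoint \<Rightarrow> real \<Rightarrow> real set" where
  "end_part S Lend c = {x \<in> dom_int S. x < c}"
| "end_part S Rend c = {x \<in> dom_int S. c < x}"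

definition integrable_near :: "sl_data \<Rightarrow> endpoint \<Rightarrow> (real \<Rightarrow> real) \<Rightarrow> bool" where
  "integrable_near S e g \<longleftrightarrow>
     (\<exists>c\<in>dom_int S. integrable (lebesgue_on (end_part S e c)) g)"

definition limit_circle :: "sl_data \<Rightarrow> endpoint \<Rightarrow> bool" where
  "limit_circle S e \<longleftrightarrow>
     (\<forall>z y. sl_solution S z y \<longrightarrow> integrable_near S e (\<lambda>x. (cmod (y x))\<^sup>2 * cw S x))"


section \<open>Maximal and minimal operators\<close>

definition bracket :: "sl_data \<Rightarrow> (real \<Rightarrow> complex) \<Rightarrow> (real \<Rightarrow> complex) \<Rightarrow> real \<Rightarrow> complex" where
  "bracket S f g x = f x * cnj (quasi_deriv S g x) - quasi_deriv S f x * cnj (g x)"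

definition end_bracket ::
    "sl_data \<Rightarrow> endpoint \<Rightarrow> (real \<Rightarrow> complex) \<Rightarrow> (real \<Rightarrow> complex) \<Rightarrow> complex" where
  "end_bracket S e f g = Lim (end_filter S e) (bracket S f g)"

definition Dmax :: "sl_data \<Rightarrow> (real \<Rightarrow> complex) set" where
  "Dmax S = {f. sl_regular S f \<and> f \<in> L2_space S \<and> ell S f \<in> L2_space S}"

definition Dmin :: "sl_data \<Rightarrow> (real \<Rightarrow> complex) set" where
  "Dmin S = {f \<in> Dmax S. \<forall>g\<in>Dmax S. end_bracket S Rend f g - end_bracket S Lend f g = 0}"

text \<open>Operators in \<open>L\<^sup>2[(a,b),w]\<close> are represented by their graphs.\<close>

type_synonym L2_operator = "((real \<Rightarrow> complex) \<times> (real \<Rightarrow> complex)) set"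

definition Lmax :: "sl_data \<Rightarrow> L2_operator" where
  "Lmax S = {(f, ell S f) | f. f \<in> Dmax S}"

definition Lmin :: "sl_data \<Rightarrow> L2_operator" where
  "Lmin S = {(f, g) \<in> Lmax S. f \<in> Dmin S}"

definition bounded_below :: "sl_data \<Rightarrow> L2_operator \<Rightarrow> real \<Rightarrow> bool" where
  "bounded_below S T K \<longleftrightarrow>
     (\<forall>(f, g)\<in>T. L2_inner S g f \<in> \<real> \<and> Re (L2_inner S g f) \<ge> K * Re (L2_inner S f f))"

text \<open>\<open>z\<close> is in the resolvent set iff \<open>T - z\<close> is a bijection of the domain onto the whole
  of \<open>L\<^sup>2\<close> (modulo a.e. equality) with bounded inverse.\<close>

definition resolvent_set :: "sl_data \<Rightarrow> L2_operator \<Rightarrow> complex set" where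
  "resolvent_set S T = {z.
     (\<forall>h\<in>L2_space S. \<exists>(f, g)\<in>T. L2_eq S (\<lambda>x. g x - z * f x) h) \<and>
     (\<forall>(f, g)\<in>T. L2_eq S (\<lambda>x. g x - z * f x) (\<lambda>x. 0) \<longrightarrow> L2_eq S f (\<lambda>x. 0)) \<and>
     (\<exists>C. \<forall>(f, g)\<in>T. L2_norm S f \<le> C * L2_norm S (\<lambda>x. g x - z * f x))}"

definition spectrum :: "sl_data \<Rightarrow> L2_operator \<Rightarrow> complex set" where
  "spectrum S T = UNIV - resolvent_set S T"

definition eigenvalue :: "sl_data \<Rightarrow> L2_operator \<Rightarrow> complex \<Rightarrow> bool" where
  "eigenvalue S T z \<longleftrightarrow>
     (\<exists>(f, g)\<in>T. \<not> L2_eq S f (\<lambda>x. 0) \<and> L2_eq S g (\<lambda>x. z * f x))"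


section \<open>Principal and non-principal solutions, boundary maps\<close>

definition cfun :: "(real \<Rightarrow> real) \<Rightarrow> real \<Rightarrow> complex" where
  "cfun u = (\<lambda>x. complex_of_real (u x))"

text \<open>Nontriviality is required because \<open>1 / 0 = 0\<close> would make the zero solution non-principal.\<close>

definition nontrivial_real_solution :: "sl_data \<Rightarrow> real \<Rightarrow> (real \<Rightarrow> real) \<Rightarrow> bool" where
  "nontrivial_real_solution S l u \<longleftrightarrow>
     sl_solution S (of_real l) (cfun u) \<and> (\<exists>x\<in>dom_int S. u x \<noteq> 0)"

definition principal :: "sl_data \<Rightarrow> endpoint \<Rightarrow> real \<Rightarrow> (real \<Rightarrow> real) \<Rightarrow> bool" where
  "principal S e l u \<longleftrightarrow> nontrivial_real_solution S l u \<and>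
     \<not> integrable_near S e (\<lambda>x. 1 / (cp S x * (u x)\<^sup>2))"

definition non_principal :: "sl_data \<Rightarrow> endpoint \<Rightarrow> real \<Rightarrow> (real \<Rightarrow> real) \<Rightarrow> bool" where
  "non_principal S e l v \<longleftrightarrow> nontrivial_real_solution S l v \<and>
     integrable_near S e (\<lambda>x. 1 / (cp S x * (v x)\<^sup>2))"

text \<open>Below \<open>u Lend, u Rend\<close> and \<open>v Lend, v Rend\<close> stand for \<open>u\<^sub>a, u\<^sub>b\<close> and \<open>v\<^sub>a, v\<^sub>b\<close>.\<close>

definition boundary_basis ::
    "sl_data \<Rightarrow> real \<Rightarrow> (endpoint \<Rightarrow> real \<Rightarrow> real) \<Rightarrow> (endpoint \<Rightarrow> real \<Rightarrow> real) \<Rightarrow> bool" where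
  "boundary_basis S l u v \<longleftrightarrow>
     (\<forall>e. principal S e l (u e) \<and> non_principal S e l (v e) \<and>
          end_bracket S e (cfun (u e)) (cfun (v e)) = 1)"

definition bv0 ::
    "sl_data \<Rightarrow> (endpoint \<Rightarrow> real \<Rightarrow> real) \<Rightarrow> endpoint \<Rightarrow> (real \<Rightarrow> complex) \<Rightarrow> complex" where
  "bv0 S v e f = end_bracket S e f (cfun (v e))"

definition bv1 ::
    "sl_data \<Rightarrow> (endpoint \<Rightarrow> real \<Rightarrow> real) \<Rightarrow> endpoint \<Rightarrow> (real \<Rightarrow> complex) \<Rightarrow> complex" where
  "bv1 S u e f = - end_bracket S e f (cfun (u e))"

definition Gamma0 ::
    "sl_data \<Rightarrow> (endpoint \<Rightarrow> real \<Rightarrow> real) \<Rightarrow> (real \<Rightarrow> complex) \<Rightarrow> complex ^ 2" where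
  "Gamma0 S v f = vector [bv0 S v Lend f, bv0 S v Rend f]"

definition Gamma1 ::
    "sl_data \<Rightarrow> (endpoint \<Rightarrow> real \<Rightarrow> real) \<Rightarrow> (real \<Rightarrow> complex) \<Rightarrow> complex ^ 2" where
  "Gamma1 S u f = vector [bv1 S u Lend f, - bv1 S u Rend f]"


section \<open>Linear relations and extensions\<close>

type_synonym relation2 = "((complex ^ 2) \<times> (complex ^ 2)) set"

definition linear_relation :: "relation2 \<Rightarrow> bool" where
  "linear_relation \<theta> \<longleftrightarrow> (0, 0) \<in> \<theta> \<and>
     (\<forall>(x, y)\<in>\<theta>. \<forall>(x', y')\<in>\<theta>. (x + x', y + y') \<in> \<theta>) \<and>
     (\<forall>c. \<forall>(x, y)\<in>\<theta>. (c *s x, c *s y) \<in> \<theta>)"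

text \<open>The library inner product on \<open>complex ^ 2\<close> is the real one, hence the explicit
  Hermitian form.\<close>

definition cinner2 :: "complex ^ 2 \<Rightarrow> complex ^ 2 \<Rightarrow> complex" where
  "cinner2 x y = (\<Sum>i\<in>UNIV. x $ i * cnj (y $ i))"

definition adjoint_relation :: "relation2 \<Rightarrow> relation2" where
  "adjoint_relation \<theta> = {(x', y'). \<forall>(x, y)\<in>\<theta>. cinner2 y x' = cinner2 x y'}"

definition sa_relations :: "relation2 set" where
  "sa_relations = {\<theta>. linear_relation \<theta> \<and> adjoint_relation \<theta> = \<theta>}"

definition matrix_graph :: "complex ^ 2 ^ 2 \<Rightarrow> relation2" where
  "matrix_graph A = {(x, A *v x) | x. True}"

definition hermitian_matrix :: "complex ^ 2 ^ 2 \<Rightarrow> bool" where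
  "hermitian_matrix A \<longleftrightarrow> (\<forall>i j. A $ i $ j = cnj (A $ j $ i))"

definition hermitian_graphs :: "relation2 set" where
  "hermitian_graphs = matrix_graph ` {A. hermitian_matrix A}"

definition L_zero :: "sl_data \<Rightarrow> (endpoint \<Rightarrow> real \<Rightarrow> real) \<Rightarrow> L2_operator" where
  "L_zero S v = {(f, g) \<in> Lmax S. Gamma0 S v f = 0}"

definition L_infty :: "sl_data \<Rightarrow> (endpoint \<Rightarrow> real \<Rightarrow> real) \<Rightarrow> L2_operator" where
  "L_infty S u = {(f, g) \<in> Lmax S. Gamma1 S u f = 0}"

definition L_ext :: "sl_data \<Rightarrow> (endpoint \<Rightarrow> real \<Rightarrow> real) \<Rightarrow> (endpoint \<Rightarrow> real \<Rightarrow> real) \<Rightarrow>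
    relation2 \<Rightarrow> L2_operator" where
  "L_ext S u v \<theta> = {(f, g) \<in> Lmax S. (Gamma0 S v f, Gamma1 S u f) \<in> \<theta>}"

definition Sigma_M ::
    "sl_data \<Rightarrow> (endpoint \<Rightarrow> real \<Rightarrow> real) \<Rightarrow> (endpoint \<Rightarrow> real \<Rightarrow> real) \<Rightarrow> complex set" where
  "Sigma_M S u v = (\<Union>\<theta>\<in>hermitian_graphs. spectrum S (L_ext S u v \<theta>))"

definition Sigma_E ::
    "sl_data \<Rightarrow> (endpoint \<Rightarrow> real \<Rightarrow> real) \<Rightarrow> (endpoint \<Rightarrow> real \<Rightarrow> real) \<Rightarrow> complex set" where
  "Sigma_E S u v = spectrum S (L_zero S v) \<inter> spectrum S (L_infty S u)"

definition Sigma_R ::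
    "sl_data \<Rightarrow> (endpoint \<Rightarrow> real \<Rightarrow> real) \<Rightarrow> (endpoint \<Rightarrow> real \<Rightarrow> real) \<Rightarrow> complex set" where
  "Sigma_R S u v =
     (\<Union>\<theta>\<in>sa_relations. spectrum S (L_ext S u v \<theta>)) - (Sigma_M S u v \<union> Sigma_E S u v)"

end

theory Submission
  imports Defs
begin

text \<open>Let \<open>z\<close> be an eigenvalue of \<open>L(\<theta>)\<close>. By Green's formula
  \<open>\<langle>L f, g\<rangle> - \<langle>f, L g\<rangle> = \<langle>\<Gamma>1 f, \<Gamma>0 g\<rangle> - \<langle>\<Gamma>0 f, \<Gamma>1 g\<rangle>\<close>, \<open>z\<close> is real, and every solution \<open>y\<close>
  of \<open>\<ell> y = z y\<close> has \<open>\<langle>\<Gamma>1 y, \<Gamma>0 y\<rangle>\<close> real. If \<open>\<Gamma>0 y \<noteq> 0\<close>, this is exactly the condition for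
  a Hermitian matrix \<open>A\<close> with \<open>A (\<Gamma>0 y) = \<Gamma>1 y\<close> to exist, so \<open>z\<close> is an eigenvalue of \<open>L(A)\<close>.
  If \<open>\<Gamma>0\<close> kills the eigenfunction, \<open>z\<close> is an eigenvalue of \<open>L\<^sub>0\<close> and hence in the resolvent set of
  \<open>L\<^sub>\<infinity>\<close>; then \<open>\<Gamma>1\<close> maps the solutions onto \<open>\<complex>\<^sup>2\<close>, and \<open>\<Gamma>0\<close> cannot vanish on all of them because
  both boundary conditions are separated. For the last claim one needs in addition that a spectral
  point of \<open>L(\<theta>)\<close> that lies in the resolvent set of \<open>L\<^sub>0\<close> or \<open>L\<^sub>\<infinity>\<close> is an eigenvalue, since \<open>L(\<theta>)\<close>
  is a finite-dimensional perturbation of them.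

  Surjectivity of \<open>(\<Gamma>0, \<Gamma>1)\<close> is obtained by variation of constants with the solutions
  \<open>u\<close>, \<open>v\<close> given at an endpoint. Derivatives of absolutely continuous functions are obtained from
  the Radon--Nikodym theorem applied to their variation.\<close>

section \<open>Indefinite integrals and functions of bounded variation\<close>

text \<open>Absolute continuity is defined by epsilon and delta, so the fundamental theorem of
  calculus is needed in both directions: an absolutely continuous function is the integral of its
  derivative, which gives the Lagrange identity and the limits of brackets at the endpoints; and an
  indefinite integral is absolutely continuous, which puts functions built by variation of constants
  into \<open>Dmax\<close>. Surjectivity of \<open>(Gamma0, Gamma1)\<close> has two uses. It turns a
  resolvent point of one extension into many null solutions: a function with prescribed boundary
  values, minus the solution of the same inhomogeneous equation inside the extension, solves the
  homogeneous one. And it turns Green's formula into a bound of boundary values by the graph norm,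
  so that passing to another extension keeps the inverse bounded. The passage is real linear
  algebra: pairs of boundary values form a space of dimension 8 and self-adjoint relations have
  dimension 4, so the boundary values of null solutions have dimension at least 4 and complement
  every self-adjoint relation that they meet only in zero.\<close>

lemma indefinite_integral_has_vector_derivative_ae:
  fixes g :: "real \<Rightarrow> 'b::euclidean_space"
  assumes g: "\<And>a b. g integrable_on {a..b}"
  obtains N where "negligible N"
    "\<And>x c. x \<notin> N \<Longrightarrow> c < x \<Longrightarrow> ((\<lambda>t. integral {c..t} g) has_vector_derivative g x) (at x)"
proof -
  obtain N1 where N1: "negligible N1"
    "\<And>x e. x \<notin> N1 \<Longrightarrow> 0 < e \<Longrightarrow> \<exists>d>0. \<forall>h. 0 < h \<and> h < d \<longrightarrow> norm (integral {x..x + h} g /\<^sub>R h - g x) < e"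
    using integrable_ccontinuous_explicit[where f = g] g by (auto simp: box_real)
  \<comment> \<open>Difference quotients from the right are controlled first; the same theorem for
    the reflected function controls those from the left, at the price of reflecting its exceptional
    set.\<close>
  have g': "(\<lambda>x. g (- x)) integrable_on {a..b}" for a b
    using g[of "- b" "- a"] Henstock_Kurzweil_Integration.integrable_reflect_real[where f = g and a = "- b" and b = "- a"] by simp
  obtain N2 where N2: "negligible N2"
    "\<And>x e. x \<notin> N2 \<Longrightarrow> 0 < e \<Longrightarrow>
       \<exists>d>0. \<forall>h. 0 < h \<and> h < d \<longrightarrow> norm (integral {x..x + h} (\<lambda>x. g (- x)) /\<^sub>R h - g (- x)) < e"
    using integrable_ccontinuous_explicit[where f = "\<lambda>x. g (- x)"] g' by (auto simp: box_real)
  have "negligible (uminus ` N2)"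
    using N2(1) by (intro negligible_differentiable_image_negligible)
      (auto intro!: derivative_intros differentiable_at_imp_differentiable_on simp: differentiable_on_def)
  then have "negligible (N1 \<union> uminus ` N2)"
    using N1(1) by simp
  moreover have "((\<lambda>t. integral {c..t} g) has_vector_derivative g x) (at x)"
    if x: "x \<notin> N1 \<union> uminus ` N2" and c: "c < x" for x c
    unfolding has_vector_derivative_def has_derivative_at_alt
  proof (intro conjI allI impI)
    show "bounded_linear (\<lambda>h. h *\<^sub>R g x)"
      by (rule bounded_linear_scaleR_left)
    fix e :: real assume e: "e > 0"
    have "- x \<notin> N2"
      using x by force
    with N2(2)[OF this e] obtain d2 where d2: "d2 > 0"
      "\<And>h. 0 < h \<Longrightarrow> h < d2 \<Longrightarrow> norm (integral {- x..- x + h} (\<lambda>x. g (- x)) /\<^sub>R h - g x) < e"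
      by auto
    have "x \<notin> N1" using x by blast
    from N1(2)[OF this e] obtain d1 where d1: "d1 > 0"
      "\<And>h. 0 < h \<Longrightarrow> h < d1 \<Longrightarrow> norm (integral {x..x + h} g /\<^sub>R h - g x) < e"
      by auto
    have *: "norm (a - h *\<^sub>R b) \<le> e * h" if "norm (a /\<^sub>R h - b) < e" "0 < h" for a b :: 'b and h
    proof -
      have "a - h *\<^sub>R b = h *\<^sub>R (a /\<^sub>R h - b)"
        using that by (simp add: algebra_simps)
      then show ?thesis
        using that by (simp add: mult.commute mult_left_mono)
    qed
    show "\<exists>d>0. \<forall>y. norm (y - x) < d \<longrightarrow>
       norm (integral {c..y} g - integral {c..x} g - (y - x) *\<^sub>R g x) \<le> e * norm (y - x)"
    \<comment> \<open>Staying within \<open>x - c\<close> keeps \<open>y\<close> to the right of the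
      base point \<open>c\<close>, where the integral over \<open>{c..y}\<close> is
      additive.\<close>
    proof (intro exI[of _ "min (x - c) (min d1 d2)"] conjI allI impI)
      show "0 < min (x - c) (min d1 d2)" using c d1 d2 by simp
      fix y assume y: "norm (y - x) < min (x - c) (min d1 d2)"
      consider "y = x" | "y > x" | "y < x" by linarith
      then show "norm (integral {c..y} g - integral {c..x} g - (y - x) *\<^sub>R g x) \<le> e * norm (y - x)"
      proof cases
        case 2
        have "integral {c..y} g = integral {c..x} g + integral {x..y} g"
          using Henstock_Kurzweil_Integration.integral_combine[of c x y g] c 2 g by simp
        then show ?thesis
          using *[OF d1(2)[of "y - x"]] 2 y by auto
      next
        case 3
        have "integral {c..x} g = integral {c..y} g + integral {y..x} g"
          using Henstock_Kurzweil_Integration.integral_combine[of c y x g] c 3 y g by (simp add: abs_if)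
        moreover have "integral {- x..- y} (\<lambda>x. g (- x)) = integral {y..x} g"
          using integral_reflect_real[of x y g] by simp
        moreover have "norm (integral {- x..- y} (\<lambda>x. g (- x)) - (x - y) *\<^sub>R g x) \<le> e * (x - y)"
          using *[OF d2(2)[of "x - y"]] 3 y by (auto simp: abs_if split: if_splits)
        ultimately have "norm (integral {y..x} g - (x - y) *\<^sub>R g x) \<le> e * (x - y)"
          by simp
        moreover have "integral {c..y} g - integral {c..x} g - (y - x) *\<^sub>R g x =
           - (integral {y..x} g - (x - y) *\<^sub>R g x)"
          using \<open>integral {c..x} g = _\<close> by (simp add: algebra_simps)
        ultimately show ?thesis
          using 3 by (metis abs_minus_commute abs_of_pos diff_gt_0_iff_gt norm_minus_cancel real_norm_def)
      qed simp
    qed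
  qed
  ultimately show ?thesis
    by (rule that)
qed

section \<open>Absolutely continuous real functions on the line; the monotone case by
  Radon-Nikodym\<close>

definition ac_fun :: "(real \<Rightarrow> real) \<Rightarrow> bool" where
  "ac_fun f \<longleftrightarrow> (\<forall>\<epsilon>>0. \<exists>\<delta>>0. \<forall>(n::nat) s t. (\<forall>i<n. s i \<le> t i) \<longrightarrow>
     disjoint_family_on (\<lambda>i. {s i<..<t i}) {..<n} \<longrightarrow> (\<Sum>i<n. t i - s i) < \<delta> \<longrightarrow>
     (\<Sum>i<n. \<bar>f (t i) - f (s i)\<bar>) < \<epsilon>)"

text \<open>A free index type matters twice: coverings are indexed by the intervals themselves, and
  refinements of a family by pairs of indices.\<close>

lemma ac_fun_finite:
  assumes "ac_fun f" "\<epsilon> > 0"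
  obtains \<delta> where "\<delta> > 0"
    "\<And>(J::'i set) s t. finite J \<Longrightarrow> (\<And>i. i \<in> J \<Longrightarrow> s i \<le> t i) \<Longrightarrow>
      disjoint_family_on (\<lambda>i. {s i<..<t i}) J \<Longrightarrow> (\<Sum>i\<in>J. t i - s i) < \<delta> \<Longrightarrow>
      (\<Sum>i\<in>J. \<bar>f (t i) - f (s i)\<bar>) < \<epsilon>"
proof -
  obtain \<delta> where \<delta>: "\<delta> > 0" "\<And>(n::nat) s t. (\<forall>i<n. s i \<le> t i) \<Longrightarrow>
     disjoint_family_on (\<lambda>i. {s i<..<t i}) {..<n} \<Longrightarrow> (\<Sum>i<n. t i - s i) < \<delta> \<Longrightarrow>
     (\<Sum>i<n. \<bar>f (t i) - f (s i)\<bar>) < \<epsilon>"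
    using assms unfolding ac_fun_def by meson
  show ?thesis
  proof (rule that[OF \<delta>(1)])
    fix J :: "'i set" and s t
    assume J: "finite J" "\<And>i. i \<in> J \<Longrightarrow> s i \<le> t i"
      "disjoint_family_on (\<lambda>i. {s i<..<t i}) J" "(\<Sum>i\<in>J. t i - s i) < \<delta>"
    obtain h where h: "bij_betw h {..<card J} J"
      using ex_bij_betw_nat_finite[OF J(1)] by (metis atLeast0LessThan)
    have sum: "(\<Sum>i<card J. k (h i)) = (\<Sum>i\<in>J. k i)" for k :: "'i \<Rightarrow> real"
      by (rule sum.reindex_bij_betw[OF h])
    have hJ: "h i \<in> J" if "i < card J" for i
      using h that by (auto simp: bij_betw_def)
    have "disjoint_family_on (\<lambda>i. {s (h i)<..<t (h i)}) {..<card J}"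
      unfolding disjoint_family_on_def
    proof (intro ballI impI)
      fix m n assume "m \<in> {..<card J}" "n \<in> {..<card J}" "m \<noteq> n"
      moreover from this have "h m \<noteq> h n"
        using h by (auto simp: bij_betw_def inj_on_def)
      ultimately show "{s (h m)<..<t (h m)} \<inter> {s (h n)<..<t (h n)} = {}"
        using J(3) hJ by (auto simp: disjoint_family_on_def)
    qed
    then show "(\<Sum>i\<in>J. \<bar>f (t i) - f (s i)\<bar>) < \<epsilon>"
      using \<delta>(2)[of "card J" "\<lambda>i. s (h i)" "\<lambda>i. t (h i)"] J(2,4) hJ
      by (simp add: sum[of "\<lambda>i. t i - s i"] sum[of "\<lambda>i. \<bar>f (t i) - f (s i)\<bar>"])
  qed
qed

lemma ac_fun_isCont:
  assumes "ac_fun f"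
  shows "isCont f x"
  unfolding continuous_at_eps_delta
proof (intro allI impI)
  fix e :: real assume "e > 0"
  obtain d where d: "d > 0" "\<And>(J::nat set) s t. finite J \<Longrightarrow> (\<And>i. i \<in> J \<Longrightarrow> s i \<le> t i) \<Longrightarrow>
      disjoint_family_on (\<lambda>i. {s i<..<t i}) J \<Longrightarrow> (\<Sum>i\<in>J. t i - s i) < d \<Longrightarrow>
      (\<Sum>i\<in>J. \<bar>f (t i) - f (s i)\<bar>) < e"
    by (rule ac_fun_finite[OF assms \<open>e > 0\<close>, where 'i = nat], rule that; blast)
  have "\<bar>f y - f x\<bar> < e" if "\<bar>y - x\<bar> < d" for y
    using d(2)[of "{0}" "\<lambda>_. min x y" "\<lambda>_. max x y"] that
    by (auto simp: disjoint_family_on_def min_def max_def abs_if split: if_splits)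
  then show "\<exists>d>0. \<forall>y. dist y x < d \<longrightarrow> dist (f y) (f x) < e"
    using d(1) by (auto simp: dist_real_def)
qed

lemma ac_fun_diff:
  assumes "ac_fun f" "ac_fun g"
  shows "ac_fun (\<lambda>x. f x - g x)"
  unfolding ac_fun_def
proof (intro allI impI)
  fix e :: real assume "e > 0"
  then have e: "e / 2 > 0" by simp
  obtain d1 where d1: "d1 > 0" "\<And>(J::nat set) s t. finite J \<Longrightarrow> (\<And>i. i \<in> J \<Longrightarrow> s i \<le> t i) \<Longrightarrow>
      disjoint_family_on (\<lambda>i. {s i<..<t i}) J \<Longrightarrow> (\<Sum>i\<in>J. t i - s i) < d1 \<Longrightarrow>
      (\<Sum>i\<in>J. \<bar>f (t i) - f (s i)\<bar>) < e / 2"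
    by (rule ac_fun_finite[OF assms(1) e, where 'i = nat], rule that; blast)
  obtain d2 where d2: "d2 > 0" "\<And>(J::nat set) s t. finite J \<Longrightarrow> (\<And>i. i \<in> J \<Longrightarrow> s i \<le> t i) \<Longrightarrow>
      disjoint_family_on (\<lambda>i. {s i<..<t i}) J \<Longrightarrow> (\<Sum>i\<in>J. t i - s i) < d2 \<Longrightarrow>
      (\<Sum>i\<in>J. \<bar>g (t i) - g (s i)\<bar>) < e / 2"
    by (rule ac_fun_finite[OF assms(2) e, where 'i = nat], rule that; blast)
  show "\<exists>\<delta>>0. \<forall>(n::nat) s t. (\<forall>i<n. s i \<le> t i) \<longrightarrow>
     disjoint_family_on (\<lambda>i. {s i<..<t i}) {..<n} \<longrightarrow> (\<Sum>i<n. t i - s i) < \<delta> \<longrightarrow>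
     (\<Sum>i<n. \<bar>(f (t i) - g (t i)) - (f (s i) - g (s i))\<bar>) < e"
  proof (intro exI[of _ "min d1 d2"] conjI allI impI)
    fix n :: nat and s t :: "nat \<Rightarrow> real"
    assume "\<forall>i<n. s i \<le> t i" "disjoint_family_on (\<lambda>i. {s i<..<t i}) {..<n}" "(\<Sum>i<n. t i - s i) < min d1 d2"
    then have "(\<Sum>i<n. \<bar>f (t i) - f (s i)\<bar>) < e / 2" "(\<Sum>i<n. \<bar>g (t i) - g (s i)\<bar>) < e / 2"
      using d1(2)[of "{..<n}" s t] d2(2)[of "{..<n}" s t] by auto
    moreover have "(\<Sum>i<n. \<bar>(f (t i) - g (t i)) - (f (s i) - g (s i))\<bar>)
        \<le> (\<Sum>i<n. \<bar>f (t i) - f (s i)\<bar> + \<bar>g (t i) - g (s i)\<bar>)"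
      by (rule sum_mono) auto
    ultimately show "(\<Sum>i<n. \<bar>(f (t i) - g (t i)) - (f (s i) - g (s i))\<bar>) < e"
      by (simp add: sum.distrib)
  qed (use d1 d2 in auto)
qed

text \<open>A null set is covered by countably many nonoverlapping closed intervals of small total
  length. Absolute continuity makes the increments of \<open>F\<close> over finitely many of them
  small, and continuity of the measure from below passes to all of them. Boundedness of
  \<open>N\<close> is what the covering theorem asks for.\<close>

lemma mono_ac_fun_null_sets:
  assumes F: "mono F" "ac_fun F" and N: "N \<in> null_sets lborel" "N \<subseteq> {a..b}"
  shows "emeasure (interval_measure F) N = 0"
proof -
  have cont: "continuous_on UNIV F"
    using ac_fun_isCont[OF F(2)] by (simp add: continuous_at_imp_continuous_on)
  have Fm: "x \<le> y \<Longrightarrow> F x \<le> F y" for x y using F(1) by (rule monoD)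
  have Icc: "emeasure (interval_measure F) {x..y} = F y - F x" if "x \<le> y" for x y
    by (rule emeasure_interval_measure_Icc[OF that Fm cont])
  have "emeasure (interval_measure F) N \<le> ennreal e" if e: "e > 0" for e
  proof -
    obtain d where d: "d > 0" "\<And>(J::real set set) s t. finite J \<Longrightarrow> (\<And>i. i \<in> J \<Longrightarrow> s i \<le> t i) \<Longrightarrow>
      disjoint_family_on (\<lambda>i. {s i<..<t i}) J \<Longrightarrow> (\<Sum>i\<in>J. t i - s i) < d \<Longrightarrow>
      (\<Sum>i\<in>J. \<bar>F (t i) - F (s i)\<bar>) < e"
      by (rule ac_fun_finite[OF F(2) e, where 'i = "real set"], rule that; blast)
    have negN: "negligible N"
      using N(1) by (simp add: negligible_iff_null_sets null_sets_completionI)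
    have "N \<in> lmeasurable" "N \<subseteq> cbox a b" "measure lebesgue N = 0"
      using negN N(2) by (simp_all add: negligible_imp_measurable negligible_imp_measure0)
    \<comment> \<open>Total length at most \<open>d / 2\<close> leaves room for the strict bound by
      \<open>d\<close> in absolute continuity.\<close>
    then obtain D where D: "countable D"
        "\<And>K. K \<in> D \<Longrightarrow> K \<subseteq> cbox a b \<and> K \<noteq> {} \<and> (\<exists>c d. K = cbox c d)"
        "pairwise (\<lambda>A B. interior A \<inter> interior B = {}) D"
        "N \<subseteq> \<Union>D" "\<Union>D \<in> lmeasurable" "measure lebesgue (\<Union>D) \<le> d / 2"
      using measurable_outer_intervals_bounded[of N a b "d / 2"] d(1)
      by (metis add_0 half_gt_zero)
    define s t where "s = (\<lambda>K::real set. Inf K)" and "t = (\<lambda>K::real set. Sup K)"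
    have K: "K = {s K..t K} \<and> s K \<le> t K" if "K \<in> D" for K
      using D(2)[OF that] by (auto simp: s_def t_def box_real)
    have fin: "(\<Sum>K\<in>J. emeasure (interval_measure F) K) \<le> ennreal e" if J: "finite J" "J \<subseteq> D" for J
    proof -
      have disj: "disjoint_family_on (\<lambda>i. {s i<..<t i}) J"
        unfolding disjoint_family_on_def
      proof (intro ballI impI)
        fix A B assume AB: "A \<in> J" "B \<in> J" "A \<noteq> B"
        then have "interior A \<inter> interior B = {}"
          using D(3) J by (auto simp: pairwise_def)
        moreover have "interior A = {s A<..<t A}" "interior B = {s B<..<t B}"
          using K AB J by (metis interior_atLeastAtMost_real subsetD)+
        ultimately show "{s A<..<t A} \<inter> {s B<..<t B} = {}" by simp
      qed
      have fin: "emeasure lborel {s K<..<t K} \<noteq> \<infinity>" for K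
        by (cases "s K \<le> t K") auto
      have "(\<Sum>K\<in>J. t K - s K) = (\<Sum>K\<in>J. measure lebesgue {s K<..<t K})"
        using K J by (intro sum.cong) auto
      also have "\<dots> = measure lebesgue (\<Union>K\<in>J. {s K<..<t K})"
        by (rule measure_finite_Union[symmetric]) (use J disj fin in auto)
      also have "\<dots> \<le> measure lebesgue (\<Union>D)"
      proof (rule measure_mono_fmeasurable)
        show "(\<Union>K\<in>J. {s K<..<t K}) \<subseteq> \<Union>D"
        proof
          fix x assume "x \<in> (\<Union>K\<in>J. {s K<..<t K})"
          then obtain K' where "K' \<in> J" "s K' < x" "x < t K'" by auto
          then have "x \<in> {s K'..t K'}" "K' \<in> D" using J by auto
          then show "x \<in> \<Union>D" using K[of K'] by (metis UnionI)
        qed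
      qed (use D J in auto)
      finally have "(\<Sum>K\<in>J. t K - s K) < d"
        using D(6) d(1) by linarith
      then have "(\<Sum>K\<in>J. \<bar>F (t K) - F (s K)\<bar>) < e"
        using J K disj by (intro d(2)) auto
      moreover have "(\<Sum>K\<in>J. emeasure (interval_measure F) K) = ennreal (\<Sum>K\<in>J. \<bar>F (t K) - F (s K)\<bar>)"
      proof (subst sum_ennreal[symmetric])
        show "(\<Sum>K\<in>J. emeasure (interval_measure F) K) = (\<Sum>K\<in>J. ennreal \<bar>F (t K) - F (s K)\<bar>)"
        proof (rule sum.cong)
          fix A assume "A \<in> J"
          then have A: "A = {s A..t A}" "s A \<le> t A" using K J by auto
          have "emeasure (interval_measure F) A = emeasure (interval_measure F) {s A..t A}"
            using A(1) by simp
          then show "emeasure (interval_measure F) A = ennreal \<bar>F (t A) - F (s A)\<bar>"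
            using Icc[OF A(2)] Fm[OF A(2)] by simp
        qed simp
      qed auto
      ultimately show ?thesis by (simp add: ennreal_leI)
    qed
    have "emeasure (interval_measure F) N \<le> emeasure (interval_measure F) (\<Union>D)"
    proof (rule emeasure_mono[OF D(4)])
      have "K \<in> sets (interval_measure F)" if "K \<in> D" for K
      proof -
        have "K = {s K..t K}" using K[OF that] by simp
        then show ?thesis by (metis atLeastAtMost_borel sets_interval_measure)
      qed
      then show "\<Union>D \<in> sets (interval_measure F)"
        using D(1) by (intro sets.countable_Union) auto
    qed
    also have "\<dots> \<le> ennreal e"
    proof (cases "D = {}")
      case False
      let ?A = "\<lambda>n. \<Union> (from_nat_into D ` {..n::nat})"
      have meas: "K \<in> sets (interval_measure F)" if "K \<in> D" for K
      proof -
        have "K = {s K..t K}" using K[OF that] by simp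
        then show ?thesis by (metis atLeastAtMost_borel sets_interval_measure)
      qed
      have sub: "from_nat_into D ` {..n} \<subseteq> D" for n
        using False by (auto intro: from_nat_into)
      have "\<Union>D = (\<Union>n. ?A n)"
          proof -
        have "(\<Union>n. ?A n) = \<Union> (range (from_nat_into D))" by auto
        then show ?thesis using range_from_nat_into[OF False D(1)] by simp
      qed
      moreover have "(SUP n. emeasure (interval_measure F) (?A n)) = emeasure (interval_measure F) (\<Union>n. ?A n)"
        by (rule SUP_emeasure_incseq) (use meas sub in \<open>auto simp: incseq_def intro!: sets.finite_Union Union_mono image_mono\<close>)
      moreover have "emeasure (interval_measure F) (?A n) \<le> ennreal e" for n
      proof -
        have "emeasure (interval_measure F) (\<Union>K\<in>from_nat_into D ` {..n}. K)
          \<le> (\<Sum>K\<in>from_nat_into D ` {..n}. emeasure (interval_measure F) K)"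
          by (rule emeasure_subadditive_finite) (use meas sub in auto)
        also have "\<dots> \<le> ennreal e"
          by (rule fin) (use sub in auto)
        finally show ?thesis by simp
      qed
      then have "(SUP n. emeasure (interval_measure F) (?A n)) \<le> ennreal e"
        by (rule SUP_least)
      ultimately show ?thesis by simp
    qed simp
    finally show ?thesis .
  qed
  then have "emeasure (interval_measure F) N \<le> 0"
    using ennreal_le_epsilon[of 0 "emeasure (interval_measure F) N"] by auto
  then show ?thesis by simp
qed


text \<open>The Stieltjes measure of \<open>F\<close> does not charge null sets, so it has a
  Radon-Nikodym density. The density takes extended values, but it is finite almost everywhere
  because bounded intervals have finite measure.\<close>

lemma mono_ac_fun_integral:
  assumes F: "mono F" "ac_fun F"
  obtains g where "\<And>a b. g absolutely_integrable_on {a..b}"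
    "\<And>a b. a \<le> b \<Longrightarrow> integral {a..b} g = F b - F a"
proof -
  have cont: "continuous_on UNIV F"
    using ac_fun_isCont[OF F(2)] by (simp add: continuous_at_imp_continuous_on)
  have Fm: "x \<le> y \<Longrightarrow> F x \<le> F y" for x y using F(1) by (rule monoD)
  have Icc: "emeasure (interval_measure F) {x..y} = F y - F x" if "x \<le> y" for x y
    by (rule emeasure_interval_measure_Icc[OF that Fm cont])
  have "absolutely_continuous lborel (interval_measure F)"
    unfolding absolutely_continuous_def
  proof
    fix N assume N: "N \<in> null_sets (lborel :: real measure)"
    have "N \<inter> {- real n..real n} \<in> null_sets (interval_measure F)" for n
      using N by (intro null_setsI mono_ac_fun_null_sets[OF F, where a = "- real n" and b = "real n"] null_set_Int2) auto
    then have "(\<Union>n. N \<inter> {- real n..real n}) \<in> null_sets (interval_measure F)"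
      by blast
    moreover have "(\<Union>n. N \<inter> {- real n..real n}) = N"
    proof -
      have "\<exists>n. - real n \<le> x \<and> x \<le> real n" for x
      proof -
        obtain n where "\<bar>x\<bar> \<le> real n" using real_arch_simple by blast
        then show ?thesis by (intro exI[of _ n]) linarith
      qed
      then show ?thesis by auto
    qed
    ultimately show "N \<in> null_sets (interval_measure F)" by simp
  qed
  then obtain h :: "real \<Rightarrow> ennreal" where h: "h \<in> borel_measurable lborel" "density lborel h = interval_measure F"
    using sigma_finite_measure.Radon_Nikodym[OF sigma_finite_lborel, of "interval_measure F"] by auto
  define g where "g = (\<lambda>x. enn2real (h x))"
  have [measurable]: "h \<in> borel_measurable borel" using h(1) by simp
  then have gm [measurable]: "g \<in> borel_measurable borel" by (simp add: g_def)
  have hI: "(\<integral>\<^sup>+x. h x * indicator {a..b} x \<partial>lborel) = ennreal (F b - F a)" if "a \<le> b" for a b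
  proof -
    have "emeasure (density lborel h) {a..b} = (\<integral>\<^sup>+x. h x * indicator {a..b} x \<partial>lborel)"
      by (rule emeasure_density) auto
    then show ?thesis using h(2) Icc[OF that] by simp
  qed
  have fin: "AE x in lborel. h x \<noteq> \<infinity>"
  proof -
    have "AE x in lborel. h x * indicator {- real n..real n} x \<noteq> \<infinity>" for n
      by (rule nn_integral_PInf_AE) (use hI[of "- real n" "real n"] in auto)
    then have "AE x in lborel. \<forall>n. h x * indicator {- real n..real n} x \<noteq> \<infinity>"
      by (simp add: AE_all_countable)
    then show ?thesis
    proof (rule AE_mp, intro AE_I2 impI)
      fix x assume *: "\<forall>n. h x * indicator {- real n..real n} x \<noteq> \<infinity>"
      obtain n where "\<bar>x\<bar> \<le> real n" using real_arch_simple by blast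
      then have "indicator {- real n..real n} x = (1::ennreal)" by (auto simp: abs_le_iff indicator_def)
      then show "h x \<noteq> \<infinity>" using *[rule_format, of n] by simp
    qed
  qed
  have gI: "((\<lambda>x. indicator {a..b} x * g x) has_integral (F b - F a)) UNIV" if "a \<le> b" for a b
  proof (rule nn_integral_has_integral)
    have "(\<integral>\<^sup>+x. ennreal (indicator {a..b} x * g x) \<partial>lborel) = (\<integral>\<^sup>+x. h x * indicator {a..b} x \<partial>lborel)"
      by (rule nn_integral_cong_AE, rule AE_mp[OF fin], intro AE_I2 impI)
         (auto simp: g_def indicator_def less_top)
    then show "(\<integral>\<^sup>+x. ennreal (indicator {a..b} x * g x) \<partial>lborel) = ennreal (F b - F a)"
      using hI[OF that] by simp
  qed (use Fm that in \<open>auto simp: g_def\<close>)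
  have gI': "(g has_integral (F b - F a)) {a..b}" if "a \<le> b" for a b
  proof -
    have "(\<lambda>x. indicator {a..b} x * g x) = (\<lambda>x. if x \<in> {a..b} then g x else 0)"
      by (auto simp: indicator_def)
    then show ?thesis
      using gI[OF that] has_integral_restrict_UNIV[of "{a..b}" g] by metis
  qed
  show ?thesis
  proof (rule that)
    fix a b :: real
    show "g absolutely_integrable_on {a..b}"
    proof (cases "a \<le> b")
      case True
      then show ?thesis
        using gI'[OF True] by (intro nonnegative_absolutely_integrable_1) (auto simp: g_def integrable_on_def)
    qed auto
    show "integral {a..b} g = F b - F a" if "a \<le> b"
      using gI'[OF that] by (rule integral_unique)
  qed
qed


section \<open>Total variation and the Jordan decomposition\<close>

lemma sum_length_disjoint_le:
  fixes s t :: "'i \<Rightarrow> real"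
  assumes "finite J" "\<And>i. i \<in> J \<Longrightarrow> a \<le> s i \<and> s i \<le> t i \<and> t i \<le> b"
    "disjoint_family_on (\<lambda>i. {s i<..<t i}) J" "a \<le> b"
  shows "(\<Sum>i\<in>J. t i - s i) \<le> b - a"
proof -
  have fin: "emeasure lborel {s i<..<t i} \<noteq> \<infinity>" for i
    by (cases "s i \<le> t i") auto
  have "(\<Sum>i\<in>J. t i - s i) = (\<Sum>i\<in>J. measure lborel {s i<..<t i})"
    using assms by (intro sum.cong) auto
  also have "\<dots> = measure lborel (\<Union>i\<in>J. {s i<..<t i})"
    by (rule measure_finite_Union[symmetric]) (use assms fin in auto)
  also have "\<dots> \<le> measure lborel {a..b}"
  proof (rule measure_mono_fmeasurable)
    show "(\<Union>i\<in>J. {s i<..<t i}) \<subseteq> {a..b}"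
    proof
      fix x assume "x \<in> (\<Union>i\<in>J. {s i<..<t i})"
      then obtain i where "i \<in> J" "s i < x" "x < t i" by auto
      then show "x \<in> {a..b}" using assms(2)[of i] by auto
    qed
    show "(\<Union>i\<in>J. {s i<..<t i}) \<in> sets lborel"
      by (simp add: borel_open open_UN)
    show "{a..b} \<in> fmeasurable lborel" using assms(4) by (simp add: fmeasurable_def)
  qed
  finally show ?thesis using assms by simp
qed

text \<open>The intervals are bounded on the right only, so \<open>variation\<close> is taken over a
  half-line. It is finite for an \<open>ac_fun\<close> that is constant near minus infinity, which
  clamping the argument to a compact interval will ensure.\<close>

definition var_family :: "real \<Rightarrow> nat \<Rightarrow> (nat \<Rightarrow> real) \<Rightarrow> (nat \<Rightarrow> real) \<Rightarrow> bool" where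
  "var_family x n s t \<longleftrightarrow> (\<forall>i<n. s i \<le> t i \<and> t i \<le> x) \<and> disjoint_family_on (\<lambda>i. {s i<..<t i}) {..<n}"

definition var_sums :: "(real \<Rightarrow> real) \<Rightarrow> real \<Rightarrow> real set" where
  "var_sums f x = {(\<Sum>i<n. \<bar>f (t i) - f (s i)\<bar>) | n s t. var_family x n s t}"

definition variation :: "(real \<Rightarrow> real) \<Rightarrow> real \<Rightarrow> real" where
  "variation f x = Sup (var_sums f x)"

lemma zero_in_var_sums: "0 \<in> var_sums f x"
  unfolding var_sums_def var_family_def
  by (rule CollectI, rule exI[of _ 0]) (auto simp: disjoint_family_on_def)

text \<open>Every interval is cut at \<open>x\<close>: minima give the part on the left, maxima the
  part on the right, and an interval lying on one side degenerates to a point on the other.\<close>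

lemma sum_split_at:
  fixes f :: "real \<Rightarrow> real"
  shows "(\<Sum>i\<in>J. \<bar>f (t i) - f (s i)\<bar>) \<le> (\<Sum>i\<in>J. \<bar>f (min (t i) x) - f (min (s i) x)\<bar>)
           + (\<Sum>i\<in>J. \<bar>f (max (t i) x) - f (max (s i) x)\<bar>)"
  unfolding sum.distrib[symmetric] by (rule sum_mono) (auto simp: min_def max_def)

lemma disjoint_family_min:
  fixes s t :: "'i \<Rightarrow> real"
  assumes "disjoint_family_on (\<lambda>i. {s i<..<t i}) J"
  shows "disjoint_family_on (\<lambda>i. {min (s i) x<..<min (t i) x}) J"
    and "disjoint_family_on (\<lambda>i. {max (s i) x<..<max (t i) x}) J"
proof -
  have "{min (s i) x<..<min (t i) x} \<subseteq> {s i<..<t i}" "{max (s i) x<..<max (t i) x} \<subseteq> {s i<..<t i}" for i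
    by (auto simp: min_def max_def split: if_splits)
  then show "disjoint_family_on (\<lambda>i. {min (s i) x<..<min (t i) x}) J"
    and "disjoint_family_on (\<lambda>i. {max (s i) x<..<max (t i) x}) J"
    using assms unfolding disjoint_family_on_def by blast+
qed

lemma var_family_min:
  assumes "var_family y n s t"
  shows "var_family x n (\<lambda>i. min (s i) x) (\<lambda>i. min (t i) x)"
  using assms disjoint_family_min(1)[of s t "{..<n}" x] unfolding var_family_def by (auto simp: min_def)

text \<open>Left of \<open>c\<close> there is no variation. With \<open>d\<close> taken from
  absolute continuity for epsilon 1, moving the right end by \<open>d / 2\<close> adds at most 1, so
  finitely many moves reach any \<open>x\<close>.\<close>

lemma bdd_above_var_sums:
  assumes f: "ac_fun f" and c: "\<And>x. x \<le> c \<Longrightarrow> f x = f c"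
  shows "bdd_above (var_sums f x)"
proof -
  obtain d where d: "d > 0" "\<And>(J::nat set) s t. finite J \<Longrightarrow> (\<And>i. i \<in> J \<Longrightarrow> s i \<le> t i) \<Longrightarrow>
      disjoint_family_on (\<lambda>i. {s i<..<t i}) J \<Longrightarrow> (\<Sum>i\<in>J. t i - s i) < d \<Longrightarrow>
      (\<Sum>i\<in>J. \<bar>f (t i) - f (s i)\<bar>) < 1"
    by (rule ac_fun_finite[OF f, where 'i = nat and \<epsilon> = 1], simp, rule that; blast)
  have "\<exists>B. \<forall>n s t. var_family (c + real k * (d / 2)) n s t \<longrightarrow> (\<Sum>i<n. \<bar>f (t i) - f (s i)\<bar>) \<le> B" for k
  proof (induction k)
    case 0
    have "(\<Sum>i<n. \<bar>f (t i) - f (s i)\<bar>) = 0" if "var_family c n s t" for n s t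
    proof (rule sum.neutral, rule ballI)
      fix i assume "i \<in> {..<n}"
      then have "s i \<le> c" "t i \<le> c" using that by (auto simp: var_family_def intro: order_trans)
      then show "\<bar>f (t i) - f (s i)\<bar> = 0" using c[of "s i"] c[of "t i"] by simp
    qed
    then show ?case by (intro exI[of _ 0]) simp
  next
    case (Suc k)
    then obtain B where B: "\<And>n s t. var_family (c + real k * (d / 2)) n s t \<Longrightarrow> (\<Sum>i<n. \<bar>f (t i) - f (s i)\<bar>) \<le> B"
      by blast
    let ?x = "c + real k * (d / 2)"
    have "(\<Sum>i<n. \<bar>f (t i) - f (s i)\<bar>) \<le> B + 1" if v: "var_family (c + real (Suc k) * (d / 2)) n s t" for n s t
    proof -
      have dj: "disjoint_family_on (\<lambda>i. {max (s i) ?x<..<max (t i) ?x}) {..<n}"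
        using v disjoint_family_min(2) unfolding var_family_def by blast
      have "(\<Sum>i<n. max (t i) ?x - max (s i) ?x) \<le> ?x + d / 2 - ?x"
        by (rule sum_length_disjoint_le[OF _ _ dj])
           (use v d(1) in \<open>auto simp: var_family_def max_def field_simps\<close>)
      then have "(\<Sum>i<n. \<bar>f (max (t i) ?x) - f (max (s i) ?x)\<bar>) < 1"
        using v d(1) by (intro d(2)[OF _ _ dj]) (auto simp: var_family_def max_def)
      then show ?thesis
        using sum_split_at[of f t s "{..<n}" ?x] B[OF var_family_min[OF v]] by force
    qed
    then show ?case by blast
  qed
  moreover obtain k where "x \<le> c + real k * (d / 2)"
  proof -
    obtain k where "(x - c) / (d / 2) \<le> real k" using real_arch_simple by blast
    then have "x - c \<le> real k * (d / 2)" using d(1) by (simp add: field_simps)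
    then show thesis by (intro that[of k]) simp
  qed
  ultimately obtain B where
    B: "\<And>n s t. var_family (c + real k * (d / 2)) n s t \<Longrightarrow> (\<Sum>i<n. \<bar>f (t i) - f (s i)\<bar>) \<le> B"
    by blast
  have "var_family (c + real k * (d / 2)) n s t" if "var_family x n s t" for n s t
    using that \<open>x \<le> _\<close> unfolding var_family_def by force
  then show ?thesis
    using B by (auto simp: var_sums_def intro!: bdd_aboveI[of _ B])
qed

lemma variation_upper:
  assumes f: "ac_fun f" and c: "\<And>x. x \<le> c \<Longrightarrow> f x = f c" and v: "var_family x n s t"
  shows "(\<Sum>i<n. \<bar>f (t i) - f (s i)\<bar>) \<le> variation f x"
  unfolding variation_def
  by (rule cSup_upper[OF _ bdd_above_var_sums[OF f c]]) (use v in \<open>auto simp: var_sums_def\<close>)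

text \<open>The interval from \<open>x\<close> to \<open>y\<close> can be appended to any family
  that stays left of \<open>x\<close>. Consequently \<open>variation f\<close> and its difference
  with \<open>f\<close> are both increasing.\<close>

lemma variation_step:
  assumes f: "ac_fun f" and c: "\<And>x. x \<le> c \<Longrightarrow> f x = f c" and "x \<le> y"
  shows "variation f x + \<bar>f y - f x\<bar> \<le> variation f y"
proof -
  have "variation f x \<le> variation f y - \<bar>f y - f x\<bar>"
    unfolding variation_def[of f x]
  proof (rule cSup_least)
    show "var_sums f x \<noteq> {}" using zero_in_var_sums by auto
    fix r assume "r \<in> var_sums f x"
    then obtain n s t where r: "r = (\<Sum>i<n. \<bar>f (t i) - f (s i)\<bar>)" "var_family x n s t"
      by (auto simp: var_sums_def)
    have dj: "{x<..<y} \<inter> {s i<..<t i} = {}" if "i < n" for i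
      using r(2) that by (force simp: var_family_def)
    have "disjoint_family_on (\<lambda>i. {(s(n := x)) i<..<(t(n := y)) i}) {..<Suc n}"
      using r(2) dj unfolding var_family_def disjoint_family_on_def
      by (auto simp: less_Suc_eq; blast)
    then have "var_family y (Suc n) (s(n := x)) (t(n := y))"
      using r(2) \<open>x \<le> y\<close> by (auto simp: var_family_def less_Suc_eq)
    from variation_upper[OF f c this] show "r \<le> variation f y - \<bar>f y - f x\<bar>"
      unfolding r(1) by simp
  qed
  then show ?thesis by simp
qed

text \<open>For each given interval, a family nearly attaining the variation up to its right end is
  cut at its left end. What lies to the left is absorbed by the variation there; what lies to the
  right sits inside the interval, so all these pieces together form a disjoint family of no greater
  total length.\<close>

lemma ac_fun_variation:
  assumes f: "ac_fun f" and c: "\<And>x. x \<le> c \<Longrightarrow> f x = f c"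
  shows "ac_fun (variation f)"
  unfolding ac_fun_def
proof (intro allI impI)
  fix e :: real assume "e > 0"
  then have e: "e / 2 > 0" by simp
  obtain d where d: "d > 0" "\<And>(J::(nat \<times> nat) set) s t. finite J \<Longrightarrow> (\<And>i. i \<in> J \<Longrightarrow> s i \<le> t i) \<Longrightarrow>
      disjoint_family_on (\<lambda>i. {s i<..<t i}) J \<Longrightarrow> (\<Sum>i\<in>J. t i - s i) < d \<Longrightarrow>
      (\<Sum>i\<in>J. \<bar>f (t i) - f (s i)\<bar>) < e / 2"
    by (rule ac_fun_finite[OF f e, where 'i = "nat \<times> nat"], rule that; blast)
  have "(\<Sum>i<n. \<bar>variation f (t i) - variation f (s i)\<bar>) < e"
    if le: "\<forall>i<n. s i \<le> t i" and dj: "disjoint_family_on (\<lambda>i. {s i<..<t i}) {..<n}"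
      and len: "(\<Sum>i<n. t i - s i) < d" for n :: nat and s t
  proof -
    \<comment> \<open>The \<open>n\<close> approximation errors add up to less than
      \<open>e / 2\<close>; the summand 1 covers \<open>n = 0\<close>.\<close>
    define \<eta> where "\<eta> = e / (2 * (real n + 1))"
    have \<eta>: "\<eta> > 0" using \<open>e > 0\<close> by (simp add: \<eta>_def)
    have "\<exists>m S T. var_family (t i) m S T \<and> variation f (t i) - \<eta> < (\<Sum>j<m. \<bar>f (T j) - f (S j)\<bar>)" for i
    proof -
      have "\<exists>r\<in>var_sums f (t i). variation f (t i) - \<eta> < r"
        unfolding variation_def
        by (rule less_cSupD) (use \<eta> zero_in_var_sums in auto)
      then show ?thesis by (auto simp: var_sums_def)
    qed
    then obtain m S T where fam: "\<And>i. var_family (t i) (m i) (S i) (T i)"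
      and app: "\<And>i. variation f (t i) - \<eta> < (\<Sum>j<m i. \<bar>f (T i j) - f (S i j)\<bar>)"
      by metis
    define S' T' where "S' = (\<lambda>(i, j). max (S i j) (s i))" and "T' = (\<lambda>(i, j). max (T i j) (s i))"
    have *: "\<bar>variation f (t i) - variation f (s i)\<bar> \<le> (\<Sum>j<m i. \<bar>f (T' (i, j)) - f (S' (i, j))\<bar>) + \<eta>" if "i < n" for i
    proof -
      have "variation f (s i) \<le> variation f (t i)"
        using variation_step[OF f c, where x = "s i" and y = "t i"] le that by force
      moreover have "(\<Sum>j<m i. \<bar>f (min (T i j) (s i)) - f (min (S i j) (s i))\<bar>) \<le> variation f (s i)"
        by (rule variation_upper[OF f c var_family_min[OF fam]])
      ultimately show ?thesis
        using app[of i] sum_split_at[of f "T i" "S i" "{..<m i}" "s i"] by (simp add: S'_def T'_def)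
    qed
    let ?J = "Sigma {..<n} (\<lambda>i. {..<m i})"
    have sub: "{S' (i, j)<..<T' (i, j)} \<subseteq> {s i<..<t i}" if "i < n" "j < m i" for i j
      using fam[of i] that by (force simp: S'_def T'_def var_family_def)
    have dj2: "disjoint_family_on (\<lambda>j. {S' (i, j)<..<T' (i, j)}) {..<m i}" for i
      using disjoint_family_min(2)[of "S i" "T i" "{..<m i}" "s i"] fam[of i]
      by (simp add: S'_def T'_def var_family_def)
    have dj': "disjoint_family_on (\<lambda>p. {S' p<..<T' p}) ?J"
      unfolding disjoint_family_on_def
    proof (intro ballI impI)
      fix p q assume pq: "p \<in> ?J" "q \<in> ?J" "p \<noteq> q"
      obtain i j where p: "p = (i, j)" "i < n" "j < m i" using pq by auto
      obtain k l where q: "q = (k, l)" "k < n" "l < m k" using pq by auto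
      show "{S' p<..<T' p} \<inter> {S' q<..<T' q} = {}"
      proof (cases "i = k")
        case True
        then have "j \<noteq> l" using p q pq by auto
        then show ?thesis using dj2[of i] p q True by (simp add: disjoint_family_on_def)
      next
        case False
        then have "{s i<..<t i} \<inter> {s k<..<t k} = {}"
          using dj p q by (simp add: disjoint_family_on_def)
        then show ?thesis using sub[of i j] sub[of k l] p q by blast
      qed
    qed
    have "(\<Sum>p\<in>?J. T' p - S' p) = (\<Sum>i<n. \<Sum>j<m i. T' (i, j) - S' (i, j))"
      by (subst sum.Sigma) (auto simp: case_prod_unfold)
    also have "\<dots> \<le> (\<Sum>i<n. t i - s i)"
    proof (rule sum_mono)
      fix i assume i: "i \<in> {..<n}"
      show "(\<Sum>j<m i. T' (i, j) - S' (i, j)) \<le> t i - s i"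
        by (rule sum_length_disjoint_le[OF _ _ dj2])
           (use fam[of i] i le in \<open>auto simp: S'_def T'_def var_family_def\<close>)
    qed
    finally have "(\<Sum>p\<in>?J. \<bar>f (T' p) - f (S' p)\<bar>) < e / 2"
      using len fam by (intro d(2)[OF _ _ dj']) (auto simp: S'_def T'_def var_family_def intro!: max.mono)
    moreover have "(\<Sum>p\<in>?J. \<bar>f (T' p) - f (S' p)\<bar>) = (\<Sum>i<n. \<Sum>j<m i. \<bar>f (T' (i, j)) - f (S' (i, j))\<bar>)"
      by (subst sum.Sigma) (auto simp: case_prod_unfold)
    moreover have "(\<Sum>i<n. \<bar>variation f (t i) - variation f (s i)\<bar>)
        \<le> (\<Sum>i<n. (\<Sum>j<m i. \<bar>f (T' (i, j)) - f (S' (i, j))\<bar>) + \<eta>)"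
      by (rule sum_mono) (use * in auto)
    moreover have "real n * \<eta> < e / 2"
      using \<open>e > 0\<close> by (simp add: \<eta>_def field_simps)
    ultimately show ?thesis by (simp add: sum.distrib)
  qed
  then show "\<exists>\<delta>>0. \<forall>(n::nat) s t. (\<forall>i<n. s i \<le> t i) \<longrightarrow>
     disjoint_family_on (\<lambda>i. {s i<..<t i}) {..<n} \<longrightarrow> (\<Sum>i<n. t i - s i) < \<delta> \<longrightarrow>
     (\<Sum>i<n. \<bar>variation f (t i) - variation f (s i)\<bar>) < e"
    using d(1) by blast
qed

text \<open>Jordan decomposition: \<open>f\<close> is the difference of two increasing functions,
  its variation and its variation minus \<open>f\<close>, and each of them is an integral.\<close>

lemma ac_fun_integral:
  assumes f: "ac_fun f" and c: "\<And>x. x \<le> c \<Longrightarrow> f x = f c"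
  obtains g where "\<And>a b. g absolutely_integrable_on {a..b}"
    "\<And>a b. a \<le> b \<Longrightarrow> integral {a..b} g = f b - f a"
proof -
  have V: "ac_fun (variation f)" by (rule ac_fun_variation[OF f c])
  have step: "x \<le> y \<Longrightarrow> variation f x + \<bar>f y - f x\<bar> \<le> variation f y" for x y
    by (rule variation_step[OF f c])
  have "mono (variation f)"
  proof
    fix x y :: real assume "x \<le> y"
    then show "variation f x \<le> variation f y" using step[of x y] by linarith
  qed
  then obtain g1 where g1: "\<And>a b. g1 absolutely_integrable_on {a..b}"
    "\<And>a b. a \<le> b \<Longrightarrow> integral {a..b} g1 = variation f b - variation f a"
    by (rule mono_ac_fun_integral[OF _ V]) (rule that; blast)
  have "mono (\<lambda>x. variation f x - f x)"
  proof
    fix x y :: real assume "x \<le> y"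
    then show "variation f x - f x \<le> variation f y - f y" using step[of x y] by linarith
  qed
  then obtain g2 where g2: "\<And>a b. g2 absolutely_integrable_on {a..b}"
    "\<And>a b. a \<le> b \<Longrightarrow> integral {a..b} g2 = (variation f b - f b) - (variation f a - f a)"
    by (rule mono_ac_fun_integral[OF _ ac_fun_diff[OF V f]]) (rule that; blast)
  show ?thesis
  proof (rule that[of "\<lambda>x. g1 x - g2 x"])
    fix a b :: real
    show "(\<lambda>x. g1 x - g2 x) absolutely_integrable_on {a..b}"
      by (intro set_integral_diff g1 g2)
    show "integral {a..b} (\<lambda>x. g1 x - g2 x) = f b - f a" if "a \<le> b"
      using g1 g2 that by (subst Henstock_Kurzweil_Integration.integral_diff)
        (auto intro: set_lebesgue_integral_eq_integral(1))
  qed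
qed

section \<open>Absolutely continuous functions\<close>

text \<open>Clamping the argument to \<open>{c..d}\<close> gives a function on the whole line that
  is constant to the left of \<open>c\<close>, as the variation argument requires. \<open>k\<close>
  will be the real or the imaginary part of \<open>f\<close>.\<close>

lemma abs_cont_on_ac_fun:
  assumes f: "abs_cont_on c d f" and cd: "c \<le> d"
    and k: "\<And>x y. \<bar>k x - k y\<bar> \<le> cmod (f x - f y)"
  shows "ac_fun (\<lambda>x. k (max (min x d) c))"
  unfolding ac_fun_def
proof (intro allI impI)
  fix e :: real assume "e > 0"
  then obtain \<delta> where \<delta>: "\<delta> > 0" "\<And>(n::nat) s t. (\<forall>i<n. c \<le> s i \<and> s i \<le> t i \<and> t i \<le> d) \<Longrightarrow>
        disjoint_family_on (\<lambda>i. {s i<..<t i}) {..<n} \<Longrightarrow> (\<Sum>i<n. t i - s i) < \<delta> \<Longrightarrow>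
        (\<Sum>i<n. cmod (f (t i) - f (s i))) < e"
    using f unfolding abs_cont_on_def by meson
  let ?r = "\<lambda>x. max (min x d) c"
  show "\<exists>\<delta>>0. \<forall>(n::nat) s t. (\<forall>i<n. s i \<le> t i) \<longrightarrow>
     disjoint_family_on (\<lambda>i. {s i<..<t i}) {..<n} \<longrightarrow> (\<Sum>i<n. t i - s i) < \<delta> \<longrightarrow>
     (\<Sum>i<n. \<bar>k (?r (t i)) - k (?r (s i))\<bar>) < e"
  proof (intro exI[of _ \<delta>] conjI allI impI)
    fix n :: nat and s t
    assume A: "\<forall>i<n. s i \<le> t i" "disjoint_family_on (\<lambda>i. {s i<..<t i}) {..<n}" "(\<Sum>i<n. t i - s i) < \<delta>"
    have "disjoint_family_on (\<lambda>i. {?r (s i)<..<?r (t i)}) {..<n}"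
      by (rule disjoint_family_min(2)[OF disjoint_family_min(1)[OF A(2)]])
    moreover have "(\<Sum>i<n. ?r (t i) - ?r (s i)) \<le> (\<Sum>i<n. t i - s i)"
      using A(1) by (intro sum_mono) (auto simp: max_def min_def)
    moreover have "\<forall>i<n. c \<le> ?r (s i) \<and> ?r (s i) \<le> ?r (t i) \<and> ?r (t i) \<le> d"
      using A(1) cd by (auto simp: max_def min_def intro: order_trans)
    ultimately have "(\<Sum>i<n. cmod (f (?r (t i)) - f (?r (s i)))) < e"
      using A(3) by (intro \<delta>(2)) auto
    moreover have "(\<Sum>i<n. \<bar>k (?r (t i)) - k (?r (s i))\<bar>) \<le> (\<Sum>i<n. cmod (f (?r (t i)) - f (?r (s i))))"
      by (intro sum_mono k)
    ultimately show "(\<Sum>i<n. \<bar>k (?r (t i)) - k (?r (s i))\<bar>) < e" by simp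
  qed (rule \<delta>(1))
qed

lemma abs_cont_on_integral:
  assumes f: "abs_cont_on c d f" and cd: "c \<le> d"
  obtains g where "\<And>a b. g absolutely_integrable_on {a..b::real}"
    "\<And>x y. c \<le> x \<Longrightarrow> x \<le> y \<Longrightarrow> y \<le> d \<Longrightarrow> integral {x..y} g = f y - f x"
proof -
  let ?r = "\<lambda>x. max (min x d) c"
  have r: "?r x = x" if "c \<le> x" "x \<le> d" for x using that by simp
  obtain g1 where g1: "\<And>a b. g1 absolutely_integrable_on {a..b}"
    "\<And>a b. a \<le> b \<Longrightarrow> integral {a..b} g1 = Re (f (?r b)) - Re (f (?r a))"
    by (rule ac_fun_integral[OF abs_cont_on_ac_fun[OF f cd, of "\<lambda>x. Re (f x)"], of c])
       (use cd in \<open>auto simp: abs_Re_le_cmod simp flip: minus_complex.sel\<close>)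
  obtain g2 where g2: "\<And>a b. g2 absolutely_integrable_on {a..b}"
    "\<And>a b. a \<le> b \<Longrightarrow> integral {a..b} g2 = Im (f (?r b)) - Im (f (?r a))"
    by (rule ac_fun_integral[OF abs_cont_on_ac_fun[OF f cd, of "\<lambda>x. Im (f x)"], of c])
       (use cd in \<open>auto simp: abs_Im_le_cmod simp flip: minus_complex.sel\<close>)
  have h1: "(g1 has_integral Re (f y) - Re (f x)) {x..y}" and h2: "(g2 has_integral Im (f y) - Im (f x)) {x..y}"
    if "c \<le> x" "x \<le> y" "y \<le> d" for x y
    using integrable_integral[OF set_lebesgue_integral_eq_integral(1)[OF g1(1)], of x y]
      integrable_integral[OF set_lebesgue_integral_eq_integral(1)[OF g2(1)], of x y] g1(2) g2(2) that r[of x] r[of y]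
    by simp_all
  show ?thesis
  proof (rule that[of "\<lambda>x. complex_of_real (g1 x) + \<i> * complex_of_real (g2 x)"])
    fix a b :: real
    have l: "bounded_linear (\<lambda>x. \<i> * complex_of_real x)"
      by (rule bounded_linear_const_mult[OF bounded_linear_of_real])
    show "(\<lambda>x. complex_of_real (g1 x) + \<i> * complex_of_real (g2 x)) absolutely_integrable_on {a..b}"
      using absolutely_integrable_linear[OF g1(1)[of a b] bounded_linear_of_real]
        absolutely_integrable_linear[OF g2(1)[of a b] l]
      by (intro set_integral_add) (simp_all add: o_def)
  next
    fix x y assume xy: "c \<le> x" "x \<le> y" "y \<le> d"
    have "((\<lambda>x. complex_of_real (g1 x) + \<i> * complex_of_real (g2 x)) has_integral
       complex_of_real (Re (f y) - Re (f x)) + \<i> * complex_of_real (Im (f y) - Im (f x))) {x..y}"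
      using has_integral_linear[OF h1[OF xy] bounded_linear_of_real[where 'a = complex]]
        has_integral_linear[OF h2[OF xy], of "\<lambda>x. \<i> * complex_of_real x"]
      by (intro has_integral_add) (auto simp: o_def intro!: bounded_linear_const_mult[OF bounded_linear_of_real])
    also have "complex_of_real (Re (f y) - Re (f x)) + \<i> * complex_of_real (Im (f y) - Im (f x)) = f y - f x"
      by (simp add: complex_eq_iff)
    finally show "integral {x..y} (\<lambda>x. complex_of_real (g1 x) + \<i> * complex_of_real (g2 x)) = f y - f x"
      by (rule integral_unique)
  qed
qed

lemma abs_cont_on_derivative:
  assumes f: "abs_cont_on c d f" and cd: "c < d"
  obtains N g where "negligible N" "\<And>x. x \<in> {c..d} - N \<Longrightarrow> (f has_vector_derivative g x) (at x)"
    "g absolutely_integrable_on {c..d}" "integral {c..d} g = f d - f c"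
proof -
  obtain g where g: "\<And>a b. g absolutely_integrable_on {a..b::real}"
    "\<And>x y. c \<le> x \<Longrightarrow> x \<le> y \<Longrightarrow> y \<le> d \<Longrightarrow> integral {x..y} g = f y - f x"
    by (rule abs_cont_on_integral[OF f]) (use cd in \<open>auto intro: that\<close>)
  obtain N where N: "negligible N"
    "\<And>x c. x \<notin> N \<Longrightarrow> c < x \<Longrightarrow> ((\<lambda>t. integral {c..t} g) has_vector_derivative g x) (at x)"
    by (rule indefinite_integral_has_vector_derivative_ae[of g])
       (use g(1) set_lebesgue_integral_eq_integral(1) in blast)+
  show ?thesis
  proof (rule that)
    \<comment> \<open>The endpoints are discarded: the derivative is two-sided, while
      \<open>f\<close> is known to be a primitive only within \<open>{c..d}\<close>.\<close>
    show "negligible (N \<union> {c, d})" using N(1) by simp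
    fix x assume x: "x \<in> {c..d} - (N \<union> {c, d})"
    then have "((\<lambda>t. f c + integral {c..t} g) has_vector_derivative 0 + g x) (at x)"
      by (intro has_vector_derivative_add has_vector_derivative_const N(2)) auto
    then show "(f has_vector_derivative g x) (at x)"
    proof (subst has_vector_derivative_transform_within_open[of "\<lambda>t. f c + integral {c..t} g" _ _ "{c<..<d}"])
      show "f c + integral {c..t} g = f t" if "t \<in> {c<..<d}" for t
        using g(2)[of c t] that by simp
    qed (use x in auto)
  qed (use g cd in auto)
qed

section \<open>Almost-everywhere derivatives on an open interval\<close>

lemma AE_lebesgue_on_open:
  assumes "open (I :: real set)"
  shows "(AE x in lebesgue_on I. P x) \<longleftrightarrow> (\<exists>N. negligible N \<and> (\<forall>x\<in>I - N. P x))"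
proof -
  have "(AE x in lebesgue_on I. P x) \<longleftrightarrow> (AE x in lebesgue. x \<in> I \<longrightarrow> P x)"
    using assms by (intro AE_restrict_space_iff) (simp add: lebesgue_openin borel_open)
  then show ?thesis
    unfolding eventually_ae_filter_negligible by (auto; blast)
qed

lemma Icc_subset_einterval:
  assumes "x \<in> einterval a b" "y \<in> einterval a b"
  shows "{x..y} \<subseteq> einterval a b"
proof
  fix z assume "z \<in> {x..y}"
  then have "ereal x \<le> ereal z" "ereal z \<le> ereal y" by simp_all
  then show "z \<in> einterval a b"
    using assms unfolding einterval_iff by (blast intro: less_le_trans le_less_trans)
qed

text \<open>Countably many compact intervals \<open>{l i..u i}\<close> exhaust the open one, and the
  union of their exceptional sets is still null. Writing the derivative as
  \<open>vector_derivative f (at x)\<close> frees it from the compact interval on which it was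
  found.\<close>

lemma AC_loc_derivative:
  assumes f: "AC_loc (einterval a b) f" and ab: "a < b"
  shows AC_loc_has_derivative: "\<exists>N. negligible N \<and>
      (\<forall>x\<in>einterval a b - N. (f has_vector_derivative vector_derivative f (at x)) (at x))"
    and AC_loc_has_integral: "\<And>c d. c \<le> d \<Longrightarrow> {c..d} \<subseteq> einterval a b \<Longrightarrow>
      (\<lambda>x. vector_derivative f (at x)) absolutely_integrable_on {c..d} \<and>
      ((\<lambda>x. vector_derivative f (at x)) has_integral f d - f c) {c..d}"
proof -
  have *: "\<exists>N g. negligible N \<and> (\<forall>x\<in>{c..d} - N. (f has_vector_derivative g x) (at x)) \<and>
    g absolutely_integrable_on {c..d} \<and> integral {c..d} g = f d - f c"
    if "c < d" "{c..d} \<subseteq> einterval a b" for c d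
  proof -
    have "abs_cont_on c d f" using f that by (simp add: AC_loc_def)
    from abs_cont_on_derivative[OF this that(1)] show ?thesis by (metis (no_types, lifting))
  qed
  obtain u l :: "nat \<Rightarrow> real" where ul: "einterval a b = (\<Union>i. {l i .. u i})" "\<And>i. l i < u i"
    by (rule einterval_Icc_approximation[OF ab]) blast
  have "\<exists>N. negligible N \<and> (\<forall>x\<in>{l i..u i} - N. (f has_vector_derivative vector_derivative f (at x)) (at x))" for i
  proof -
    obtain N g where "negligible N" "\<forall>x\<in>{l i..u i} - N. (f has_vector_derivative g x) (at x)"
      using *[OF ul(2)[of i]] ul(1) by blast
    then show ?thesis
      by (metis differentiableI_vector vector_derivative_works)
  qed
  then have "\<exists>N. \<forall>i. negligible (N i) \<and>
    (\<forall>x\<in>{l i..u i} - N i. (f has_vector_derivative vector_derivative f (at x)) (at x))"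
    by (intro choice allI)
  then obtain N where N: "\<And>i. negligible (N i)"
    "\<And>i x. x \<in> {l i..u i} - N i \<Longrightarrow> (f has_vector_derivative vector_derivative f (at x)) (at x)"
    by blast
  have "negligible (\<Union>i. N i)" using N(1) by (intro negligible_countable_Union) auto
  moreover have "\<forall>x\<in>einterval a b - (\<Union>i. N i). (f has_vector_derivative vector_derivative f (at x)) (at x)"
  proof
    fix x assume x: "x \<in> einterval a b - (\<Union>i. N i)"
    then obtain i where "x \<in> {l i..u i}" unfolding ul(1) by blast
    then show "(f has_vector_derivative vector_derivative f (at x)) (at x)" using x by (intro N(2)[of x i]) blast
  qed
  ultimately show "\<exists>N. negligible N \<and>
      (\<forall>x\<in>einterval a b - N. (f has_vector_derivative vector_derivative f (at x)) (at x))"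
    by blast
  fix c d :: real assume cd: "c \<le> d" "{c..d} \<subseteq> einterval a b"
  show "(\<lambda>x. vector_derivative f (at x)) absolutely_integrable_on {c..d} \<and>
      ((\<lambda>x. vector_derivative f (at x)) has_integral f d - f c) {c..d}"
  proof (cases "c = d")
    case False
    then obtain N g where g: "negligible N" "\<And>x. x \<in> {c..d} - N \<Longrightarrow> (f has_vector_derivative g x) (at x)"
      "g absolutely_integrable_on {c..d}" "integral {c..d} g = f d - f c"
    proof -
      have "c < d" using False cd(1) by simp
      from *[OF this cd(2)] show ?thesis using that by blast
    qed
    have eq: "vector_derivative f (at x) = g x" if "x \<in> {c..d} - N" for x
      using g(2)[OF that] by (rule vector_derivative_at)
    have "(g has_integral f d - f c) {c..d}"
      using g(3,4) by (metis has_integral_integral set_lebesgue_integral_eq_integral(1))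
    then have "((\<lambda>x. vector_derivative f (at x)) has_integral f d - f c) {c..d}"
      by (rule has_integral_spike[OF g(1), rotated]) (use eq in auto)
    moreover have "(\<lambda>x. vector_derivative f (at x)) absolutely_integrable_on {c..d}"
      by (rule absolutely_integrable_spike[OF g(3) g(1)]) (use eq in auto)
    ultimately show ?thesis by blast
  next
    case True
    then have "Henstock_Kurzweil_Integration.content (cbox c d) = 0" by simp
    then have "(\<lambda>x. vector_derivative f (at x)) absolutely_integrable_on cbox c d"
      by (rule absolutely_integrable_on_null)
    then show ?thesis using True by (simp add: has_integral_refl)
  qed
qed

section \<open>Continuity, and absolute continuity of indefinite integrals\<close>

lemma abs_cont_on_continuous:
  assumes "abs_cont_on c d f"
  shows "continuous_on {c..d} f"
  unfolding continuous_on_iff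
proof (intro ballI allI impI)
  fix x e :: real assume x: "x \<in> {c..d}" and "e > 0"
  then obtain \<delta> where \<delta>: "\<delta> > 0" "\<And>(n::nat) s t. (\<forall>i<n. c \<le> s i \<and> s i \<le> t i \<and> t i \<le> d) \<Longrightarrow>
        disjoint_family_on (\<lambda>i. {s i<..<t i}) {..<n} \<Longrightarrow> (\<Sum>i<n. t i - s i) < \<delta> \<Longrightarrow>
        (\<Sum>i<n. cmod (f (t i) - f (s i))) < e"
    using assms unfolding abs_cont_on_def by meson
  have "dist (f y) (f x) < e" if "y \<in> {c..d}" "dist y x < \<delta>" for y
    using \<delta>(2)[of 1 "\<lambda>_. min x y" "\<lambda>_. max x y"] that x
    by (auto simp: disjoint_family_on_def dist_norm min_def max_def norm_minus_commute abs_if split: if_splits)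
  then show "\<exists>d'>0. \<forall>y\<in>{c..d}. dist y x < d' \<longrightarrow> dist (f y) (f x) < e"
    using \<delta>(1) by blast
qed

lemma AC_loc_continuous_on:
  assumes "AC_loc (einterval a b) f"
  shows "continuous_on (einterval a b) f"
proof (rule continuous_at_imp_continuous_on, rule ballI)
  fix x assume "x \<in> einterval a b"
  then obtain e where e: "e > 0" "cball x e \<subseteq> einterval a b"
    using open_einterval open_contains_cball by blast
  then have "continuous_on {x - e..x + e} f"
    using assms by (intro abs_cont_on_continuous) (auto simp: AC_loc_def cball_eq_atLeastAtMost)
  then show "isCont f x"
    using e(1) by (intro continuous_on_interior[of "{x - e..x + e}"]) auto
qed

text \<open>The norm of \<open>g\<close> is cut at a height \<open>m\<close> so large that the
  excess \<open>k\<close> has integral below \<open>e / 2\<close>. Over a disjoint family the excess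
  contributes less than \<open>e / 2\<close> in total, and the bounded part at most \<open>m\<close>
  times the total length.\<close>

lemma abs_cont_on_integral_function:
  assumes g: "g absolutely_integrable_on {c..d}"
    and F: "\<And>x y. c \<le> x \<Longrightarrow> x \<le> y \<Longrightarrow> y \<le> d \<Longrightarrow> F y - F x = integral {x..y} g"
  shows "abs_cont_on c d F"
  unfolding abs_cont_on_def
proof (intro allI impI)
  fix e :: real assume e: "e > 0"
  define h where "h = (\<lambda>x. norm (g x))"
  have h: "h absolutely_integrable_on {c..d}"
    using absolutely_integrable_norm[OF g] by (simp add: h_def o_def)
  then have h': "h integrable_on {c..d}"
    by (rule set_lebesgue_integral_eq_integral(1))
  have hm: "(\<lambda>x. min (h x) (real n)) absolutely_integrable_on {c..d}" for n
    using absolutely_integrable_min_1[OF h, of "\<lambda>_. real n"] absolutely_integrable_on_const[of "{c..d}"]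
    by (simp add: lmeasurable_cbox flip: box_real)
  have "(\<lambda>n. integral {c..d} (\<lambda>x. min (h x) (real n))) \<longlonglongrightarrow> integral {c..d} h"
  proof (rule dominated_convergence(2)[where h = h])
    show "(\<lambda>x. min (h x) (real k)) integrable_on {c..d}" for k
      using hm by (rule set_lebesgue_integral_eq_integral(1))
    fix x
    obtain m where m: "h x \<le> real m" using real_arch_simple by blast
    have "\<forall>\<^sub>F k in sequentially. min (h x) (real k) = h x"
      using eventually_ge_at_top[of m] by eventually_elim (use m in auto)
    then show "(\<lambda>k. min (h x) (real k)) \<longlonglongrightarrow> h x"
      by (rule tendsto_eventually)
  qed (use h' in \<open>auto simp: h_def\<close>)
  then have "\<forall>\<^sub>F n in sequentially. dist (integral {c..d} (\<lambda>x. min (h x) (real n))) (integral {c..d} h) < e / 2"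
    using e by (intro tendstoD) auto
  then obtain m where m: "dist (integral {c..d} (\<lambda>x. min (h x) (real m))) (integral {c..d} h) < e / 2"
    by (auto simp: eventually_sequentially)
  define k where "k = (\<lambda>x. h x - min (h x) (real m))"
  have k: "k integrable_on {c..d}" "\<And>x. 0 \<le> k x"
    using h' hm set_lebesgue_integral_eq_integral(1)
    unfolding k_def by (auto intro!: Henstock_Kurzweil_Integration.integrable_diff)
  have "integral {c..d} k = integral {c..d} h - integral {c..d} (\<lambda>x. min (h x) (real m))"
    unfolding k_def
    by (rule Henstock_Kurzweil_Integration.integral_diff[OF h' set_lebesgue_integral_eq_integral(1)[OF hm]])
  then have kI: "integral {c..d} k < e / 2"
    using m by (simp only: dist_real_def)
  \<comment> \<open>The summand 1 keeps \<open>\<delta>\<close> positive for \<open>m = 0\<close>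
    and makes \<open>real m * \<delta>\<close> strictly smaller than \<open>e / 2\<close>.\<close>
  define \<delta> where "\<delta> = e / (2 * (real m + 1))"
  show "\<exists>\<delta>>0. \<forall>(n::nat) s t.
        (\<forall>i<n. c \<le> s i \<and> s i \<le> t i \<and> t i \<le> d) \<longrightarrow>
        disjoint_family_on (\<lambda>i. {s i<..<t i}) {..<n} \<longrightarrow>
        (\<Sum>i<n. t i - s i) < \<delta> \<longrightarrow> (\<Sum>i<n. cmod (F (t i) - F (s i))) < e"
  proof (intro exI[of _ \<delta>] conjI allI impI)
    show "\<delta> > 0" using e by (simp add: \<delta>_def)
    fix n :: nat and s t
    assume A: "\<forall>i<n. c \<le> s i \<and> s i \<le> t i \<and> t i \<le> d" "disjoint_family_on (\<lambda>i. {s i<..<t i}) {..<n}"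
      "(\<Sum>i<n. t i - s i) < \<delta>"
    have ki: "k integrable_on {s i..t i}" if "i < n" for i
      using A(1) that by (intro integrable_on_subinterval[OF k(1)]) auto
    have "cmod (F (t i) - F (s i)) \<le> integral {s i..t i} k + real m * (t i - s i)" if i: "i < n" for i
    proof -
      have sub: "{s i..t i} \<subseteq> {c..d}" using A(1) i by auto
      have "cmod (F (t i) - F (s i)) = norm (integral {s i..t i} g)"
        using F A(1) i by simp
      also have "\<dots> \<le> integral {s i..t i} (\<lambda>x. k x + real m)"
      proof (rule integral_norm_bound_integral)
        show "g integrable_on {s i..t i}"
          using integrable_on_subinterval[OF _ sub] g set_lebesgue_integral_eq_integral(1) by blast
        show "(\<lambda>x. k x + real m) integrable_on {s i..t i}"
          using ki[OF i] by (intro integrable_add) auto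
        show "norm (g x) \<le> k x + real m" for x
          by (auto simp: k_def h_def min_def)
      qed
      also have "\<dots> = integral {s i..t i} k + real m * (t i - s i)"
        using ki[OF i] A(1) i by (subst integral_add) auto
      finally show ?thesis .
    qed
    then have "(\<Sum>i<n. cmod (F (t i) - F (s i))) \<le> (\<Sum>i<n. integral {s i..t i} k + real m * (t i - s i))"
      by (intro sum_mono) auto
    also have "\<dots> = (\<Sum>i<n. integral {s i..t i} k) + real m * (\<Sum>i<n. t i - s i)"
      by (simp add: sum.distrib sum_distrib_left)
    also have "(\<Sum>i<n. integral {s i..t i} k) \<le> integral {c..d} k"
    proof -
      have "(k has_integral (\<Sum>i<n. integral {s i..t i} k)) (\<Union>i<n. {s i..t i})"
      proof (rule has_integral_UN)
        show "pairwise (\<lambda>i i'. negligible ({s i..t i} \<inter> {s i'..t i'})) {..<n}"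
          unfolding pairwise_def
        proof (intro ballI impI)
          fix i j assume ij: "i \<in> {..<n}" "j \<in> {..<n}" "i \<noteq> j"
          then have "{s i<..<t i} \<inter> {s j<..<t j} = {}"
            using A(2) by (simp add: disjoint_family_on_def)
          then have "{s i..t i} \<inter> {s j..t j} \<subseteq> {s i, t i, s j, t j}"
            by (auto simp: set_eq_iff) (metis greaterThanLessThan_iff less_eq_real_def)+
          then show "negligible ({s i..t i} \<inter> {s j..t j})"
            by (rule negligible_subset[rotated]) simp
        qed
      qed (use ki in auto)
      moreover have "(\<Union>i<n. {s i..t i}) \<subseteq> {c..d}"
      proof
        fix x assume "x \<in> (\<Union>i<n. {s i..t i})"
        then obtain i where "i < n" "s i \<le> x" "x \<le> t i" by auto
        then show "x \<in> {c..d}" using A(1)[rule_format, of i] by auto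
      qed
      ultimately show ?thesis
        using has_integral_subset_le integrable_integral[OF k(1)] k(2) by blast
    qed
    also have "real m * (\<Sum>i<n. t i - s i) \<le> real m * \<delta>"
      using A(3) by (intro mult_left_mono) auto
    also have "integral {c..d} k + real m * \<delta> < e"
    proof -
      have "real m * \<delta> < e / 2" using e by (simp add: \<delta>_def field_simps)
      then show ?thesis using kI by simp
    qed
    finally show "(\<Sum>i<n. cmod (F (t i) - F (s i))) < e" by simp
  qed
qed

lemma AC_loc_integral_function:
  assumes ab: "a < b" and g: "\<And>c d. {c..d} \<subseteq> einterval a b \<Longrightarrow> g absolutely_integrable_on {c..d}"
    and F: "\<And>x y. x \<in> einterval a b \<Longrightarrow> y \<in> einterval a b \<Longrightarrow> x \<le> y \<Longrightarrow> F y - F x = integral {x..y} g"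
  shows "AC_loc (einterval a b) F"
    and "\<exists>N. negligible N \<and> (\<forall>x\<in>einterval a b - N. (F has_vector_derivative g x) (at x))"
proof -
  show "AC_loc (einterval a b) F"
    unfolding AC_loc_def
  proof (intro allI impI)
    fix c d assume cd: "c \<le> d" "{c..d} \<subseteq> einterval a b"
    show "abs_cont_on c d F"
    proof (rule abs_cont_on_integral_function[OF g[OF cd(2)]])
      fix x y assume "c \<le> x" "x \<le> y" "y \<le> d"
      then show "F y - F x = integral {x..y} g" using cd by (intro F) auto
    qed
  qed
  obtain u l :: "nat \<Rightarrow> real" where ul: "einterval a b = (\<Union>i. {l i .. u i})" "\<And>i. l i < u i"
    by (rule einterval_Icc_approximation[OF ab]) blast
  have "\<exists>N. negligible N \<and> (\<forall>x\<in>{l i..u i} - N. (F has_vector_derivative g x) (at x))" for i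
  proof -
    have sub: "{l i..u i} \<subseteq> einterval a b" using ul by auto
    \<comment> \<open>Extension by zero gives integrability over every interval, as the theorem on
      almost-everywhere derivatives of indefinite integrals demands.\<close>
    define g' where "g' = (\<lambda>x. if x \<in> {l i..u i} then g x else 0)"
    have "g' absolutely_integrable_on UNIV"
      using g[OF sub] absolutely_integrable_restrict_UNIV[of "{l i..u i}" g] by (simp add: g'_def)
    then have "g' integrable_on {c..d}" for c d
      using integrable_on_subinterval[of g' UNIV c d] by (simp add: set_lebesgue_integral_eq_integral(1))
    then obtain N where N: "negligible N"
      "\<And>x c. x \<notin> N \<Longrightarrow> c < x \<Longrightarrow> ((\<lambda>t. integral {c..t} g') has_vector_derivative g' x) (at x)"
      by (rule indefinite_integral_has_vector_derivative_ae) blast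
    have "(F has_vector_derivative g x) (at x)" if x: "x \<in> {l i..u i} - (N \<union> {l i, u i})" for x
    proof -
      have "((\<lambda>t. F (l i) + integral {l i..t} g') has_vector_derivative 0 + g' x) (at x)"
        using x by (intro has_vector_derivative_add has_vector_derivative_const N(2)) auto
      moreover have "g' x = g x" using x by (simp add: g'_def)
      ultimately have *: "((\<lambda>t. F (l i) + integral {l i..t} g') has_vector_derivative g x) (at x)" by simp
      show ?thesis
      proof (rule has_vector_derivative_transform_within_open[OF *, of "{l i<..<u i}"])
        fix t assume t: "t \<in> {l i<..<u i}"
        have "integral {l i..t} g' = integral {l i..t} g"
          by (rule integral_cong) (use t in \<open>auto simp: g'_def\<close>)
        moreover have "F t - F (l i) = integral {l i..t} g"
          using t sub by (intro F) auto
        ultimately show "F (l i) + integral {l i..t} g' = F t" by (simp add: algebra_simps)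
      qed (use x in auto)
    qed
    then show ?thesis
      using N(1) by (intro exI[of _ "N \<union> {l i, u i}"]) auto
  qed
  then have "\<exists>N. \<forall>i. negligible (N i) \<and> (\<forall>x\<in>{l i..u i} - N i. (F has_vector_derivative g x) (at x))"
    by (intro choice allI)
  then obtain N where N: "\<And>i. negligible (N i)"
    "\<And>i x. x \<in> {l i..u i} - N i \<Longrightarrow> (F has_vector_derivative g x) (at x)"
    by blast
  have "negligible (\<Union>i. N i)" using N(1) by (intro negligible_countable_Union) auto
  moreover have "\<forall>x\<in>einterval a b - (\<Union>i. N i). (F has_vector_derivative g x) (at x)"
  proof
    fix x assume x: "x \<in> einterval a b - (\<Union>i. N i)"
    then obtain i where "x \<in> {l i..u i}" unfolding ul(1) by blast
    then show "(F has_vector_derivative g x) (at x)" using x by (intro N(2)[of x i]) blast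
  qed
  ultimately show "\<exists>N. negligible N \<and> (\<forall>x\<in>einterval a b - N. (F has_vector_derivative g x) (at x))"
    by blast
qed

text \<open>Common source of the closure properties below: increments of sums, conjugates and
  products are dominated by those of their constituents. The constant may depend on the compact
  subinterval, which products need because their factors are bounded only locally.\<close>

lemma AC_loc_dominated:
  assumes f: "AC_loc I f" and g: "AC_loc I g"
    and dom: "\<And>c d. {c..d} \<subseteq> I \<Longrightarrow> \<exists>M. \<forall>x\<in>{c..d}. \<forall>y\<in>{c..d}. cmod (h y - h x) \<le> M * (cmod (f y - f x) + cmod (g y - g x))"
  shows "AC_loc I h"
  unfolding AC_loc_def abs_cont_on_def
proof (intro allI impI)
  fix c d e :: real assume cd: "c \<le> d" "{c..d} \<subseteq> I" and e: "0 < e"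
  obtain M0 where M0: "\<And>x y. x \<in> {c..d} \<Longrightarrow> y \<in> {c..d} \<Longrightarrow> cmod (h y - h x) \<le> M0 * (cmod (f y - f x) + cmod (g y - g x))"
    using dom[OF cd(2)] by blast
  define M where "M = \<bar>M0\<bar> + 1"
  have M: "M > 0" "cmod (h y - h x) \<le> M * (cmod (f y - f x) + cmod (g y - g x))" if "x \<in> {c..d}" "y \<in> {c..d}" for x y
  proof -
    have "M0 * (cmod (f y - f x) + cmod (g y - g x)) \<le> M * (cmod (f y - f x) + cmod (g y - g x))"
      by (rule mult_right_mono) (auto simp: M_def)
    then show "cmod (h y - h x) \<le> M * (cmod (f y - f x) + cmod (g y - g x))"
      using M0[OF that] by linarith
  qed (simp add: M_def)
  have "M > 0" by (simp add: M_def)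
  then have e': "e / (2 * M) > 0" using e by simp
  have "abs_cont_on c d f" "abs_cont_on c d g" using f g cd by (auto simp: AC_loc_def)
  obtain d1 where d1: "d1 > 0" "\<And>(n::nat) s t. (\<forall>i<n. c \<le> s i \<and> s i \<le> t i \<and> t i \<le> d) \<Longrightarrow>
        disjoint_family_on (\<lambda>i. {s i<..<t i}) {..<n} \<Longrightarrow> (\<Sum>i<n. t i - s i) < d1 \<Longrightarrow>
        (\<Sum>i<n. cmod (f (t i) - f (s i))) < e / (2 * M)"
    using \<open>abs_cont_on c d f\<close> e' unfolding abs_cont_on_def by meson
  obtain d2 where d2: "d2 > 0" "\<And>(n::nat) s t. (\<forall>i<n. c \<le> s i \<and> s i \<le> t i \<and> t i \<le> d) \<Longrightarrow>
        disjoint_family_on (\<lambda>i. {s i<..<t i}) {..<n} \<Longrightarrow> (\<Sum>i<n. t i - s i) < d2 \<Longrightarrow>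
        (\<Sum>i<n. cmod (g (t i) - g (s i))) < e / (2 * M)"
    using \<open>abs_cont_on c d g\<close> e' unfolding abs_cont_on_def by meson
  show "\<exists>\<delta>>0. \<forall>(n::nat) s t.
        (\<forall>i<n. c \<le> s i \<and> s i \<le> t i \<and> t i \<le> d) \<longrightarrow>
        disjoint_family_on (\<lambda>i. {s i<..<t i}) {..<n} \<longrightarrow>
        (\<Sum>i<n. t i - s i) < \<delta> \<longrightarrow> (\<Sum>i<n. cmod (h (t i) - h (s i))) < e"
  proof (intro exI[of _ "min d1 d2"] conjI allI impI)
    fix n :: nat and s t
    assume A: "\<forall>i<n. c \<le> s i \<and> s i \<le> t i \<and> t i \<le> d" "disjoint_family_on (\<lambda>i. {s i<..<t i}) {..<n}"
      "(\<Sum>i<n. t i - s i) < min d1 d2"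
    have "(\<Sum>i<n. cmod (h (t i) - h (s i))) \<le> (\<Sum>i<n. M * (cmod (f (t i) - f (s i)) + cmod (g (t i) - g (s i))))"
      by (intro sum_mono M(2)) (use A(1) in force)+
    also have "\<dots> = M * ((\<Sum>i<n. cmod (f (t i) - f (s i))) + (\<Sum>i<n. cmod (g (t i) - g (s i))))"
      by (simp only: sum_distrib_left[symmetric] sum.distrib)
    also have "\<dots> < M * (e / (2 * M) + e / (2 * M))"
      using d1(2)[OF A(1,2)] d2(2)[OF A(1,2)] A(3) \<open>M > 0\<close> by (intro mult_strict_left_mono add_strict_mono) auto
    also have "\<dots> = e" using \<open>M > 0\<close> by (simp add: field_simps)
    finally show "(\<Sum>i<n. cmod (h (t i) - h (s i))) < e" .
  qed (use d1 d2 in auto)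
qed

lemma AC_loc_const [simp]: "AC_loc I (\<lambda>x. z)"
  unfolding AC_loc_def abs_cont_on_def by (auto intro: exI[of _ 1])

lemma AC_loc_add: "AC_loc I f \<Longrightarrow> AC_loc I g \<Longrightarrow> AC_loc I (\<lambda>x. f x + g x)"
proof (rule AC_loc_dominated[of I f g])
  fix c d
  have "cmod (f y + g y - (f x + g x)) \<le> 1 * (cmod (f y - f x) + cmod (g y - g x))" for x y
    using norm_triangle_ineq[of "f y - f x" "g y - g x"] by (simp add: algebra_simps)
  then show "\<exists>M. \<forall>x\<in>{c..d}. \<forall>y\<in>{c..d}. cmod (f y + g y - (f x + g x)) \<le> M * (cmod (f y - f x) + cmod (g y - g x))"
    by blast
qed auto

lemma AC_loc_cnj: "AC_loc I f \<Longrightarrow> AC_loc I (\<lambda>x. cnj (f x))"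
proof (rule AC_loc_dominated[of I f f])
  fix c d
  have "cmod (cnj (f y) - cnj (f x)) \<le> 1 * (cmod (f y - f x) + cmod (f y - f x))" for x y
    using complex_mod_cnj[of "f y - f x"] by simp
  then show "\<exists>M. \<forall>x\<in>{c..d}. \<forall>y\<in>{c..d}. cmod (cnj (f y) - cnj (f x)) \<le> M * (cmod (f y - f x) + cmod (f y - f x))"
    by blast
qed auto

lemma AC_loc_mult:
  assumes f: "AC_loc (einterval a b) f" and g: "AC_loc (einterval a b) g"
  shows "AC_loc (einterval a b) (\<lambda>x. f x * g x)"
proof (rule AC_loc_dominated[OF f g])
  fix c d assume cd: "{c..d} \<subseteq> einterval a b"
  have bd: "\<exists>M. \<forall>x\<in>{c..d}. cmod (h x) \<le> M" if "AC_loc (einterval a b) h" for h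
  proof -
    have "continuous_on {c..d} h"
      using AC_loc_continuous_on[OF that] cd by (rule continuous_on_subset)
    then have "compact (h ` {c..d})" by (rule compact_continuous_image) simp
    then show ?thesis by (auto dest: compact_imp_bounded simp: bounded_iff)
  qed
  obtain M1 M2 where M: "\<And>x. x \<in> {c..d} \<Longrightarrow> cmod (f x) \<le> M1" "\<And>x. x \<in> {c..d} \<Longrightarrow> cmod (g x) \<le> M2"
    using bd[OF f] bd[OF g] by blast
  have "cmod (f y * g y - f x * g x) \<le> max M1 M2 * (cmod (f y - f x) + cmod (g y - g x))"
    if "x \<in> {c..d}" "y \<in> {c..d}" for x y
  proof -
    have "f y * g y - f x * g x = g y * (f y - f x) + f x * (g y - g x)" by (simp add: algebra_simps)
    then have "cmod (f y * g y - f x * g x) \<le> cmod (g y) * cmod (f y - f x) + cmod (f x) * cmod (g y - g x)"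
      by (metis norm_mult norm_triangle_ineq)
    also have "\<dots> \<le> max M1 M2 * cmod (f y - f x) + max M1 M2 * cmod (g y - g x)"
      using M that by (intro add_mono mult_right_mono) (auto simp: le_max_iff_disj)
    finally show ?thesis by (simp add: algebra_simps)
  qed
  then show "\<exists>M. \<forall>x\<in>{c..d}. \<forall>y\<in>{c..d}. cmod (f y * g y - f x * g x) \<le> M * (cmod (f y - f x) + cmod (g y - g x))"
    by blast
qed

section \<open>Quasi-derivatives and Green's formula\<close>

text \<open>The points of disagreement form an open set inside a null set.\<close>

lemma continuous_AE_eq:
  fixes f g :: "real \<Rightarrow> complex"
  assumes "open I" "continuous_on I f" "continuous_on I g" "AE x in lebesgue_on I. f x = g x" "x \<in> I"
  shows "f x = g x"
proof (rule ccontr)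
  assume ne: "f x \<noteq> g x"
  obtain N where N: "negligible N" "\<forall>x\<in>I - N. f x = g x"
    using assms(4) unfolding AE_lebesgue_on_open[OF assms(1)] by blast
  let ?U = "(\<lambda>x. f x - g x) -` (- {0}) \<inter> I"
  have "open ?U"
    by (rule continuous_on_open_vimage[OF assms(1), THEN iffD1, rule_format])
       (use assms in \<open>auto intro: continuous_on_diff\<close>)
  moreover have "x \<in> ?U" using ne assms by auto
  moreover have "?U \<subseteq> N" using N(2) by auto
  ultimately show False
    using open_not_negligible[of ?U] negligible_subset[OF N(1)] by blast
qed

lemma integrable_lebesgue_on_iff:
  fixes f :: "real \<Rightarrow> 'b::euclidean_space"
  assumes "S \<in> sets lebesgue"
  shows "integrable (lebesgue_on S) f \<longleftrightarrow> f absolutely_integrable_on S"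
  unfolding set_integrable_def using assms by (subst integrable_restrict_space) auto

section \<open>Filters at the endpoints, and integrals up to them\<close>

lemma end_filter_Rend_eventually:
  assumes "lep S < rep S" "c \<in> dom_int S"
  shows "\<forall>\<^sub>F t in end_filter S Rend. t \<in> dom_int S \<and> c < t"
proof -
  have "\<forall>\<^sub>F X in at_left (rep S). X \<in> {ereal c<..<rep S}"
    using assms by (intro eventually_at_leftI[of "ereal c"]) (auto simp: einterval_def)
  then show ?thesis
    unfolding end_filter.simps eventually_filtermap
  proof eventually_elim
    case (elim X)
    then obtain r where "X = ereal r" by (cases X) auto
    then show ?case using elim assms less_trans[of "lep S" "ereal c" X] by (auto simp: einterval_def)
  qed
qed

lemma end_filter_Lend_eventually:
  assumes "lep S < rep S" "c \<in> dom_int S"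
  shows "\<forall>\<^sub>F t in end_filter S Lend. t \<in> dom_int S \<and> t < c"
proof -
  have "\<forall>\<^sub>F X in at_right (lep S). X \<in> {lep S<..<ereal c}"
    using assms by (intro eventually_at_rightI[of _ "ereal c"]) (auto simp: einterval_def)
  then show ?thesis
    unfolding end_filter.simps eventually_filtermap
  proof eventually_elim
    case (elim X)
    then obtain r where "X = ereal r" by (cases X) auto
    then show ?case using elim assms less_trans[of X "ereal c" "rep S"] by (auto simp: einterval_def)
  qed
qed

lemma end_filter_eventually_dom_int:
  assumes "lep S < rep S"
  shows "\<forall>\<^sub>F t in end_filter S e. t \<in> dom_int S"
proof -
  obtain c where c: "c \<in> dom_int S" using einterval_nonempty[OF assms] by blast
  show ?thesis
  proof (cases e)
    case Lend
    show ?thesis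
      unfolding Lend by (rule eventually_mono[OF end_filter_Lend_eventually[OF assms c]]) (erule conjunct1)
  next
    case Rend
    show ?thesis
      unfolding Rend by (rule eventually_mono[OF end_filter_Rend_eventually[OF assms c]]) (erule conjunct1)
  qed
qed

lemma end_filter_not_bot:
  assumes "lep S < rep S"
  shows "end_filter S e \<noteq> bot"
proof -
  obtain u l :: "nat \<Rightarrow> real" where ul: "\<And>i. lep S < l i" "\<And>i. u i < rep S"
    "(\<lambda>i. ereal (l i)) \<longlonglongrightarrow> lep S" "(\<lambda>i. ereal (u i)) \<longlonglongrightarrow> rep S"
    by (rule einterval_Icc_approximation[OF assms]) blast
  have nb: "F \<noteq> bot" if "filterlim h F sequentially" for h :: "nat \<Rightarrow> ereal" and F
    using that by (auto simp: filterlim_def bot_unique filtermap_bot_iff)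
  have "filterlim (\<lambda>i. ereal (l i)) (at_right (lep S)) sequentially"
    using ul by (intro tendsto_imp_filterlim_at_right) auto
  moreover have "filterlim (\<lambda>i. ereal (u i)) (at_left (rep S)) sequentially"
    using ul by (intro tendsto_imp_filterlim_at_left) auto
  ultimately show ?thesis
    using nb by (cases e) (auto simp: filtermap_bot_iff)
qed

lemma borel_measurable_indicator_lebesgue_on:
  "A \<in> sets borel \<Longrightarrow> (indicator A :: real \<Rightarrow> real) \<in> borel_measurable (lebesgue_on I)"
  by (intro measurable_restrict_space1 borel_measurable_indicator) (simp add: sets_completionI_sets)

lemma integrable_indicator_lebesgue_on:
  fixes k :: "real \<Rightarrow> 'b::euclidean_space"
  assumes "integrable (lebesgue_on I) k" "A \<in> sets borel"
  shows "integrable (lebesgue_on I) (\<lambda>x. indicator A x *\<^sub>R k x)"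
proof (rule Bochner_Integration.integrable_bound[OF assms(1)])
  show "(\<lambda>x. indicator A x *\<^sub>R k x) \<in> borel_measurable (lebesgue_on I)"
    using assms by (intro borel_measurable_scaleR borel_measurable_indicator_lebesgue_on borel_measurable_integrable)
  show "AE x in lebesgue_on I. norm (indicator A x *\<^sub>R k x) \<le> norm (k x)"
    by (rule AE_I2) (auto simp: indicator_def)
qed

text \<open>The limit is tested along sequences, where dominated convergence applies with majorant
  \<open>norm (k x)\<close>: for each fixed \<open>x\<close> the indicators are eventually
  constant.\<close>

lemma tendsto_integral_end:
  fixes k :: "real \<Rightarrow> complex"
  assumes S: "lep S < rep S" and k: "integrable (lebesgue_on (dom_int S)) k"
  shows "((\<lambda>t. LINT x|lebesgue_on (dom_int S). indicator {c..t} x *\<^sub>R k x) \<longlongrightarrow>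
           (LINT x|lebesgue_on (dom_int S). indicator {c..} x *\<^sub>R k x)) (end_filter S Rend)"
    and "((\<lambda>t. LINT x|lebesgue_on (dom_int S). indicator {t..c} x *\<^sub>R k x) \<longlongrightarrow>
           (LINT x|lebesgue_on (dom_int S). indicator {..c} x *\<^sub>R k x)) (end_filter S Lend)"
proof -
  let ?M = "lebesgue_on (dom_int S)"
  have dc: "(\<lambda>n. LINT x|?M. indicator (A n) x *\<^sub>R k x) \<longlonglongrightarrow> (LINT x|?M. indicator B x *\<^sub>R k x)"
    if A: "\<And>n. A n \<in> sets borel" "B \<in> sets borel"
      and ev: "\<And>x. x \<in> dom_int S \<Longrightarrow> \<forall>\<^sub>F n in sequentially. x \<in> A n \<longleftrightarrow> x \<in> B" for A :: "nat \<Rightarrow> real set" and B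
  proof (rule integral_dominated_convergence[where w = "\<lambda>x. norm (k x)"])
    show "AE x in ?M. (\<lambda>n. indicator (A n) x *\<^sub>R k x) \<longlonglongrightarrow> indicator B x *\<^sub>R k x"
    proof (rule AE_I2)
      fix x assume "x \<in> space ?M"
      then have "\<forall>\<^sub>F n in sequentially. x \<in> A n \<longleftrightarrow> x \<in> B" by (intro ev) (simp add: space_restrict_space)
      then have "\<forall>\<^sub>F n in sequentially. indicator (A n) x *\<^sub>R k x = indicator B x *\<^sub>R k x"
        by eventually_elim (auto simp: indicator_def)
      then show "(\<lambda>n. indicator (A n) x *\<^sub>R k x) \<longlonglongrightarrow> indicator B x *\<^sub>R k x"
        by (rule tendsto_eventually)
    qed
    show "AE x in ?M. norm (indicator (A n) x *\<^sub>R k x) \<le> norm (k x)" for n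
      by (rule AE_I2) (auto simp: indicator_def)
  qed (use k A in \<open>auto intro!: borel_measurable_integrable integrable_indicator_lebesgue_on\<close>)
  show "((\<lambda>t. LINT x|?M. indicator {c..t} x *\<^sub>R k x) \<longlongrightarrow> (LINT x|?M. indicator {c..} x *\<^sub>R k x)) (end_filter S Rend)"
    unfolding end_filter.simps filterlim_filtermap tendsto_at_iff_sequentially o_def
  proof (intro allI impI dc)
    fix X x assume X: "\<forall>i. X i \<in> {..<rep S} - {rep S}" "X \<longlonglongrightarrow> rep S" and x: "x \<in> dom_int S"
    then have "\<forall>\<^sub>F n in sequentially. ereal x < X n"
      by (intro order_tendstoD(1)) (auto simp: einterval_def)
    then show "\<forall>\<^sub>F n in sequentially. (x \<in> {c..real_of_ereal (X n)}) = (x \<in> {c..})"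
    proof eventually_elim
      case (elim n)
      have "X n < rep S" using X(1) by auto
      \<comment> \<open>\<open>real_of_ereal\<close> maps both infinities to 0, so they have to be
        excluded before comparing with \<open>x\<close>.\<close>
      then have "X n \<noteq> \<infinity>" by auto
      moreover have "X n \<noteq> - \<infinity>" using elim by auto
      ultimately have "x < real_of_ereal (X n)" using elim by (cases "X n") auto
      then show ?case by auto
    qed
  qed auto
  show "((\<lambda>t. LINT x|?M. indicator {t..c} x *\<^sub>R k x) \<longlongrightarrow> (LINT x|?M. indicator {..c} x *\<^sub>R k x)) (end_filter S Lend)"
    unfolding end_filter.simps filterlim_filtermap tendsto_at_iff_sequentially o_def
  proof (intro allI impI dc)
    fix X x assume X: "\<forall>i. X i \<in> {lep S<..} - {lep S}" "X \<longlonglongrightarrow> lep S" and x: "x \<in> dom_int S"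
    then have "\<forall>\<^sub>F n in sequentially. X n < ereal x"
      by (intro order_tendstoD(2)) (auto simp: einterval_def)
    then show "\<forall>\<^sub>F n in sequentially. (x \<in> {real_of_ereal (X n)..c}) = (x \<in> {..c})"
    proof eventually_elim
      case (elim n)
      have "lep S < X n" using X(1) by auto
      then have "X n \<noteq> - \<infinity>" by auto
      moreover have "X n \<noteq> \<infinity>" using elim by auto
      ultimately have "real_of_ereal (X n) < x" using elim by (cases "X n") auto
      then show ?case by auto
    qed
  qed auto
qed

section \<open>Regular functions, their quasi-derivatives and the Lagrange identity\<close>

locale sturm_liouville =
  fixes S :: sl_data
  assumes coefficients: "sl_coefficients S"
begin

abbreviation "\<mu> \<equiv> lebesgue_on (dom_int S)"

lemma ends: "lep S < rep S"
  using coefficients by (simp add: sl_coefficients_def)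

lemma dom_int_nonempty: "\<exists>c. c \<in> dom_int S"
  by (rule einterval_nonempty[OF ends])

lemma AE_pos: "AE x in \<mu>. cp S x > 0 \<and> cw S x > 0"
  using coefficients by (simp add: sl_coefficients_def)

lemma coefficients_integrable:
  assumes "{c..d} \<subseteq> dom_int S"
  shows "(\<lambda>x. 1 / cp S x) absolutely_integrable_on {c..d}"
    and "cq S absolutely_integrable_on {c..d}" and "cw S absolutely_integrable_on {c..d}"
  using coefficients assms
  by (auto simp: sl_coefficients_def integrable_lebesgue_on_iff)

lemma measurable_locally_integrable:
  fixes k :: "real \<Rightarrow> 'b::euclidean_space"
  assumes k: "\<And>c d. {c..d} \<subseteq> dom_int S \<Longrightarrow> k absolutely_integrable_on {c..d}"
  shows "k \<in> borel_measurable \<mu>"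
proof -
  obtain u l :: "nat \<Rightarrow> real" where ul: "dom_int S = (\<Union>i. {l i .. u i})"
    by (rule einterval_Icc_approximation[OF ends]) blast
  show ?thesis
  proof (rule measurable_piecewise_restrict2[where A = "\<lambda>i. {l i..u i}"])
    show "space \<mu> = (\<Union>i. {l i..u i})"
      using ul by (simp add: space_restrict_space)
    fix n
    have sub: "{l n..u n} \<subseteq> dom_int S" using ul by auto
    then show "{l n..u n} \<in> sets \<mu>"
      by (auto simp: sets_restrict_space_iff)
    show "\<exists>h\<in>borel_measurable \<mu>. \<forall>x\<in>{l n..u n}. k x = h x"
    proof
      have "integrable (lebesgue_on {l n..u n}) k"
        using k[OF sub] by (subst integrable_lebesgue_on_iff) auto
      then have "k \<in> borel_measurable (lebesgue_on {l n..u n})"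
        by (rule borel_measurable_integrable)
      then show "(\<lambda>x. if x \<in> {l n..u n} then k x else 0) \<in> borel_measurable \<mu>"
        using sub by (subst borel_measurable_if_lebesgue_on) auto
    qed auto
  qed
qed

lemma measurable_cw: "cw S \<in> borel_measurable \<mu>"
  and measurable_cq: "cq S \<in> borel_measurable \<mu>"
  using coefficients_integrable by (auto intro: measurable_locally_integrable)

text \<open>Two representatives are continuous and agree almost everywhere on an open set. Off that
  set the choice in \<open>quasi_deriv\<close> is arbitrary, which is why later identities for
  quasi-derivatives are confined to \<open>dom_int S\<close>.\<close>

lemma is_quasi_deriv_unique:
  assumes "is_quasi_deriv S f h" "is_quasi_deriv S f k" "x \<in> dom_int S"
  shows "h x = k x"
proof (rule continuous_AE_eq[OF open_einterval _ _ _ assms(3)])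
  show "AE x in \<mu>. h x = k x"
    using assms(1,2) unfolding is_quasi_deriv_def by (auto elim: AE_mp)
qed (use assms in \<open>auto simp: is_quasi_deriv_def intro: AC_loc_continuous_on\<close>)

lemma is_quasi_deriv_quasi_deriv: "sl_regular S f \<Longrightarrow> is_quasi_deriv S f (quasi_deriv S f)"
  unfolding sl_regular_def quasi_deriv_def by (metis someI_ex)

lemma AC_loc_quasi_deriv: "sl_regular S f \<Longrightarrow> AC_loc (dom_int S) (quasi_deriv S f)"
  using is_quasi_deriv_quasi_deriv by (simp add: is_quasi_deriv_def)

lemma AC_loc_regular: "sl_regular S f \<Longrightarrow> AC_loc (dom_int S) f"
  by (simp add: sl_regular_def)

lemma AC_loc_AE_vector_derivative:
  assumes "AC_loc (dom_int S) f"
  shows "AE x in \<mu>. (f has_vector_derivative vector_derivative f (at x)) (at x)"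
  unfolding AE_lebesgue_on_open[OF open_einterval]
  by (rule AC_loc_has_derivative[OF assms ends])

lemma has_derivative_regular:
  assumes "sl_regular S f"
  shows "AE x in \<mu>. (f has_vector_derivative quasi_deriv S f x / of_real (cp S x)) (at x)"
proof -
  have "AE x in \<mu>. quasi_deriv S f x = of_real (cp S x) * vector_derivative f (at x)"
    using is_quasi_deriv_quasi_deriv[OF assms] by (simp add: is_quasi_deriv_def)
  with AC_loc_AE_vector_derivative[OF AC_loc_regular[OF assms]] AE_pos show ?thesis
    by eventually_elim auto
qed

lemma has_derivative_quasi_deriv:
  assumes "sl_regular S f"
  shows "AE x in \<mu>.
    (quasi_deriv S f has_vector_derivative - of_real (cw S x) * ell S f x - of_real (cq S x) * f x) (at x)"
  using AC_loc_AE_vector_derivative[OF AC_loc_quasi_deriv[OF assms]] AE_pos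
  by eventually_elim (auto simp: ell_def field_simps)

lemma has_vector_derivative_cong_dom:
  assumes "\<And>x. x \<in> dom_int S \<Longrightarrow> f x = g x" "x \<in> dom_int S" "(g has_vector_derivative D) (at x)"
  shows "(f has_vector_derivative D) (at x)"
  using has_vector_derivative_transform_within_open[OF assms(3) open_einterval assms(2), of f] assms(1) by auto

lemma AE_dom_int: "AE x in \<mu>. x \<in> dom_int S"
  by (rule AE_I2) (simp add: space_restrict_space)

text \<open>Reads the equation as a first-order system for the pair \<open>f\<close>,
  \<open>h\<close>, and identifies \<open>h\<close> with the chosen quasi-derivative and
  \<open>k\<close> with \<open>ell S f\<close>. It serves linear combinations and variation of
  constants alike.\<close>

lemma sl_regularI:
  assumes f: "AC_loc (dom_int S) f" and h: "AC_loc (dom_int S) h"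
    and d: "AE x in \<mu>. (f has_vector_derivative h x / of_real (cp S x)) (at x)"
    and d2: "AE x in \<mu>.
      (h has_vector_derivative - of_real (cw S x) * k x - of_real (cq S x) * f x) (at x)"
  shows "sl_regular S f" and "\<And>x. x \<in> dom_int S \<Longrightarrow> quasi_deriv S f x = h x"
    and "AE x in \<mu>. ell S f x = k x"
proof -
  have "AE x in \<mu>. h x = of_real (cp S x) * vector_derivative f (at x)"
    using d AE_pos by eventually_elim (auto dest: vector_derivative_at)
  then have q: "is_quasi_deriv S f h" using h by (simp add: is_quasi_deriv_def)
  then show r: "sl_regular S f" using f by (auto simp: sl_regular_def)
  show eq: "quasi_deriv S f x = h x" if "x \<in> dom_int S" for x
    by (rule is_quasi_deriv_unique[OF is_quasi_deriv_quasi_deriv[OF r] q that])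
  show "AE x in \<mu>. ell S f x = k x"
    using d2 AE_pos AE_dom_int
  proof eventually_elim
    case (elim x)
    have "vector_derivative (quasi_deriv S f) (at x) = - of_real (cw S x) * k x - of_real (cq S x) * f x"
      using has_vector_derivative_cong_dom[OF eq elim(3) elim(1)] by (rule vector_derivative_at)
    then show ?case using elim(2) by (simp add: ell_def)
  qed
qed

lemma sl_regular_linear:
  assumes f: "sl_regular S f" and g: "sl_regular S g"
  shows "sl_regular S (\<lambda>x. \<alpha> * f x + \<beta> * g x)"
    and "\<And>x. x \<in> dom_int S \<Longrightarrow>
      quasi_deriv S (\<lambda>x. \<alpha> * f x + \<beta> * g x) x = \<alpha> * quasi_deriv S f x + \<beta> * quasi_deriv S g x"
    and "AE x in \<mu>. ell S (\<lambda>x. \<alpha> * f x + \<beta> * g x) x = \<alpha> * ell S f x + \<beta> * ell S g x"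
proof -
  have lin: "AC_loc (dom_int S) (\<lambda>x. \<alpha> * f x + \<beta> * g x)"
    if "AC_loc (dom_int S) f" "AC_loc (dom_int S) g" for f g
    using that by (intro AC_loc_add AC_loc_mult AC_loc_const)
  have d: "AE x in \<mu>. ((\<lambda>x. \<alpha> * f x + \<beta> * g x) has_vector_derivative
      (\<alpha> * quasi_deriv S f x + \<beta> * quasi_deriv S g x) / of_real (cp S x)) (at x)"
    using has_derivative_regular[OF f] has_derivative_regular[OF g]
    by eventually_elim (auto intro!: derivative_eq_intros simp: add_divide_distrib)
  have d2: "AE x in \<mu>.
     ((\<lambda>x. \<alpha> * quasi_deriv S f x + \<beta> * quasi_deriv S g x) has_vector_derivative
      - of_real (cw S x) * (\<alpha> * ell S f x + \<beta> * ell S g x) - of_real (cq S x) * (\<alpha> * f x + \<beta> * g x)) (at x)"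
    using has_derivative_quasi_deriv[OF f] has_derivative_quasi_deriv[OF g]
    by eventually_elim (auto intro!: derivative_eq_intros simp: algebra_simps)
  note * = sl_regularI[OF lin[OF f[THEN AC_loc_regular] g[THEN AC_loc_regular]]
      lin[OF f[THEN AC_loc_quasi_deriv] g[THEN AC_loc_quasi_deriv]] d d2]
  show "sl_regular S (\<lambda>x. \<alpha> * f x + \<beta> * g x)"
    and "\<And>x. x \<in> dom_int S \<Longrightarrow>
      quasi_deriv S (\<lambda>x. \<alpha> * f x + \<beta> * g x) x = \<alpha> * quasi_deriv S f x + \<beta> * quasi_deriv S g x"
    and "AE x in \<mu>. ell S (\<lambda>x. \<alpha> * f x + \<beta> * g x) x = \<alpha> * ell S f x + \<beta> * ell S g x"
    by (fact *)+
qed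

text \<open>The imaginary part of \<open>cfun u\<close> is constant, so \<open>p u'\<close> is real
  almost everywhere; continuity does the rest.\<close>

lemma quasi_deriv_real:
  assumes "sl_regular S (cfun u)" "x \<in> dom_int S"
  shows "cnj (quasi_deriv S (cfun u) x) = quasi_deriv S (cfun u) x"
proof (rule continuous_AE_eq[OF open_einterval _ _ _ assms(2)])
  show "AE x in \<mu>. cnj (quasi_deriv S (cfun u) x) = quasi_deriv S (cfun u) x"
    using has_derivative_regular[OF assms(1)] AE_pos
  proof eventually_elim
    case (elim x)
    have "((\<lambda>x. Im (cfun u x)) has_vector_derivative Im (quasi_deriv S (cfun u) x / of_real (cp S x))) (at x)"
      using bounded_linear.has_vector_derivative[OF bounded_linear_Im elim(1)] .
    moreover have "((\<lambda>x. Im (cfun u x)) has_vector_derivative 0) (at x)"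
      by (simp add: cfun_def)
    ultimately have "Im (quasi_deriv S (cfun u) x / of_real (cp S x)) = 0"
      by (rule vector_derivative_unique_at)
    then show ?case using elim(2) by (simp add: complex_eq_iff)
  qed
qed (intro AC_loc_continuous_on AC_loc_cnj AC_loc_quasi_deriv assms(1))+

text \<open>Lagrange identity: in the derivative of the bracket the terms with \<open>1 / p\<close>
  cancel and so do those with \<open>q\<close>, since both coefficients are real.\<close>

lemma bracket_has_integral:
  assumes f: "sl_regular S f" and g: "sl_regular S g" and cd: "c \<le> d" "{c..d} \<subseteq> dom_int S"
  shows "((\<lambda>x. (ell S f x * cnj (g x) - f x * cnj (ell S g x)) * of_real (cw S x))
     has_integral bracket S f g d - bracket S f g c) {c..d}"
proof -
  have AC: "AC_loc (dom_int S) (bracket S f g)"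
  proof -
    have "AC_loc (dom_int S) (\<lambda>x. f x * cnj (quasi_deriv S g x) + (- 1) * (quasi_deriv S f x * cnj (g x)))"
      using f g by (intro AC_loc_add AC_loc_mult AC_loc_cnj AC_loc_const AC_loc_regular AC_loc_quasi_deriv)
    moreover have "(\<lambda>x. f x * cnj (quasi_deriv S g x) + (- 1) * (quasi_deriv S f x * cnj (g x))) = bracket S f g"
      by (auto simp: bracket_def)
    ultimately show ?thesis by simp
  qed
  have "AE x in \<mu>. vector_derivative (bracket S f g) (at x) =
     (ell S f x * cnj (g x) - f x * cnj (ell S g x)) * of_real (cw S x)"
    using has_derivative_regular[OF f] has_derivative_regular[OF g]
      has_derivative_quasi_deriv[OF f] has_derivative_quasi_deriv[OF g]
  proof eventually_elim
    case (elim x)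
    have "(bracket S f g has_vector_derivative (ell S f x * cnj (g x) - f x * cnj (ell S g x)) * of_real (cw S x)) (at x)"
      unfolding bracket_def
      by (rule derivative_eq_intros bounded_linear.has_vector_derivative[OF bounded_linear_cnj] elim refl)+
         (simp add: algebra_simps)
    then show ?case by (rule vector_derivative_at)
  qed
  then obtain N where N: "negligible N" "\<forall>x\<in>dom_int S - N. vector_derivative (bracket S f g) (at x) =
     (ell S f x * cnj (g x) - f x * cnj (ell S g x)) * of_real (cw S x)"
    unfolding AE_lebesgue_on_open[OF open_einterval] by blast
  have "((\<lambda>x. vector_derivative (bracket S f g) (at x)) has_integral bracket S f g d - bracket S f g c) {c..d}"
    using AC_loc_has_integral[OF AC ends cd] by blast
  then show ?thesis
    by (rule has_integral_spike[OF N(1), rotated]) (use N(2) cd in force)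
qed

lemma DmaxD:
  assumes "f \<in> Dmax S"
  shows "sl_regular S f" "f \<in> L2_space S" "ell S f \<in> L2_space S"
  using assms by (auto simp: Dmax_def)

lemma L2_product_integrable:
  assumes "f \<in> L2_space S" "g \<in> L2_space S"
  shows "integrable \<mu> (\<lambda>x. f x * cnj (g x) * of_real (cw S x))"
proof (rule Bochner_Integration.integrable_bound)
  show "integrable \<mu> (\<lambda>x. (cmod (f x))\<^sup>2 * cw S x + (cmod (g x))\<^sup>2 * cw S x)"
    using assms by (intro Bochner_Integration.integrable_add) (auto simp: L2_space_def)
  have "f \<in> borel_measurable \<mu>" "g \<in> borel_measurable \<mu>"
    using assms by (auto simp: L2_space_def)
  then show "(\<lambda>x. f x * cnj (g x) * of_real (cw S x)) \<in> borel_measurable \<mu>"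
    by (intro borel_measurable_times measurable_cw borel_measurable_continuous_on[of cnj]
        borel_measurable_continuous_on[of of_real]) (auto intro!: continuous_intros)
  show "AE x in \<mu>. norm (f x * cnj (g x) * of_real (cw S x))
     \<le> norm ((cmod (f x))\<^sup>2 * cw S x + (cmod (g x))\<^sup>2 * cw S x)"
    using AE_pos
  proof eventually_elim
    case (elim x)
    have "cmod (f x) * cmod (g x) \<le> (cmod (f x))\<^sup>2 + (cmod (g x))\<^sup>2"
      using sum_squares_bound[of "cmod (f x)" "cmod (g x)"] mult_nonneg_nonneg[OF norm_ge_zero[of "f x"] norm_ge_zero[of "g x"]]
      by linarith
    then have "cmod (f x) * cmod (g x) * cw S x \<le> ((cmod (f x))\<^sup>2 + (cmod (g x))\<^sup>2) * cw S x"
      using elim by (intro mult_right_mono) auto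
    then show ?case using elim by (simp add: norm_mult algebra_simps abs_of_pos)
  qed
qed

text \<open>The Lagrange identity writes a bracket as its value at an interior point
  \<open>c\<close> plus an integral, and the integrand is integrable over the whole interval because
  products of members of \<open>L2_space\<close> are. So the limits exist, and their difference is
  the full integral.\<close>

lemma bracket_limits:
  assumes f: "f \<in> Dmax S" and g: "g \<in> Dmax S"
  shows bracket_tendsto: "(bracket S f g \<longlongrightarrow> end_bracket S e f g) (end_filter S e)"
    and Green: "end_bracket S Rend f g - end_bracket S Lend f g = L2_inner S (ell S f) g - L2_inner S f (ell S g)"
proof -
  note f' = DmaxD[OF f] and g' = DmaxD[OF g]
  let ?k = "\<lambda>x. (ell S f x * cnj (g x) - f x * cnj (ell S g x)) * of_real (cw S x)"
  have i1: "integrable \<mu> (\<lambda>x. ell S f x * cnj (g x) * of_real (cw S x))"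
    by (rule L2_product_integrable[OF f'(3) g'(2)])
  have i2: "integrable \<mu> (\<lambda>x. f x * cnj (ell S g x) * of_real (cw S x))"
    by (rule L2_product_integrable[OF f'(2) g'(3)])
  have k: "integrable \<mu> ?k"
    using Bochner_Integration.integrable_diff[OF i1 i2] by (simp add: algebra_simps)
  have kint: "(LINT x|\<mu>. ?k x) = L2_inner S (ell S f) g - L2_inner S f (ell S g)"
    using Bochner_Integration.integral_diff[OF i1 i2] by (simp add: algebra_simps L2_inner_def)
  obtain c where c: "c \<in> dom_int S" using dom_int_nonempty by blast
  have step: "bracket S f g y - bracket S f g x = (LINT t|\<mu>. indicator {x..y} t *\<^sub>R ?k t)"
    if "x \<in> dom_int S" "y \<in> dom_int S" "x \<le> y" for x y
  proof -
    have sub: "{x..y} \<subseteq> dom_int S" using Icc_subset_einterval that by blast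
    have "?k absolutely_integrable_on dom_int S"
      using k by (subst (asm) integrable_lebesgue_on_iff) auto
    then have ai: "?k absolutely_integrable_on {x..y}"
      by (rule set_integrable_subset) (use sub in auto)
    have "bracket S f g y - bracket S f g x = integral {x..y} ?k"
      using bracket_has_integral[OF f'(1) g'(1) that(3) sub] by (rule integral_unique[symmetric])
    also have "\<dots> = (LINT t:{x..y}|lebesgue. ?k t)"
      by (rule set_lebesgue_integral_eq_integral(2)[OF ai, symmetric])
    also have "\<dots> = (LINT t|\<mu>. indicator {x..y} t *\<^sub>R ?k t)"
      unfolding set_lebesgue_integral_def
      by (subst integral_restrict_space) (use sub in \<open>auto intro!: Bochner_Integration.integral_cong simp: indicator_def\<close>)
    finally show ?thesis .
  qed
  define R where "R = bracket S f g c + (LINT x|\<mu>. indicator {c..} x *\<^sub>R ?k x)"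
  define L where "L = bracket S f g c - (LINT x|\<mu>. indicator {..c} x *\<^sub>R ?k x)"
  have R: "(bracket S f g \<longlongrightarrow> R) (end_filter S Rend)"
    unfolding R_def
  proof (rule Lim_transform_eventually)
    show "((\<lambda>t. bracket S f g c + (LINT x|\<mu>. indicator {c..t} x *\<^sub>R ?k x)) \<longlongrightarrow>
       bracket S f g c + (LINT x|\<mu>. indicator {c..} x *\<^sub>R ?k x)) (end_filter S Rend)"
      by (intro tendsto_add tendsto_const tendsto_integral_end(1)[OF ends k])
    show "\<forall>\<^sub>F t in end_filter S Rend. bracket S f g c + (LINT x|\<mu>. indicator {c..t} x *\<^sub>R ?k x) = bracket S f g t"
      using end_filter_Rend_eventually[OF ends c] by eventually_elim (use step[OF c] in \<open>auto simp: algebra_simps\<close>)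
  qed
  have L: "(bracket S f g \<longlongrightarrow> L) (end_filter S Lend)"
    unfolding L_def
  proof (rule Lim_transform_eventually)
    show "((\<lambda>t. bracket S f g c - (LINT x|\<mu>. indicator {t..c} x *\<^sub>R ?k x)) \<longlongrightarrow>
       bracket S f g c - (LINT x|\<mu>. indicator {..c} x *\<^sub>R ?k x)) (end_filter S Lend)"
      by (intro tendsto_diff tendsto_const tendsto_integral_end(2)[OF ends k])
    show "\<forall>\<^sub>F t in end_filter S Lend. bracket S f g c - (LINT x|\<mu>. indicator {t..c} x *\<^sub>R ?k x) = bracket S f g t"
      using end_filter_Lend_eventually[OF ends c] by eventually_elim (use step[OF _ c] in \<open>auto simp: algebra_simps\<close>)
  qed
  have eR: "end_bracket S Rend f g = R" and eL: "end_bracket S Lend f g = L"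
    unfolding end_bracket_def by (rule tendsto_Lim[OF end_filter_not_bot[OF ends]], rule R L)+
  show "(bracket S f g \<longlongrightarrow> end_bracket S e f g) (end_filter S e)"
    using R L eR eL by (cases e) auto
  have "R - L = (LINT x|\<mu>. indicator {c..} x *\<^sub>R ?k x) + (LINT x|\<mu>. indicator {..c} x *\<^sub>R ?k x)"
    by (simp add: R_def L_def)
  also have "\<dots> = (LINT x|\<mu>. indicator {c..} x *\<^sub>R ?k x + indicator {..c} x *\<^sub>R ?k x)"
    by (intro Bochner_Integration.integral_add[symmetric] integrable_indicator_lebesgue_on k) auto
  also have "\<dots> = (LINT x|\<mu>. ?k x)"
  proof (rule integral_cong_AE)
    \<comment> \<open>The two half-lines share only the point \<open>c\<close>, which has measure
      zero.\<close>
    have "AE x in \<mu>. x \<noteq> c"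
      unfolding AE_lebesgue_on_open[OF open_einterval] by (rule exI[of _ "{c}"]) auto
    then show "AE x in \<mu>. indicator {c..} x *\<^sub>R ?k x + indicator {..c} x *\<^sub>R ?k x = ?k x"
      by eventually_elim (auto simp: indicator_def)
    show "(\<lambda>x. indicator {c..} x *\<^sub>R ?k x + indicator {..c} x *\<^sub>R ?k x) \<in> borel_measurable \<mu>"
      by (intro borel_measurable_integrable Bochner_Integration.integrable_add integrable_indicator_lebesgue_on k) auto
  qed (use k in auto)
  finally show "end_bracket S Rend f g - end_bracket S Lend f g = L2_inner S (ell S f) g - L2_inner S f (ell S g)"
    using kint eR eL by simp
qed

end

section \<open>The weighted space and the maximal domain\<close>

context sturm_liouville
begin

lemma measurable_of_real_comp:
  "k \<in> borel_measurable M \<Longrightarrow> (\<lambda>x. complex_of_real (k x)) \<in> borel_measurable M"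
  by (rule borel_measurable_continuous_on[of of_real]) (auto intro!: continuous_intros)

lemma measurable_regular:
  assumes "AC_loc (dom_int S) f"
  shows "f \<in> borel_measurable \<mu>"
  using AC_loc_continuous_on[OF assms] by (rule continuous_imp_measurable_on_sets_lebesgue) simp

lemma measurable_ell:
  assumes "sl_regular S f"
  shows "ell S f \<in> borel_measurable \<mu>"
proof -
  have "(\<lambda>x. vector_derivative (quasi_deriv S f) (at x)) \<in> borel_measurable \<mu>"
  proof (rule measurable_locally_integrable)
    fix c d assume cd: "{c..d} \<subseteq> dom_int S"
    show "(\<lambda>x. vector_derivative (quasi_deriv S f) (at x)) absolutely_integrable_on {c..d}"
    proof (cases "c \<le> d")
      case True
      then show ?thesis
        using AC_loc_has_integral[OF AC_loc_quasi_deriv[OF assms] ends _ cd] by blast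
    qed simp
  qed
  then show ?thesis
    unfolding ell_def[abs_def]
    by (intro borel_measurable_times borel_measurable_add borel_measurable_uminus borel_measurable_divide
        measurable_of_real_comp measurable_cw measurable_cq borel_measurable_const
        measurable_regular[OF AC_loc_regular[OF assms]])
qed

lemma measurable_weighted_square:
  "f \<in> borel_measurable \<mu> \<Longrightarrow>
    (\<lambda>x. (cmod (f x))\<^sup>2 * cw S x) \<in> borel_measurable \<mu>"
  by (intro borel_measurable_times borel_measurable_power measurable_compose[OF _ borel_measurable_norm] measurable_cw)

lemma L2_space_cong:
  assumes "f \<in> L2_space S" "g \<in> borel_measurable \<mu>"
    "AE x in \<mu>. g x = f x"
  shows "g \<in> L2_space S"
proof -
  have "integrable \<mu> (\<lambda>x. (cmod (g x))\<^sup>2 * cw S x)"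
  proof (rule integrable_cong_AE_imp)
    show "integrable \<mu> (\<lambda>x. (cmod (f x))\<^sup>2 * cw S x)"
      using assms by (simp add: L2_space_def)
    show "AE x in \<mu>. (cmod (f x))\<^sup>2 * cw S x = (cmod (g x))\<^sup>2 * cw S x"
      using assms(3) by eventually_elim simp
  qed (rule measurable_weighted_square[OF assms(2)])
  then show ?thesis using assms by (simp add: L2_space_def)
qed

lemma L2_norm_cong:
  assumes "f \<in> borel_measurable \<mu>" "g \<in> borel_measurable \<mu>"
    "AE x in \<mu>. f x = g x"
  shows "L2_norm S f = L2_norm S g"
proof -
  have "AE x in \<mu>. (cmod (f x))\<^sup>2 * cw S x = (cmod (g x))\<^sup>2 * cw S x"
    using assms(3) by eventually_elim simp
  then have "(LINT x|\<mu>. (cmod (f x))\<^sup>2 * cw S x) = (LINT x|\<mu>. (cmod (g x))\<^sup>2 * cw S x)"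
    using assms by (intro integral_cong_AE measurable_weighted_square)
  then show ?thesis by (simp add: L2_norm_def)
qed

lemma L2_inner_cong:
  assumes "f \<in> borel_measurable \<mu>" "f' \<in> borel_measurable \<mu>"
    "g \<in> borel_measurable \<mu>" "g' \<in> borel_measurable \<mu>"
    "AE x in \<mu>. f x = f' x" "AE x in \<mu>. g x = g' x"
  shows "L2_inner S f g = L2_inner S f' g'"
proof -
  have "AE x in \<mu>. f x * cnj (g x) * of_real (cw S x) = f' x * cnj (g' x) * of_real (cw S x)"
    using assms(5,6) by eventually_elim simp
  then show ?thesis
    unfolding L2_inner_def using assms(1-4)
    by (intro integral_cong_AE borel_measurable_times measurable_of_real_comp measurable_cw
        borel_measurable_continuous_on[of cnj]) (auto intro!: continuous_intros)
qed

lemma L2_space_measurable: "f \<in> L2_space S \<Longrightarrow> f \<in> borel_measurable \<mu>"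
  by (simp add: L2_space_def)

lemma cmod_add_square_le: "(cmod (a + b))\<^sup>2 \<le> 2 * (cmod a)\<^sup>2 + 2 * (cmod b)\<^sup>2"
proof -
  have "(cmod (a + b))\<^sup>2 \<le> (cmod a + cmod b)\<^sup>2"
    by (intro power_mono norm_triangle_ineq) auto
  also have "\<dots> \<le> 2 * (cmod a)\<^sup>2 + 2 * (cmod b)\<^sup>2"
    using sum_squares_bound[of "cmod a" "cmod b"] by (simp add: power2_sum)
  finally show ?thesis .
qed

text \<open>The factor 2 comes from \<open>(a + b)^2 <= 2 a^2 + 2 b^2\<close>. It is cruder than the
  triangle inequality but keeps estimates linear in the norms, which is enough for boundedness of an
  inverse.\<close>

lemma L2_space_add:
  assumes "f \<in> L2_space S" "g \<in> L2_space S"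
  shows "(\<lambda>x. f x + g x) \<in> L2_space S"
    and "L2_norm S (\<lambda>x. f x + g x) \<le> 2 * (L2_norm S f + L2_norm S g)"
proof -
  have i: "integrable \<mu> (\<lambda>x. (cmod (f x))\<^sup>2 * cw S x)" "integrable \<mu> (\<lambda>x. (cmod (g x))\<^sup>2 * cw S x)"
    using assms by (auto simp: L2_space_def)
  have m: "(\<lambda>x. f x + g x) \<in> borel_measurable \<mu>"
    using assms by (auto simp: L2_space_def)
  have b: "AE x in \<mu>. (cmod (f x + g x))\<^sup>2 * cw S x \<le> 2 * ((cmod (f x))\<^sup>2 * cw S x) + 2 * ((cmod (g x))\<^sup>2 * cw S x)"
    using AE_pos
  proof eventually_elim
    case (elim x)
    have "(cmod (f x + g x))\<^sup>2 * cw S x \<le> (2 * (cmod (f x))\<^sup>2 + 2 * (cmod (g x))\<^sup>2) * cw S x"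
      using elim cmod_add_square_le by (intro mult_right_mono) auto
    then show ?case by (simp add: algebra_simps)
  qed
  have ib: "integrable \<mu> (\<lambda>x. 2 * ((cmod (f x))\<^sup>2 * cw S x) + 2 * ((cmod (g x))\<^sup>2 * cw S x))"
    using i by auto
  have isum: "integrable \<mu> (\<lambda>x. (cmod (f x + g x))\<^sup>2 * cw S x)"
  proof (rule Bochner_Integration.integrable_bound[OF ib measurable_weighted_square[OF m]])
    show "AE x in \<mu>. norm ((cmod (f x + g x))\<^sup>2 * cw S x) \<le> norm (2 * ((cmod (f x))\<^sup>2 * cw S x) + 2 * ((cmod (g x))\<^sup>2 * cw S x))"
      using b AE_pos by eventually_elim auto
  qed
  then show "(\<lambda>x. f x + g x) \<in> L2_space S" using m by (simp add: L2_space_def)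
  have nn: "0 \<le> (LINT x|\<mu>. (cmod (h x))\<^sup>2 * cw S x)" for h
    by (rule integral_nonneg_AE) (use AE_pos in \<open>eventually_elim, auto\<close>)
  have "(LINT x|\<mu>. (cmod (f x + g x))\<^sup>2 * cw S x) \<le>
      (LINT x|\<mu>. 2 * ((cmod (f x))\<^sup>2 * cw S x) + 2 * ((cmod (g x))\<^sup>2 * cw S x))"
    by (rule integral_mono_AE[OF isum ib b])
  also have "\<dots> = 2 * (LINT x|\<mu>. (cmod (f x))\<^sup>2 * cw S x) + 2 * (LINT x|\<mu>. (cmod (g x))\<^sup>2 * cw S x)"
    using i by simp
  also have "\<dots> = 2 * (L2_norm S f)\<^sup>2 + 2 * (L2_norm S g)\<^sup>2"
    using nn by (simp add: L2_norm_def)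
  also have "\<dots> \<le> (2 * (L2_norm S f + L2_norm S g))\<^sup>2"
    using nn by (auto simp: L2_norm_def power2_eq_square algebra_simps)
  finally show "L2_norm S (\<lambda>x. f x + g x) \<le> 2 * (L2_norm S f + L2_norm S g)"
    using nn unfolding L2_norm_def[of _ "\<lambda>x. f x + g x"]
    by (intro real_le_lsqrt) (auto simp: L2_norm_def)
qed

lemma L2_space_mult:
  assumes "f \<in> L2_space S"
  shows "(\<lambda>x. c * f x) \<in> L2_space S"
    and "L2_norm S (\<lambda>x. c * f x) = cmod c * L2_norm S f"
proof -
  have eq: "(cmod (c * f x))\<^sup>2 * cw S x = (cmod c)\<^sup>2 * ((cmod (f x))\<^sup>2 * cw S x)" for x
    by (simp add: norm_mult power_mult_distrib)
  show "(\<lambda>x. c * f x) \<in> L2_space S"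
    using assms by (auto simp: L2_space_def eq)
  show "L2_norm S (\<lambda>x. c * f x) = cmod c * L2_norm S f"
    using assms by (simp add: L2_norm_def eq real_sqrt_mult)
qed

lemma L2_norm_nonneg: "0 \<le> L2_norm S f"
proof -
  have "0 \<le> (LINT x|\<mu>. (cmod (f x))\<^sup>2 * cw S x)"
    by (rule integral_nonneg_AE) (use AE_pos in \<open>eventually_elim, auto\<close>)
  then show ?thesis by (simp add: L2_norm_def)
qed

lemma L2_norm_square:
  "(L2_norm S f)\<^sup>2 = (LINT x|\<mu>. (cmod (f x))\<^sup>2 * cw S x)"
proof -
  have "0 \<le> (LINT x|\<mu>. (cmod (f x))\<^sup>2 * cw S x)"
    by (rule integral_nonneg_AE) (use AE_pos in \<open>eventually_elim, auto\<close>)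
  then show ?thesis by (simp add: L2_norm_def)
qed

lemma L2_norm_zero_iff:
  assumes "f \<in> L2_space S"
  shows "L2_norm S f = 0 \<longleftrightarrow> L2_eq S f (\<lambda>x. 0)"
proof -
  have "L2_norm S f = 0 \<longleftrightarrow> (LINT x|\<mu>. (cmod (f x))\<^sup>2 * cw S x) = 0"
    by (simp add: L2_norm_def)
  also have "\<dots> \<longleftrightarrow> (AE x in \<mu>. (cmod (f x))\<^sup>2 * cw S x = 0)"
  proof (rule integral_nonneg_eq_0_iff_AE)
    show "AE x in \<mu>. 0 \<le> (cmod (f x))\<^sup>2 * cw S x"
      using AE_pos by eventually_elim auto
  qed (use assms in \<open>simp add: L2_space_def\<close>)
  also have "\<dots> \<longleftrightarrow> (AE x in \<mu>. f x = 0)"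
  proof
    assume "AE x in \<mu>. (cmod (f x))\<^sup>2 * cw S x = 0"
    with AE_pos show "AE x in \<mu>. f x = 0" by eventually_elim auto
  next
    assume "AE x in \<mu>. f x = 0"
    then show "AE x in \<mu>. (cmod (f x))\<^sup>2 * cw S x = 0" by eventually_elim auto
  qed
  finally show ?thesis by (simp add: L2_eq_def)
qed

lemma L2_Cauchy_Schwarz:
  assumes "f \<in> L2_space S" "g \<in> L2_space S"
  shows "cmod (L2_inner S f g) \<le> L2_norm S f * L2_norm S g"
proof -
  define J where "J = (LINT x|\<mu>. cmod (f x) * cmod (g x) * cw S x)"
  have i: "integrable \<mu> (\<lambda>x. (cmod (f x))\<^sup>2 * cw S x)" "integrable \<mu> (\<lambda>x. (cmod (g x))\<^sup>2 * cw S x)"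
    using assms by (auto simp: L2_space_def)
  have AEn: "AE x in \<mu>. norm (f x * cnj (g x) * of_real (cw S x)) = cmod (f x) * cmod (g x) * cw S x"
    using AE_pos by eventually_elim (simp add: norm_mult)
  have m: "(\<lambda>x. cmod (f x) * cmod (g x) * cw S x) \<in> borel_measurable \<mu>"
    using assms measurable_cw by (auto simp: L2_space_def)
  have iJ: "integrable \<mu> (\<lambda>x. cmod (f x) * cmod (g x) * cw S x)"
    by (rule integrable_cong_AE_imp[OF integrable_norm[OF L2_product_integrable[OF assms]] m])
       (use AEn in \<open>eventually_elim, simp\<close>)
  have "cmod (L2_inner S f g) \<le> (LINT x|\<mu>. norm (f x * cnj (g x) * of_real (cw S x)))"
    unfolding L2_inner_def by (rule integral_norm_bound)
  also have "\<dots> = J"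
    unfolding J_def
    by (rule integral_cong_AE[OF _ m AEn])
       (rule measurable_compose[OF borel_measurable_integrable[OF L2_product_integrable[OF assms]] borel_measurable_norm])
  finally have le: "cmod (L2_inner S f g) \<le> J" .
  \<comment> \<open>The weights are free: if both norms are positive, each function gets the norm of
    the other; if a norm vanishes, its function gets the square of the other norm divided by
    \<open>J\<close>.\<close>
  have quad: "2 * s * t * J \<le> s\<^sup>2 * (L2_norm S f)\<^sup>2 + t\<^sup>2 * (L2_norm S g)\<^sup>2" for s t :: real
  proof -
    have "(LINT x|\<mu>. 2 * s * t * (cmod (f x) * cmod (g x) * cw S x)) \<le>
       (LINT x|\<mu>. s\<^sup>2 * ((cmod (f x))\<^sup>2 * cw S x) + t\<^sup>2 * ((cmod (g x))\<^sup>2 * cw S x))"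
    proof (rule integral_mono_AE)
      show "AE x in \<mu>. 2 * s * t * (cmod (f x) * cmod (g x) * cw S x) \<le> s\<^sup>2 * ((cmod (f x))\<^sup>2 * cw S x) + t\<^sup>2 * ((cmod (g x))\<^sup>2 * cw S x)"
        using AE_pos
      proof eventually_elim
        case (elim x)
        have "(2 * (s * cmod (f x)) * (t * cmod (g x))) * cw S x \<le> ((s * cmod (f x))\<^sup>2 + (t * cmod (g x))\<^sup>2) * cw S x"
          using elim by (intro mult_right_mono sum_squares_bound) auto
        then show ?case by (simp add: algebra_simps power_mult_distrib)
      qed
    qed (use i iJ in auto)
    then show ?thesis using i iJ by (simp add: J_def L2_norm_square)
  qed
  have "J \<le> L2_norm S f * L2_norm S g"
  proof (cases "L2_norm S f = 0 \<or> L2_norm S g = 0")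
    case True
    have "J \<le> 0"
    proof (rule ccontr)
      assume "\<not> J \<le> 0"
      then have J: "J > 0" by simp
      show False
      proof (cases "L2_norm S f = 0")
        case True
        have "2 * ((L2_norm S g)\<^sup>2 / J) * 1 * J \<le> (L2_norm S g)\<^sup>2"
          using quad[of "(L2_norm S g)\<^sup>2 / J" 1] True by simp
        then have "(L2_norm S g)\<^sup>2 \<le> 0" using J by simp
        then have "L2_norm S g = 0" by simp
        then show False using quad[of 1 1] True J by simp
      next
        case False
        then have g0: "L2_norm S g = 0" using True by simp
        have "2 * 1 * ((L2_norm S f)\<^sup>2 / J) * J \<le> (L2_norm S f)\<^sup>2"
          using quad[of 1 "(L2_norm S f)\<^sup>2 / J"] g0 by simp
        then show False using J False by simp
      qed
    qed
    then show ?thesis using True by auto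
  next
    case False
    then have pos: "L2_norm S f > 0" "L2_norm S g > 0"
      using L2_norm_nonneg[of f] L2_norm_nonneg[of g] by linarith+
    have "2 * (L2_norm S g * L2_norm S f) * J \<le> 2 * (L2_norm S g * L2_norm S f) * (L2_norm S f * L2_norm S g)"
      using quad[of "L2_norm S g" "L2_norm S f"] by (simp add: power2_eq_square algebra_simps)
    then show ?thesis using pos by (subst (asm) mult_le_cancel_left_pos) auto
  qed
  then show ?thesis using le by simp
qed

section \<open>The maximal domain and brackets at the endpoints\<close>

lemma Dmax_linear:
  assumes "f \<in> Dmax S" "g \<in> Dmax S"
  shows "(\<lambda>x. \<alpha> * f x + \<beta> * g x) \<in> Dmax S"
proof -
  note f = DmaxD[OF assms(1)] and g = DmaxD[OF assms(2)]
  note l = sl_regular_linear[OF f(1) g(1), where \<alpha> = \<alpha> and \<beta> = \<beta>]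
  have "ell S (\<lambda>x. \<alpha> * f x + \<beta> * g x) \<in> L2_space S"
    by (rule L2_space_cong[OF _ measurable_ell[OF l(1)] l(3)])
       (intro L2_space_add L2_space_mult f g)
  then show ?thesis
    using l(1) f g by (auto simp: Dmax_def intro: L2_space_add L2_space_mult)
qed

lemma Dmax_scale: "f \<in> Dmax S \<Longrightarrow> (\<lambda>x. \<alpha> * f x) \<in> Dmax S"
  using Dmax_linear[of f f \<alpha> 0] by simp

text \<open>The limit-circle condition gives square integrability near each endpoint; on the
  remaining compact interval the solution is bounded and \<open>w\<close> is integrable.\<close>

lemma solution_in_Dmax:
  assumes y: "sl_solution S z y" and lc: "limit_circle S Lend" "limit_circle S Rend"
  shows "y \<in> Dmax S"
proof -
  let ?k = "\<lambda>x. (cmod (y x))\<^sup>2 * cw S x"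
  have r: "sl_regular S y" and e: "AE x in \<mu>. ell S y x = z * y x"
    using y by (auto simp: sl_solution_def)
  obtain c1 where c1: "c1 \<in> dom_int S" "integrable (lebesgue_on {x \<in> dom_int S. x < c1}) ?k"
    using lc(1) y by (auto simp: limit_circle_def integrable_near_def)
  obtain c2 where c2: "c2 \<in> dom_int S" "integrable (lebesgue_on {x \<in> dom_int S. c2 < x}) ?k"
    using lc(2) y by (auto simp: limit_circle_def integrable_near_def)
  \<comment> \<open>With \<open>min\<close> and \<open>max\<close> the three pieces cover the
    interval whichever of \<open>c1\<close>, \<open>c2\<close> is larger.\<close>
  let ?A = "{x \<in> dom_int S. x < c1}" and ?B = "{x \<in> dom_int S. c2 < x}" and ?C = "{min c1 c2..max c1 c2}"
  have "?A = dom_int S \<inter> {..<c1}" "?B = dom_int S \<inter> {c2<..}" by auto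
  then have AB: "?A \<in> sets lebesgue" "?B \<in> sets lebesgue" by (simp_all add: sets_completionI_sets)
  have sub: "?C \<subseteq> dom_int S"
    by (rule Icc_subset_einterval) (use c1 c2 in \<open>auto simp: min_def max_def\<close>)
  have C: "?k absolutely_integrable_on ?C"
  proof (rule absolutely_integrable_bounded_measurable_product_real)
    have cont: "continuous_on ?C (\<lambda>x. (cmod (y x))\<^sup>2)"
      using continuous_on_subset[OF AC_loc_continuous_on[OF AC_loc_regular[OF r]] sub]
      by (intro continuous_intros)
    then show "(\<lambda>x. (cmod (y x))\<^sup>2) \<in> borel_measurable (lebesgue_on ?C)"
      by (rule continuous_imp_measurable_on_sets_lebesgue) simp
    show "bounded ((\<lambda>x. (cmod (y x))\<^sup>2) ` ?C)"
      using compact_continuous_image[OF cont] by (simp add: compact_imp_bounded)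
  qed (use coefficients_integrable(3)[OF sub] in auto)
  have "?k absolutely_integrable_on (?A \<union> ?C \<union> ?B)"
    using c1(2) c2(2) AB C
    by (intro absolutely_integrable_Un) (auto simp: integrable_lebesgue_on_iff)
  moreover have "?A \<union> ?C \<union> ?B = dom_int S" using sub by auto
  ultimately have "integrable \<mu> ?k"
    by (simp add: integrable_lebesgue_on_iff)
  then have y2: "y \<in> L2_space S"
    using measurable_regular[OF AC_loc_regular[OF r]] by (simp add: L2_space_def)
  then have "ell S y \<in> L2_space S"
    by (intro L2_space_cong[OF L2_space_mult(1)[of y z] measurable_ell[OF r] e])
  then show ?thesis using r y2 by (simp add: Dmax_def)
qed

text \<open>A bracket at an endpoint depends only on the functions near it; this is how patched
  functions and pointwise identities are evaluated.\<close>

lemma end_bracket_eqI: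
  assumes "f \<in> Dmax S" "g \<in> Dmax S" "(h \<longlongrightarrow> L) (end_filter S e)"
    "\<forall>\<^sub>F x in end_filter S e. bracket S f g x = h x"
  shows "end_bracket S e f g = L"
  using tendsto_unique[OF end_filter_not_bot[OF ends] bracket_tendsto[OF assms(1,2)]]
    Lim_transform_eventually[OF assms(3)] assms(4) by (simp add: eq_commute)

lemma end_bracket_linear:
  assumes "f \<in> Dmax S" "g \<in> Dmax S" "h \<in> Dmax S"
  shows "end_bracket S e (\<lambda>x. \<alpha> * f x + \<beta> * g x) h = \<alpha> * end_bracket S e f h + \<beta> * end_bracket S e g h"
proof (rule end_bracket_eqI[OF Dmax_linear[OF assms(1,2)] assms(3)])
  show "((\<lambda>x. \<alpha> * bracket S f h x + \<beta> * bracket S g h x) \<longlongrightarrow> \<alpha> * end_bracket S e f h + \<beta> * end_bracket S e g h) (end_filter S e)"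
    by (intro tendsto_intros bracket_tendsto assms)
  show "\<forall>\<^sub>F x in end_filter S e. bracket S (\<lambda>x. \<alpha> * f x + \<beta> * g x) h x = \<alpha> * bracket S f h x + \<beta> * bracket S g h x"
    using end_filter_eventually_dom_int[OF ends]
    by eventually_elim
      (simp add: bracket_def sl_regular_linear(2)[OF DmaxD(1)[OF assms(1)] DmaxD(1)[OF assms(2)]] algebra_simps)
qed

lemma end_bracket_skew:
  assumes "f \<in> Dmax S" "g \<in> Dmax S"
  shows "end_bracket S e g f = - cnj (end_bracket S e f g)"
proof (rule end_bracket_eqI[OF assms(2,1)])
  show "((\<lambda>x. - cnj (bracket S f g x)) \<longlongrightarrow> - cnj (end_bracket S e f g)) (end_filter S e)"
    by (intro tendsto_intros bracket_tendsto assms)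
qed (simp add: bracket_def)

text \<open>Pluecker relation for 2 by 2 determinants, first pointwise and then in the limit;
  conjugates on the values of \<open>u\<close> and \<open>v\<close> drop because these are real.
  With \<open>[u,v] = 1\<close> it expresses every bracket by boundary values.\<close>

lemma end_bracket_Pluecker:
  assumes f: "f \<in> Dmax S" and g: "g \<in> Dmax S" and u: "cfun u \<in> Dmax S" and v: "cfun v \<in> Dmax S"
  shows "end_bracket S e f g * end_bracket S e (cfun u) (cfun v) =
    end_bracket S e f (cfun u) * cnj (end_bracket S e g (cfun v)) - end_bracket S e f (cfun v) * cnj (end_bracket S e g (cfun u))"
proof (rule tendsto_unique[OF end_filter_not_bot[OF ends]])
  let ?h = "\<lambda>x. bracket S f (cfun u) x * cnj (bracket S g (cfun v) x) - bracket S f (cfun v) x * cnj (bracket S g (cfun u) x)"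
  show "(?h \<longlongrightarrow> end_bracket S e f (cfun u) * cnj (end_bracket S e g (cfun v)) -
      end_bracket S e f (cfun v) * cnj (end_bracket S e g (cfun u))) (end_filter S e)"
    by (intro tendsto_intros bracket_tendsto assms)
  show "(?h \<longlongrightarrow> end_bracket S e f g * end_bracket S e (cfun u) (cfun v)) (end_filter S e)"
  proof (rule Lim_transform_eventually)
    show "((\<lambda>x. bracket S f g x * bracket S (cfun u) (cfun v) x) \<longlongrightarrow> end_bracket S e f g * end_bracket S e (cfun u) (cfun v)) (end_filter S e)"
      by (intro tendsto_intros bracket_tendsto assms)
    show "\<forall>\<^sub>F x in end_filter S e. bracket S f g x * bracket S (cfun u) (cfun v) x = ?h x"
      using end_filter_eventually_dom_int[OF ends]
    proof eventually_elim
      case (elim x)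
      have "cnj (quasi_deriv S (cfun u) x) = quasi_deriv S (cfun u) x" "cnj (quasi_deriv S (cfun v) x) = quasi_deriv S (cfun v) x"
        "cnj (cfun u x) = cfun u x" "cnj (cfun v x) = cfun v x"
        using quasi_deriv_real[OF DmaxD(1)[OF u] elim] quasi_deriv_real[OF DmaxD(1)[OF v] elim] by (simp_all add: cfun_def)
      then show ?case by (simp add: bracket_def algebra_simps)
    qed
  qed
qed

end

section \<open>Patching solutions\<close>

lemma integral_eq_zero_off_finite:
  fixes k :: "real \<Rightarrow> 'b::banach"
  assumes "finite F" "\<And>x. x \<in> A - F \<Longrightarrow> k x = 0"
  shows "integral A k = 0"
proof -
  have "integral A k = integral A (\<lambda>x. 0 :: 'b)"
    by (rule integral_spike[of F]) (use assms in auto)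
  then show ?thesis by simp
qed

text \<open>\<open>C\<close> is a coefficient function of variation of constants for a source
  supported in \<open>{c..d}\<close>: constant on both sides of that interval, the two constants
  differing by the integral of \<open>k\<close>.\<close>

lemma cutoff_primitive:
  fixes k :: "real \<Rightarrow> complex" and \<kappa> :: complex
  assumes cd: "c \<le> d" and k: "k absolutely_integrable_on {c..d}"
  defines "k' \<equiv> \<lambda>t. if t \<in> {c..d} then k t else 0"
  defines "C \<equiv> \<lambda>x. \<kappa> + integral {c..x} k'"
  shows "k' absolutely_integrable_on {x..y}"
    and "x \<le> c \<Longrightarrow> C x = \<kappa>"
    and "d \<le> x \<Longrightarrow> C x = \<kappa> + integral {c..d} k"
    and "x \<le> y \<Longrightarrow> C y - C x = integral {x..y} k'"
proof -
  have "k' absolutely_integrable_on UNIV"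
    using k absolutely_integrable_restrict_UNIV[of "{c..d}" k] by (simp add: k'_def)
  then show ai: "k' absolutely_integrable_on {x..y}" for x y
    by (rule set_integrable_subset) auto
  then have i: "k' integrable_on {x..y}" for x y
    by (rule set_lebesgue_integral_eq_integral(1))
  show left: "C x = \<kappa>" if "x \<le> c" for x
    unfolding C_def using that by (subst integral_eq_zero_off_finite[of "{c}"]) auto
  show "C x = \<kappa> + integral {c..d} k" if "d \<le> x" for x
  proof -
    have "integral {c..x} k' = integral {c..d} k' + integral {d..x} k'"
      using Henstock_Kurzweil_Integration.integral_combine[OF cd that i] by simp
    also have "integral {d..x} k' = 0"
      by (rule integral_eq_zero_off_finite[of "{d}"]) (auto simp: k'_def)
    also have "integral {c..d} k' = integral {c..d} k"
      by (rule integral_cong) (simp add: k'_def)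
    finally show ?thesis by (simp add: C_def)
  qed
  show "C y - C x = integral {x..y} k'" if xy: "x \<le> y" for x y
  proof (cases "c \<le> x")
    case True
    show ?thesis
      unfolding C_def Henstock_Kurzweil_Integration.integral_combine[OF True xy i, symmetric] by simp
  next
    case False
    then have x: "x \<le> c" by simp
    show ?thesis
    proof (cases "c \<le> y")
      case True
      have "integral {x..y} k' = integral {x..c} k' + integral {c..y} k'"
        using Henstock_Kurzweil_Integration.integral_combine[OF x True i] by simp
      also have "integral {x..c} k' = 0"
        by (rule integral_eq_zero_off_finite[of "{c}"]) (auto simp: k'_def)
      finally show ?thesis using left[OF x] by (simp add: C_def)
    next
      case False
      then have "integral {x..y} k' = 0"
        by (intro integral_eq_zero_off_finite[of "{}"]) (auto simp: k'_def)
      then show ?thesis using left[of x] left[of y] x False by simp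
    qed
  qed
qed

context sturm_liouville
begin

lemma L2_space_bounded_mult:
  assumes b: "b \<in> borel_measurable \<mu>" "\<And>x. x \<in> dom_int S \<Longrightarrow> cmod (b x) \<le> M"
    and f: "f \<in> L2_space S"
  shows "(\<lambda>x. b x * f x) \<in> L2_space S"
proof -
  have m: "(\<lambda>x. b x * f x) \<in> borel_measurable \<mu>"
    using b(1) L2_space_measurable[OF f] by (rule borel_measurable_times)
  have "integrable \<mu> (\<lambda>x. (cmod (b x * f x))\<^sup>2 * cw S x)"
  proof (rule Bochner_Integration.integrable_bound[OF _ measurable_weighted_square[OF m]])
    show "integrable \<mu> (\<lambda>x. M\<^sup>2 * ((cmod (f x))\<^sup>2 * cw S x))"
      using f by (simp add: L2_space_def)
    show "AE x in \<mu>. norm ((cmod (b x * f x))\<^sup>2 * cw S x) \<le> norm (M\<^sup>2 * ((cmod (f x))\<^sup>2 * cw S x))"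
      using AE_pos AE_dom_int
    proof eventually_elim
      case (elim x)
      have "(cmod (b x))\<^sup>2 \<le> M\<^sup>2" using b(2)[OF elim(2)] by (intro power_mono) auto
      then have "(cmod (b x))\<^sup>2 * ((cmod (f x))\<^sup>2 * cw S x) \<le> M\<^sup>2 * ((cmod (f x))\<^sup>2 * cw S x)"
        using elim by (intro mult_right_mono) auto
      then show ?case using elim by (simp add: norm_mult power_mult_distrib abs_mult)
    qed
  qed
  then show ?thesis using m by (simp add: L2_space_def)
qed

lemma locally_integrable_mult_cw:
  assumes f: "continuous_on (dom_int S) f" and cd: "{c..d} \<subseteq> dom_int S"
  shows "(\<lambda>x. f x * complex_of_real (cw S x)) absolutely_integrable_on {c..d}"
proof -
  have f': "continuous_on {c..d} f" using f cd by (rule continuous_on_subset)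
  have "(\<lambda>x. complex_of_real (cw S x)) absolutely_integrable_on {c..d}"
    using absolutely_integrable_linear[OF coefficients_integrable(3)[OF cd] bounded_linear_of_real]
    by (simp add: o_def)
  moreover have "f \<in> borel_measurable (lebesgue_on {c..d})"
    using f' by (rule continuous_imp_measurable_on_sets_lebesgue) simp
  moreover have "bounded (f ` {c..d})"
    using compact_continuous_image[OF f'] by (simp add: compact_imp_bounded)
  ultimately show ?thesis
    using absolutely_integrable_bounded_measurable_product[OF bilinear_times, of f "{c..d}"] by simp
qed

text \<open>For a real spectral parameter the integrand in the Lagrange identity vanishes.\<close>

lemma bracket_constant:
  assumes f: "sl_regular S f" "AE x in \<mu>. ell S f x = of_real l * f x"
    and g: "sl_regular S g" "AE x in \<mu>. ell S g x = of_real l * g x"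
    and x: "x \<in> dom_int S" and y: "y \<in> dom_int S"
  shows "bracket S f g x = bracket S f g y"
proof -
  have *: "bracket S f g x = bracket S f g y" if "x \<in> dom_int S" "y \<in> dom_int S" "x \<le> y" for x y
  proof -
    have sub: "{x..y} \<subseteq> dom_int S" using that Icc_subset_einterval by blast
    have "AE x in \<mu>. (ell S f x * cnj (g x) - f x * cnj (ell S g x)) * of_real (cw S x) = 0"
      using f(2) g(2) by eventually_elim (simp add: algebra_simps)
    then obtain N where N: "negligible N"
      "\<forall>x\<in>dom_int S - N. (ell S f x * cnj (g x) - f x * cnj (ell S g x)) * of_real (cw S x) = 0"
      unfolding AE_lebesgue_on_open[OF open_einterval] by blast
    have "((\<lambda>x. 0) has_integral bracket S f g y - bracket S f g x) {x..y}"
      by (rule has_integral_spike[OF N(1) _ bracket_has_integral[OF f(1) g(1) that(3) sub]]) (use N(2) sub in force)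
    from has_integral_unique[OF this has_integral_0] show ?thesis by simp
  qed
  show ?thesis
  proof (cases "x \<le> y")
    case True
    then show ?thesis by (rule *[OF x y])
  next
    case False
    then show ?thesis by (intro *[OF y x, symmetric]) simp
  qed
qed

text \<open>If the Gram matrix were singular, some nontrivial real combination of \<open>u\<close>
  and \<open>v\<close> would have weighted norm zero over \<open>{c..d}\<close>, hence vanish inside
  it; at some point its quasi-derivative would vanish too, against the Wronskian being 1.\<close>

lemma Gram_determinant_nonzero:
  fixes u v :: "real \<Rightarrow> real"
  assumes u: "sl_regular S (cfun u)" and v: "sl_regular S (cfun v)"
    and W: "\<And>x. x \<in> dom_int S \<Longrightarrow> bracket S (cfun u) (cfun v) x = 1"
    and cd: "c < d" "{c..d} \<subseteq> dom_int S"
  defines "A \<equiv> integral {c..d} (\<lambda>x. u x * u x * cw S x)"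
    and "B \<equiv> integral {c..d} (\<lambda>x. u x * v x * cw S x)"
    and "E \<equiv> integral {c..d} (\<lambda>x. v x * v x * cw S x)"
  shows "A * E - B * B \<noteq> 0"
proof
  assume D: "A * E - B * B = 0"
  have cont: "continuous_on {c..d} u" "continuous_on {c..d} v"
    using continuous_on_Re[OF continuous_on_subset[OF AC_loc_continuous_on[OF AC_loc_regular[OF u]] cd(2)]]
      continuous_on_Re[OF continuous_on_subset[OF AC_loc_continuous_on[OF AC_loc_regular[OF v]] cd(2)]]
    by (simp_all add: cfun_def)
  have int: "(\<lambda>x. f x * cw S x) absolutely_integrable_on {c..d}" if f: "continuous_on {c..d} f" for f
  proof (rule absolutely_integrable_bounded_measurable_product_real)
    show "f \<in> borel_measurable (lebesgue_on {c..d})"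
      using f by (rule continuous_imp_measurable_on_sets_lebesgue) simp
    show "bounded (f ` {c..d})"
      using compact_continuous_image[OF f] by (simp add: compact_imp_bounded)
  qed (use coefficients_integrable(3)[OF cd(2)] in auto)
  have hA: "((\<lambda>x. u x * u x * cw S x) has_integral A) {c..d}"
    and hB: "((\<lambda>x. u x * v x * cw S x) has_integral B) {c..d}"
    and hE: "((\<lambda>x. v x * v x * cw S x) has_integral E) {c..d}"
    unfolding A_def B_def E_def
    by (rule integrable_integral, rule set_lebesgue_integral_eq_integral(1), rule int, intro continuous_intros cont)+
  \<comment> \<open>A zero of the quadratic form: \<open>(1, 0)\<close> if \<open>A = 0\<close>,
    otherwise \<open>(- B, A)\<close>, where the form equals \<open>A\<close> times the
    determinant.\<close>
  obtain \<alpha> \<beta> :: real where ab: "\<alpha> \<noteq> 0 \<or> \<beta> \<noteq> 0" "\<alpha> * \<alpha> * A + 2 * \<alpha> * \<beta> * B + \<beta> * \<beta> * E = 0"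
  proof (cases "A = 0")
    case True
    then show ?thesis by (intro that[of 1 0]) auto
  next
    case False
    have "(- B) * (- B) * A + 2 * (- B) * A * B + A * A * E = A * (A * E - B * B)"
      by (simp add: algebra_simps)
    then show ?thesis using False D by (intro that[of "- B" A]) auto
  qed
  define \<phi> where "\<phi> = (\<lambda>x. \<alpha> * u x + \<beta> * v x)"
  have "((\<lambda>x. \<alpha> * \<alpha> * (u x * u x * cw S x) + 2 * \<alpha> * \<beta> * (u x * v x * cw S x) + \<beta> * \<beta> * (v x * v x * cw S x))
      has_integral \<alpha> * \<alpha> * A + 2 * \<alpha> * \<beta> * B + \<beta> * \<beta> * E) {c..d}"
    by (intro has_integral_add has_integral_mult_right hA hB hE)
  then have "((\<lambda>x. \<phi> x * \<phi> x * cw S x) has_integral 0) {c..d}"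
    using ab(2) by (simp add: \<phi>_def algebra_simps)
  moreover have \<phi>i: "(\<lambda>x. \<phi> x * \<phi> x * cw S x) absolutely_integrable_on {c..d}"
    unfolding \<phi>_def by (intro int continuous_intros cont)
  moreover obtain N0 where N0: "negligible N0" "\<forall>x\<in>dom_int S - N0. cp S x > 0 \<and> cw S x > 0"
    using AE_pos unfolding AE_lebesgue_on_open[OF open_einterval] by blast
  obtain N where N: "negligible N" "\<And>x. x \<in> {c..d} - N \<Longrightarrow> \<phi> x = 0"
  proof -
    have ae: "AE x in lebesgue_on {c..d}. cp S x > 0 \<and> cw S x > 0"
    proof -
      have "AE x in lebesgue. x \<in> {c..d} \<longrightarrow> cp S x > 0 \<and> cw S x > 0"
        unfolding eventually_ae_filter_negligible using N0 cd by (intro exI[of _ N0]) auto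
      then show ?thesis by (subst AE_restrict_space_iff) auto
    qed
    have "(LINT x|lebesgue_on {c..d}. \<phi> x * \<phi> x * cw S x) = 0"
      using \<open>((\<lambda>x. \<phi> x * \<phi> x * cw S x) has_integral 0) {c..d}\<close> \<phi>i
      by (subst lebesgue_integral_eq_integral) (auto simp: integrable_lebesgue_on_iff)
    then have "AE x in lebesgue_on {c..d}. \<phi> x * \<phi> x * cw S x = 0"
      by (subst (asm) integral_nonneg_eq_0_iff_AE)
         (use \<phi>i ae in \<open>auto simp: integrable_lebesgue_on_iff elim: eventually_mono\<close>)
    with ae have "AE x in lebesgue_on {c..d}. \<phi> x = 0"
      by eventually_elim auto
    then have "AE x in lebesgue. x \<in> {c..d} \<longrightarrow> \<phi> x = 0"
      by (subst (asm) AE_restrict_space_iff) auto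
    then show ?thesis
      unfolding eventually_ae_filter_negligible using that by blast
  qed
  let ?\<Phi> = "\<lambda>x. complex_of_real \<alpha> * cfun u x + complex_of_real \<beta> * cfun v x"
  note l = sl_regular_linear[OF u v, where \<alpha> = "complex_of_real \<alpha>" and \<beta> = "complex_of_real \<beta>"]
  have zero: "?\<Phi> x = 0" if "x \<in> {c<..<d}" for x
  proof (rule continuous_AE_eq[of "{c<..<d}" ?\<Phi> "\<lambda>x. 0" x])
    show "continuous_on {c<..<d} ?\<Phi>"
      by (rule continuous_on_subset[OF AC_loc_continuous_on[OF AC_loc_regular[OF l(1)]]]) (use cd in auto)
    show "AE x in lebesgue_on {c<..<d}. ?\<Phi> x = 0"
      unfolding AE_lebesgue_on_open[OF open_greaterThanLessThan]
    proof (intro exI[of _ N] conjI ballI N(1))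
      fix x assume "x \<in> {c<..<d} - N"
      then have "\<phi> x = 0" using N(2)[of x] by auto
      moreover have "?\<Phi> x = complex_of_real (\<phi> x)" by (simp add: \<phi>_def cfun_def)
      ultimately show "?\<Phi> x = 0" by simp
    qed
  qed (use that in auto)
  obtain N1 where N1: "negligible N1"
    "\<forall>x\<in>dom_int S - N1. (?\<Phi> has_vector_derivative quasi_deriv S ?\<Phi> x / of_real (cp S x)) (at x)"
    using has_derivative_regular[OF l(1)] unfolding AE_lebesgue_on_open[OF open_einterval] by blast
  have "negligible (N0 \<union> N1)" using N0(1) N1(1) by simp
  moreover have "\<not> negligible {c<..<d}"
    using open_not_negligible[of "{c<..<d}"] cd(1) by auto
  \<comment> \<open>Off both null sets \<open>p\<close> is positive and the derivative of
    \<open>?\<Phi>\<close> is its quasi-derivative divided by \<open>p\<close>.\<close>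
  ultimately obtain x where x: "x \<in> {c<..<d}" "x \<notin> N0" "x \<notin> N1"
    using negligible_subset by blast
  then have xI: "x \<in> dom_int S" using cd by auto
  have "(?\<Phi> has_vector_derivative 0) (at x)"
    by (rule has_vector_derivative_transform_within_open[OF has_vector_derivative_const[of 0] _ x(1)])
       (use zero in auto)
  moreover have "(?\<Phi> has_vector_derivative quasi_deriv S ?\<Phi> x / of_real (cp S x)) (at x)"
    using N1(2) x xI by blast
  ultimately have "quasi_deriv S ?\<Phi> x / of_real (cp S x) = 0"
    using vector_derivative_unique_at by blast
  moreover have "cp S x \<noteq> 0" using N0(2) x xI by force
  ultimately have e2: "complex_of_real \<alpha> * quasi_deriv S (cfun u) x + complex_of_real \<beta> * quasi_deriv S (cfun v) x = 0"
    using l(2)[OF xI] by simp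
  have e1: "complex_of_real \<alpha> * cfun u x + complex_of_real \<beta> * cfun v x = 0"
    by (rule zero[OF x(1)])
  have e3: "cfun u x * quasi_deriv S (cfun v) x - quasi_deriv S (cfun u) x * cfun v x = 1"
    using W[OF xI] quasi_deriv_real[OF v xI] by (simp add: bracket_def cfun_def)
  \<comment> \<open>Cramer's rule: multiplying by the Wronskian 1 isolates each coefficient.\<close>
  have "complex_of_real \<alpha> = complex_of_real \<alpha> * (cfun u x * quasi_deriv S (cfun v) x - quasi_deriv S (cfun u) x * cfun v x)"
    using e3 by simp
  also have "\<dots> = (complex_of_real \<alpha> * cfun u x + complex_of_real \<beta> * cfun v x) * quasi_deriv S (cfun v) x
     - (complex_of_real \<alpha> * quasi_deriv S (cfun u) x + complex_of_real \<beta> * quasi_deriv S (cfun v) x) * cfun v x"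
    by (simp add: algebra_simps)
  finally have "\<alpha> = 0" using e1 e2 by simp
  have "complex_of_real \<beta> = complex_of_real \<beta> * (cfun u x * quasi_deriv S (cfun v) x - quasi_deriv S (cfun u) x * cfun v x)"
    using e3 by simp
  also have "\<dots> = (complex_of_real \<alpha> * quasi_deriv S (cfun u) x + complex_of_real \<beta> * quasi_deriv S (cfun v) x) * cfun u x
     - (complex_of_real \<alpha> * cfun u x + complex_of_real \<beta> * cfun v x) * quasi_deriv S (cfun u) x"
    by (simp add: algebra_simps)
  finally have "\<beta> = 0" using e1 e2 by simp
  with \<open>\<alpha> = 0\<close> ab(1) show False by simp
qed

text \<open>Variation of constants. For \<open>f = C1 * u + C2 * v\<close> with
  \<open>C1' = - v h w\<close> and \<open>C2' = u h w\<close> one gets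
  \<open>ell f = l * f - h\<close>. The source \<open>h\<close> lives on \<open>{c..d}\<close> and
  is sought there in the span of \<open>u\<close> and \<open>v\<close>; prescribing the total
  increments of \<open>C1\<close> and \<open>C2\<close> is then a linear system with the Gram
  matrix. The scalars \<open>\<mu>1\<close>, \<open>\<mu>2\<close> are unrelated to the measure
  \<open>\<mu>\<close>.\<close>

lemma Dmax_patch:
  fixes u v :: "real \<Rightarrow> real" and \<kappa>1 \<kappa>2 \<mu>1 \<mu>2 :: complex
  assumes u: "cfun u \<in> Dmax S" "AE x in \<mu>. ell S (cfun u) x = of_real l * cfun u x"
    and v: "cfun v \<in> Dmax S" "AE x in \<mu>. ell S (cfun v) x = of_real l * cfun v x"
    and W: "\<And>x. x \<in> dom_int S \<Longrightarrow> bracket S (cfun u) (cfun v) x = 1"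
  obtains f c d where "f \<in> Dmax S" "c \<in> dom_int S" "d \<in> dom_int S"
    "\<And>x. x \<in> dom_int S \<Longrightarrow> x \<le> c \<Longrightarrow> f x = \<kappa>1 * cfun u x + \<kappa>2 * cfun v x"
    "\<And>x. x \<in> dom_int S \<Longrightarrow> x \<le> c \<Longrightarrow> quasi_deriv S f x = \<kappa>1 * quasi_deriv S (cfun u) x + \<kappa>2 * quasi_deriv S (cfun v) x"
    "\<And>x. x \<in> dom_int S \<Longrightarrow> d \<le> x \<Longrightarrow> f x = \<mu>1 * cfun u x + \<mu>2 * cfun v x"
    "\<And>x. x \<in> dom_int S \<Longrightarrow> d \<le> x \<Longrightarrow> quasi_deriv S f x = \<mu>1 * quasi_deriv S (cfun u) x + \<mu>2 * quasi_deriv S (cfun v) x"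
proof -
  note ur = DmaxD[OF u(1)] and vr = DmaxD[OF v(1)]
  let ?u = "cfun u" and ?v = "cfun v" and ?Du = "quasi_deriv S (cfun u)" and ?Dv = "quasi_deriv S (cfun v)"
  obtain uu ll :: "nat \<Rightarrow> real" where ul: "dom_int S = (\<Union>i. {ll i .. uu i})" "\<And>i. ll i < uu i"
    by (rule einterval_Icc_approximation[OF ends]) blast
  define c d where "c = ll 0" and "d = uu 0"
  have cd: "c < d" "{c..d} \<subseteq> dom_int S" using ul by (auto simp: c_def d_def)
  have cdI: "c \<in> dom_int S" "d \<in> dom_int S" using cd by auto
  define A B E where "A = integral {c..d} (\<lambda>x. u x * u x * cw S x)"
    and "B = integral {c..d} (\<lambda>x. u x * v x * cw S x)"
    and "E = integral {c..d} (\<lambda>x. v x * v x * cw S x)"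
  have D: "A * E - B * B \<noteq> 0"
    unfolding A_def B_def E_def by (rule Gram_determinant_nonzero[OF ur(1) vr(1) W cd])
  then have D': "complex_of_real A * complex_of_real E - complex_of_real B * complex_of_real B \<noteq> 0"
    by (metis of_real_diff of_real_eq_0_iff of_real_mult)
  define m1 m2 where "m1 = \<mu>1 - \<kappa>1" and "m2 = \<mu>2 - \<kappa>2"
  \<comment> \<open>Cramer's rule for \<open>s * A + t * B = m2\<close> and
    \<open>s * B + t * E = - m1\<close>; the last sign stems from the one in
    \<open>C1'\<close>.\<close>
  define s t where "s = (m2 * E + m1 * B) / (complex_of_real A * complex_of_real E - complex_of_real B * complex_of_real B)"
    and "t = (- m1 * A - m2 * B) / (complex_of_real A * complex_of_real E - complex_of_real B * complex_of_real B)"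
  have st: "s * A + t * B = m2" "s * B + t * E = - m1"
    using D' by (simp_all add: s_def t_def divide_simps) (simp_all add: algebra_simps)
  have cont: "continuous_on (dom_int S) ?u" "continuous_on (dom_int S) ?v"
    using AC_loc_continuous_on AC_loc_regular ur vr by blast+
  define h0 where "h0 = (\<lambda>x. s * ?u x + t * ?v x)"
  define k1 k2 where "k1 = (\<lambda>x. (- ?v x * h0 x) * of_real (cw S x))" and "k2 = (\<lambda>x. (?u x * h0 x) * of_real (cw S x))"
  have k: "k1 absolutely_integrable_on {c..d}" "k2 absolutely_integrable_on {c..d}"
    unfolding k1_def k2_def h0_def by (rule locally_integrable_mult_cw[OF _ cd(2)]; intro continuous_intros cont)+
  have hI: "((\<lambda>x. complex_of_real (f x * g x * cw S x)) has_integral complex_of_real (integral {c..d} (\<lambda>x. f x * g x * cw S x))) {c..d}"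
    if "continuous_on (dom_int S) (cfun f)" "continuous_on (dom_int S) (cfun g)" for f g
  proof -
    have "(\<lambda>x. (cfun f x * cfun g x) * of_real (cw S x)) absolutely_integrable_on {c..d}"
      by (rule locally_integrable_mult_cw[OF _ cd(2)]) (intro continuous_intros that)
    from absolutely_integrable_linear[OF this bounded_linear_Re]
    have "(\<lambda>x. f x * g x * cw S x) absolutely_integrable_on {c..d}"
      by (simp add: o_def cfun_def flip: of_real_mult)
    then have "(\<lambda>x. f x * g x * cw S x) integrable_on {c..d}"
      by (rule set_lebesgue_integral_eq_integral(1))
    then show ?thesis
      using has_integral_linear[OF integrable_integral bounded_linear_of_real[where 'a = complex]]
      by (simp add: o_def del: of_real_mult)
  qed
  note hA = hI[OF cont(1) cont(1), folded A_def] and hB = hI[OF cont, folded B_def] and hE = hI[OF cont(2) cont(2), folded E_def]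
  have "(k2 has_integral s * A + t * B) {c..d}"
    using has_integral_add[OF has_integral_mult_right[OF hA, of s] has_integral_mult_right[OF hB, of t]]
    by (simp add: k2_def h0_def cfun_def algebra_simps)
  then have K2: "integral {c..d} k2 = m2" using st by (simp add: integral_unique)
  have "(k1 has_integral - (s * B + t * E)) {c..d}"
    using has_integral_neg[OF has_integral_add[OF has_integral_mult_right[OF hB, of s] has_integral_mult_right[OF hE, of t]]]
    by (simp add: k1_def h0_def cfun_def algebra_simps)
  then have K1: "integral {c..d} k1 = m1" using st by (simp add: integral_unique)
  define k1' k2' where "k1' = (\<lambda>t. if t \<in> {c..d} then k1 t else 0)" and "k2' = (\<lambda>t. if t \<in> {c..d} then k2 t else 0)"
  define C1 C2 where "C1 = (\<lambda>x. \<kappa>1 + integral {c..x} k1')" and "C2 = (\<lambda>x. \<kappa>2 + integral {c..x} k2')"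
  have C1: "\<kappa>1 + integral {c..x} k1' = C1 x" and C2: "\<kappa>2 + integral {c..x} k2' = C2 x" for x
    by (simp_all add: C1_def C2_def)
  note p1 = cutoff_primitive(1)[OF less_imp_le[OF cd(1)] k(1), folded k1'_def]
    cutoff_primitive(2-4)[OF less_imp_le[OF cd(1)] k(1), where \<kappa> = \<kappa>1, folded k1'_def, unfolded C1]
  note p2 = cutoff_primitive(1)[OF less_imp_le[OF cd(1)] k(2), folded k2'_def]
    cutoff_primitive(2-4)[OF less_imp_le[OF cd(1)] k(2), where \<kappa> = \<kappa>2, folded k2'_def, unfolded C2]
  have AC: "AC_loc (dom_int S) C1" "AC_loc (dom_int S) C2"
    by (rule AC_loc_integral_function(1)[OF ends], rule p1(1) p2(1), rule p1(4) p2(4), assumption)+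
  have dC: "AE x in \<mu>. (C1 has_vector_derivative k1' x) (at x)"
      "AE x in \<mu>. (C2 has_vector_derivative k2' x) (at x)"
    unfolding AE_lebesgue_on_open[OF open_einterval]
    by (rule AC_loc_integral_function(2)[OF ends], rule p1(1) p2(1), rule p1(4) p2(4), assumption)+
  define f where "f = (\<lambda>x. C1 x * ?u x + C2 x * ?v x)"
  define f1 where "f1 = (\<lambda>x. C1 x * ?Du x + C2 x * ?Dv x)"
  define h where "h = (\<lambda>x. if x \<in> {c..d} then h0 x else 0)"
  have ACf: "AC_loc (dom_int S) f" "AC_loc (dom_int S) f1"
    unfolding f_def f1_def
    by (intro AC_loc_add AC_loc_mult AC AC_loc_regular[OF ur(1)] AC_loc_regular[OF vr(1)]
        AC_loc_quasi_deriv[OF ur(1)] AC_loc_quasi_deriv[OF vr(1)])+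
  have k': "k1' x = - ?v x * h x * of_real (cw S x)" "k2' x = ?u x * h x * of_real (cw S x)" for x
    by (auto simp: k1'_def k2'_def k1_def k2_def h_def)
  have df: "AE x in \<mu>. (f has_vector_derivative f1 x / of_real (cp S x)) (at x)"
    using dC has_derivative_regular[OF ur(1)] has_derivative_regular[OF vr(1)]
  proof eventually_elim
    case (elim x)
    have "(f has_vector_derivative C1 x * (?Du x / of_real (cp S x)) + k1' x * ?u x + (C2 x * (?Dv x / of_real (cp S x)) + k2' x * ?v x)) (at x)"
      unfolding f_def by (intro has_vector_derivative_add has_vector_derivative_mult elim)
    then show ?case by (simp add: k' f1_def add_divide_distrib algebra_simps)
  qed
  have df1: "AE x in \<mu>.
      (f1 has_vector_derivative - of_real (cw S x) * (of_real l * f x - h x) - of_real (cq S x) * f x) (at x)"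
    using dC has_derivative_quasi_deriv[OF ur(1)] has_derivative_quasi_deriv[OF vr(1)] u(2) v(2) AE_dom_int
  proof eventually_elim
    case (elim x)
    have "(f1 has_vector_derivative
        C1 x * (- of_real (cw S x) * ell S ?u x - of_real (cq S x) * ?u x) + k1' x * ?Du x +
       (C2 x * (- of_real (cw S x) * ell S ?v x - of_real (cq S x) * ?v x) + k2' x * ?Dv x)) (at x)"
      unfolding f1_def by (intro has_vector_derivative_add has_vector_derivative_mult elim)
    also have "C1 x * (- of_real (cw S x) * ell S ?u x - of_real (cq S x) * ?u x) + k1' x * ?Du x +
       (C2 x * (- of_real (cw S x) * ell S ?v x - of_real (cq S x) * ?v x) + k2' x * ?Dv x) =
       h x * of_real (cw S x) * (?u x * ?Dv x - ?Du x * ?v x) - of_real (cw S x) * of_real l * f x - of_real (cq S x) * f x"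
      by (simp add: k' elim(5,6) f_def algebra_simps)
    also have "?u x * ?Dv x - ?Du x * ?v x = 1"
      using W[OF elim(7)] quasi_deriv_real[OF vr(1) elim(7)] by (simp add: bracket_def cfun_def)
    finally show ?case by (simp add: algebra_simps)
  qed
  note r = sl_regularI[OF ACf df df1]
  \<comment> \<open>Bounded coefficients keep \<open>f\<close> in the weighted space. Compactness
    bounds them on \<open>{c..d}\<close>, and beyond it they are constant.\<close>
  have bounded: "\<exists>M. \<forall>x\<in>dom_int S. cmod (C x) \<le> M"
    if "AC_loc (dom_int S) C" "\<And>x. x \<le> c \<Longrightarrow> C x = C c" "\<And>x. d \<le> x \<Longrightarrow> C x = C d" for C :: "real \<Rightarrow> complex"
  proof -
    have "compact (C ` {c..d})"
      by (rule compact_continuous_image[OF continuous_on_subset[OF AC_loc_continuous_on[OF that(1)] cd(2)]]) simp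
    then have "bounded (C ` {c..d})"
      by (rule compact_imp_bounded)
    then obtain M where M: "\<And>x. x \<in> {c..d} \<Longrightarrow> cmod (C x) \<le> M"
      unfolding bounded_iff by blast
    have "cmod (C x) \<le> M" for x
    proof -
      consider "x \<le> c" | "d \<le> x" | "x \<in> {c..d}" by fastforce
      then show ?thesis
      proof cases
        case 1
        show ?thesis unfolding that(2)[OF 1] by (rule M) (use cd in auto)
      next
        case 2
        show ?thesis unfolding that(3)[OF 2] by (rule M) (use cd in auto)
      qed (rule M)
    qed
    then show ?thesis by blast
  qed
  obtain M1 where M1: "\<And>x. x \<in> dom_int S \<Longrightarrow> cmod (C1 x) \<le> M1"
    using bounded[OF AC(1)] p1(2,3) by force
  obtain M2 where M2: "\<And>x. x \<in> dom_int S \<Longrightarrow> cmod (C2 x) \<le> M2"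
    using bounded[OF AC(2)] p2(2,3) by force
  have fL: "f \<in> L2_space S"
    unfolding f_def
    by (intro L2_space_add(1) L2_space_bounded_mult[OF measurable_regular[OF AC(1)] M1]
        L2_space_bounded_mult[OF measurable_regular[OF AC(2)] M2] ur vr)
  have hL: "h \<in> L2_space S"
  proof -
    have "(\<lambda>x. complex_of_real (indicator {c..d} x) * h0 x) \<in> L2_space S"
      unfolding h0_def
      by (intro L2_space_bounded_mult[of _ 1] L2_space_add(1) L2_space_mult(1) ur vr measurable_of_real_comp
          borel_measurable_indicator_lebesgue_on) (auto simp: indicator_def)
    moreover have "(\<lambda>x. complex_of_real (indicator {c..d} x) * h0 x) = h"
      by (auto simp: h_def indicator_def)
    ultimately show ?thesis by simp
  qed
  have "(\<lambda>x. of_real l * f x + (- 1) * h x) \<in> L2_space S"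
    by (intro L2_space_add(1) L2_space_mult(1) fL hL)
  then have "ell S f \<in> L2_space S"
    by (rule L2_space_cong[OF _ measurable_ell[OF r(1)]]) (use r(3) in simp)
  then have "f \<in> Dmax S" using r(1) fL by (simp add: Dmax_def)
  then show ?thesis
  proof (rule that[OF _ cdI])
    show "f x = \<kappa>1 * ?u x + \<kappa>2 * ?v x" if "x \<le> c" for x
      using p1(2)[OF that] p2(2)[OF that] by (simp add: f_def)
    show "quasi_deriv S f x = \<kappa>1 * ?Du x + \<kappa>2 * ?Dv x" if "x \<in> dom_int S" "x \<le> c" for x
      using p1(2)[OF that(2)] p2(2)[OF that(2)] r(2)[OF that(1)] by (simp add: f1_def)
    show "f x = \<mu>1 * ?u x + \<mu>2 * ?v x" if "d \<le> x" for x
      using p1(3)[OF that] p2(3)[OF that] by (simp add: f_def K1 K2 m1_def m2_def)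
    show "quasi_deriv S f x = \<mu>1 * ?Du x + \<mu>2 * ?Dv x" if "x \<in> dom_int S" "d \<le> x" for x
      using p1(3)[OF that(2)] p2(3)[OF that(2)] r(2)[OF that(1)] by (simp add: f1_def K1 K2 m1_def m2_def)
  qed
qed

end

section \<open>Uniqueness and boundary values\<close>

context sturm_liouville
begin

lemma AC_increment_bound:
  assumes f: "AC_loc (dom_int S) f"
    and d: "AE x in \<mu>. (f has_vector_derivative g x) (at x)"
    and xy: "x \<le> y" "{x..y} \<subseteq> dom_int S"
    and m: "m absolutely_integrable_on {x..y}"
    and le: "\<And>t. t \<in> {x..y} \<Longrightarrow> cmod (g t) \<le> M * m t"
  shows "cmod (f y - f x) \<le> M * integral {x..y} m"
proof -
  obtain N where N: "negligible N" "\<forall>x\<in>dom_int S - N. (f has_vector_derivative g x) (at x)"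
    using d unfolding AE_lebesgue_on_open[OF open_einterval] by blast
  have "((\<lambda>x. vector_derivative f (at x)) has_integral f y - f x) {x..y}"
    using AC_loc_has_integral[OF f ends xy] by blast
  then have g: "(g has_integral f y - f x) {x..y}"
  proof (rule has_integral_spike[OF N(1), rotated])
    fix t assume "t \<in> {x..y} - N"
    then have "(f has_vector_derivative g t) (at t)" using N(2) xy by blast
    then show "g t = vector_derivative f (at t)" by (rule vector_derivative_at[symmetric])
  qed
  have "norm (integral {x..y} g) \<le> integral {x..y} (\<lambda>t. M * m t)"
    using g m le set_lebesgue_integral_eq_integral(1)[OF m]
    by (intro integral_norm_bound_integral integrable_on_mult_right) (auto simp: has_integral_integrable)
  then show ?thesis using g by (simp add: integral_unique)
qed

text \<open>The set \<open>Z\<close> of points with zero initial data is closed by continuity. It is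
  open by a contraction estimate: on a short interval around a point of \<open>Z\<close>, the
  maximum \<open>M\<close> of the moduli of \<open>y\<close> and its quasi-derivative, added,
  satisfies \<open>M <= M / 2\<close>. Connectedness finishes.\<close>

lemma solution_unique:
  assumes r: "sl_regular S y" and e: "AE x in \<mu>. ell S y x = z * y x"
    and x0: "x0 \<in> dom_int S" "y x0 = 0" "quasi_deriv S y x0 = 0" and x: "x \<in> dom_int S"
  shows "y x = 0"
proof -
  let ?D = "quasi_deriv S y"
  \<comment> \<open>Majorants for the coefficients of the first-order system satisfied by
    \<open>y\<close> and its quasi-derivative.\<close>
  define m1 where "m1 = (\<lambda>x. \<bar>1 / cp S x\<bar>)"
  define m2 where "m2 = (\<lambda>x. cmod z * \<bar>cw S x\<bar> + \<bar>cq S x\<bar>)"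
  have m: "m1 absolutely_integrable_on {c..d}" "m2 absolutely_integrable_on {c..d}" if "{c..d} \<subseteq> dom_int S" for c d
  proof -
    show "m1 absolutely_integrable_on {c..d}"
      unfolding m1_def using absolutely_integrable_abs[OF coefficients_integrable(1)[OF that]] by simp
    have "(\<lambda>x. cmod z *\<^sub>R \<bar>cw S x\<bar>) absolutely_integrable_on {c..d}"
      using absolutely_integrable_abs[OF coefficients_integrable(3)[OF that]]
      by (intro absolutely_integrable_scaleR_left) simp
    then show "m2 absolutely_integrable_on {c..d}"
      unfolding m2_def using absolutely_integrable_abs[OF coefficients_integrable(2)[OF that]]
      by (intro set_integral_add) simp_all
  qed
  have d1: "AE x in \<mu>. (y has_vector_derivative ?D x / of_real (cp S x)) (at x)"
    by (rule has_derivative_regular[OF r])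
  have d2: "AE x in \<mu>. (?D has_vector_derivative - (of_real (cw S x) * z + of_real (cq S x)) * y x) (at x)"
    using has_derivative_quasi_deriv[OF r] e
  proof eventually_elim
    case (elim x)
    have "- of_real (cw S x) * ell S y x - of_real (cq S x) * y x = - (of_real (cw S x) * z + of_real (cq S x)) * y x"
      unfolding elim(2) by (simp add: algebra_simps)
    then show ?case using elim(1) by simp
  qed
  have cy: "continuous_on (dom_int S) y" and cD: "continuous_on (dom_int S) ?D"
    by (rule AC_loc_continuous_on[OF AC_loc_regular[OF r]] AC_loc_continuous_on[OF AC_loc_quasi_deriv[OF r]])+
  define Z where "Z = {x \<in> dom_int S. y x = 0 \<and> ?D x = 0}"
  have "\<exists>r>0. ball s r \<subseteq> Z" if s: "s \<in> Z" for s
  proof -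
    have sI: "s \<in> dom_int S" and s0: "y s = 0" "?D s = 0" using s by (auto simp: Z_def)
    obtain R where R: "R > 0" "cball s R \<subseteq> dom_int S"
      using sI open_einterval open_contains_cball by blast
    have RI: "{s - R..s + R} \<subseteq> dom_int S" using R(2) by (simp add: cball_eq_atLeastAtMost)
    define mm where "mm = (\<lambda>x. m1 x + m2 x)"
    have mm: "mm absolutely_integrable_on {s - R..s + R}"
      unfolding mm_def by (intro set_integral_add m RI)
    define G where "G = (\<lambda>x. integral {s - R..x} mm)"
    have "continuous_on {s - R..s + R} G"
      unfolding G_def using mm by (intro indefinite_integral_continuous_1) (rule set_lebesgue_integral_eq_integral(1))
    then have "isCont G s"
      using R(1) by (intro continuous_on_interior[of "{s - R..s + R}"]) auto
    \<comment> \<open>Two deviations below 1/4 from \<open>G s\<close> bound the integral over any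
      subinterval by 1/2.\<close>
    then obtain \<delta> where \<delta>: "\<delta> > 0" "\<And>t. dist t s < \<delta> \<Longrightarrow> dist (G t) (G s) < 1 / 4"
      unfolding continuous_at_eps_delta by (metis zero_less_divide_1_iff zero_less_numeral)
    define \<rho> where "\<rho> = min (R / 2) (\<delta> / 2)"
    have \<rho>: "\<rho> > 0" "\<rho> < R" "\<rho> < \<delta>" using R(1) \<delta>(1) by (auto simp: \<rho>_def min_def)
    let ?J = "{s - \<rho>..s + \<rho>}"
    have JR: "?J \<subseteq> {s - R..s + R}" using \<rho> by auto
    then have J: "?J \<subseteq> dom_int S" using RI by blast
    have mmi: "mm integrable_on {s - R..t}" if "t \<le> s + R" for t
      using integrable_on_subinterval[OF set_lebesgue_integral_eq_integral(1)[OF mm], of "s - R" t] that by auto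
    have GJ: "integral {a..b} mm < 1 / 2" if "a \<in> ?J" "b \<in> ?J" "a \<le> b" for a b
    proof -
      have "integral {s - R..a} mm + integral {a..b} mm = integral {s - R..b} mm"
        using that \<rho> by (intro Henstock_Kurzweil_Integration.integral_combine mmi) auto
      moreover have "dist (G a) (G s) < 1 / 4" "dist (G b) (G s) < 1 / 4"
        using that \<rho> by (intro \<delta>(2); auto simp: dist_real_def abs_if)+
      ultimately show ?thesis by (simp add: G_def dist_real_def abs_if split: if_splits)
    qed
    have "continuous_on ?J (\<lambda>x. cmod (y x) + cmod (?D x))"
      by (intro continuous_intros continuous_on_subset[OF cy J] continuous_on_subset[OF cD J])
    then obtain t where t: "t \<in> ?J" "\<And>x. x \<in> ?J \<Longrightarrow> cmod (y x) + cmod (?D x) \<le> cmod (y t) + cmod (?D t)"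
      using continuous_attains_sup[of ?J "\<lambda>x. cmod (y x) + cmod (?D x)"] \<rho> by auto
    define M where "M = cmod (y t) + cmod (?D t)"
    have inc: "cmod (y b - y a) + cmod (?D b - ?D a) \<le> M * integral {a..b} mm" if ab: "a \<in> ?J" "b \<in> ?J" "a \<le> b" for a b
    proof -
      have sub: "{a..b} \<subseteq> ?J" "{a..b} \<subseteq> dom_int S" using ab J by auto
      have b: "cmod (y x) \<le> M" "cmod (?D x) \<le> M" if "x \<in> {a..b}" for x
        using t(2)[of x] sub that norm_ge_zero[of "y x"] norm_ge_zero[of "?D x"] unfolding M_def by (smt (verit) subsetD)+
      have "cmod (y b - y a) \<le> M * integral {a..b} m1"
      proof (rule AC_increment_bound[OF AC_loc_regular[OF r] d1 ab(3) sub(2) m(1)[OF sub(2)]])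
        fix x assume "x \<in> {a..b}"
        then have "cmod (?D x) * \<bar>1 / cp S x\<bar> \<le> M * \<bar>1 / cp S x\<bar>" using b by (intro mult_right_mono) auto
        then show "cmod (?D x / of_real (cp S x)) \<le> M * m1 x"
          by (simp add: m1_def norm_divide abs_divide)
      qed
      moreover have "cmod (?D b - ?D a) \<le> M * integral {a..b} m2"
      proof (rule AC_increment_bound[OF AC_loc_quasi_deriv[OF r] d2 ab(3) sub(2) m(2)[OF sub(2)]])
        fix x assume x: "x \<in> {a..b}"
        have "cmod (- (of_real (cw S x) * z + of_real (cq S x)) * y x) = cmod (of_real (cw S x) * z + of_real (cq S x)) * cmod (y x)"
          by (simp only: norm_mult norm_minus_cancel)
        also have "\<dots> \<le> m2 x * M"
          using b(1)[OF x] norm_triangle_ineq[of "of_real (cw S x) * z" "of_real (cq S x)"]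
          by (intro mult_mono) (auto simp: m2_def norm_mult mult.commute)
        finally show "cmod (- (of_real (cw S x) * z + of_real (cq S x)) * y x) \<le> M * m2 x"
          by (simp add: mult.commute)
      qed
      moreover have "integral {a..b} mm = integral {a..b} m1 + integral {a..b} m2"
        unfolding mm_def
        by (intro Henstock_Kurzweil_Integration.integral_add set_lebesgue_integral_eq_integral(1) m sub)
      ultimately show ?thesis by (simp add: algebra_simps)
    qed
    have M0: "M \<ge> 0" by (simp add: M_def)
    have sJ: "s \<in> ?J" using \<rho> by auto
    have "M \<le> M * (1 / 2)"
    proof (cases "s \<le> t")
      case True
      have "M \<le> M * integral {s..t} mm"
        using inc[OF sJ t(1) True] s0 by (simp add: M_def)
      also have "\<dots> \<le> M * (1 / 2)"
        using GJ[OF sJ t(1) True] M0 by (intro mult_left_mono) auto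
      finally show ?thesis .
    next
      case False
      then have ts: "t \<le> s" by simp
      have "M \<le> M * integral {t..s} mm"
        using inc[OF t(1) sJ ts] s0 by (simp add: M_def)
      also have "\<dots> \<le> M * (1 / 2)"
        using GJ[OF t(1) sJ ts] M0 by (intro mult_left_mono) auto
      finally show ?thesis .
    qed
    then have M: "M = 0" using M0 by simp
    have "x \<in> Z" if "x \<in> ?J" for x
    proof -
      have "cmod (y x) + cmod (?D x) \<le> 0" using t(2)[OF that] M by (simp add: M_def)
      then have "y x = 0" "?D x = 0"
        using norm_ge_zero[of "y x"] norm_ge_zero[of "?D x"] by (smt (verit) norm_le_zero_iff)+
      then show ?thesis using that J by (auto simp: Z_def)
    qed
    then have "ball s \<rho> \<subseteq> Z" by (auto simp: ball_eq_greaterThanLessThan)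
    then show ?thesis using \<rho>(1) by blast
  qed
  then have "open Z" by (simp add: open_contains_ball)
  then have 1: "openin (top_of_set (dom_int S)) Z"
    by (intro open_subset) (auto simp: Z_def)
  have "closedin (top_of_set (dom_int S)) {x \<in> dom_int S. (y x, ?D x) = (0, 0)}"
    by (rule continuous_closedin_preimage_constant[OF continuous_on_Pair[OF cy cD]])
  then have 2: "closedin (top_of_set (dom_int S)) Z"
    by (simp add: Z_def)
  have "connected (dom_int S)"
    unfolding is_interval_connected_1[symmetric] is_interval_1
    using Icc_subset_einterval by (meson atLeastAtMost_iff subsetD)
  then have "Z = {} \<or> Z = dom_int S"
    using 1 2 connected_clopen by blast
  moreover have "x0 \<in> Z" using x0 by (simp add: Z_def)
  ultimately show ?thesis using x by (auto simp: Z_def)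
qed

lemma end_bracket_eventually_zero:
  assumes "f \<in> Dmax S" "g \<in> Dmax S" "\<forall>\<^sub>F x in end_filter S e. f x = 0 \<and> quasi_deriv S f x = 0"
  shows "end_bracket S e f g = 0"
  by (rule end_bracket_eqI[OF assms(1,2) tendsto_const])
     (use assms(3) in \<open>eventually_elim, simp add: bracket_def\<close>)

end

lemma vec2_eq_iff: "(x :: 'a ^ 2) = y \<longleftrightarrow> x $ 1 = y $ 1 \<and> x $ 2 = y $ 2"
  by (auto simp: vec_eq_iff forall_2)

lemma cinner2_expand: "cinner2 x y = x $ 1 * cnj (y $ 1) + x $ 2 * cnj (y $ 2)"
  by (simp add: cinner2_def sum_2)

section \<open>Boundary values, Green's formula and surjectivity\<close>

locale sl_boundary = sturm_liouville S for S +
  fixes l0 :: real and u v :: "endpoint \<Rightarrow> real \<Rightarrow> real"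
  assumes limit_circle: "limit_circle S Lend" "limit_circle S Rend"
    and basis: "boundary_basis S l0 u v"
begin

abbreviation "U e \<equiv> cfun (u e)"
abbreviation "V e \<equiv> cfun (v e)"
abbreviation "\<Gamma>0 \<equiv> Gamma0 S v"
abbreviation "\<Gamma>1 \<equiv> Gamma1 S u"

lemma UV_solution: "sl_solution S (of_real l0) (U e)" "sl_solution S (of_real l0) (V e)"
  using basis by (simp_all add: boundary_basis_def principal_def non_principal_def nontrivial_real_solution_def)

lemma UV_Dmax: "U e \<in> Dmax S" "V e \<in> Dmax S"
  using UV_solution limit_circle by (auto intro: solution_in_Dmax)

lemma UV_ell:
  "AE x in \<mu>. ell S (U e) x = of_real l0 * U e x"
  "AE x in \<mu>. ell S (V e) x = of_real l0 * V e x"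
  using UV_solution[of e] by (simp_all add: sl_solution_def)

lemma end_bracket_UV: "end_bracket S e (U e) (V e) = 1"
  using basis by (simp add: boundary_basis_def)

text \<open>A constant bracket equals its limit at \<open>e\<close>, which is normalised to 1;
  patching needs the value on the whole interval.\<close>

lemma bracket_UV:
  assumes "x \<in> dom_int S"
  shows "bracket S (U e) (V e) x = 1"
proof -
  have "end_bracket S e (U e) (V e) = bracket S (U e) (V e) x"
  proof (rule end_bracket_eqI[OF UV_Dmax tendsto_const])
    show "\<forall>\<^sub>F t in end_filter S e. bracket S (U e) (V e) t = bracket S (U e) (V e) x"
      using end_filter_eventually_dom_int[OF ends]
      by eventually_elim
        (rule bracket_constant[OF DmaxD(1)[OF UV_Dmax(1)] UV_ell(1) DmaxD(1)[OF UV_Dmax(2)] UV_ell(2) _ assms])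
  qed
  then show ?thesis using end_bracket_UV by simp
qed

lemma end_bracket_self: "cfun a \<in> Dmax S \<Longrightarrow> end_bracket S e (cfun a) (cfun a) = 0"
proof (rule end_bracket_eqI[OF _ _ tendsto_const])
  assume a: "cfun a \<in> Dmax S"
  show "\<forall>\<^sub>F x in end_filter S e. bracket S (cfun a) (cfun a) x = 0"
    using end_filter_eventually_dom_int[OF ends]
  proof eventually_elim
    case (elim x)
    then show ?case
      using quasi_deriv_real[OF DmaxD(1)[OF a] elim] by (simp add: bracket_def cfun_def)
  qed
qed

lemma end_bracket_VU: "end_bracket S e (V e) (U e) = - 1"
  using end_bracket_skew[OF UV_Dmax, of e e] end_bracket_UV by simp

lemma bv_linear:
  assumes "f \<in> Dmax S" "g \<in> Dmax S"
  shows "bv0 S v e (\<lambda>x. \<alpha> * f x + \<beta> * g x) = \<alpha> * bv0 S v e f + \<beta> * bv0 S v e g"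
    and "bv1 S u e (\<lambda>x. \<alpha> * f x + \<beta> * g x) = \<alpha> * bv1 S u e f + \<beta> * bv1 S u e g"
  using assms UV_Dmax by (simp_all add: bv0_def bv1_def end_bracket_linear algebra_simps)

lemma Gamma_linear:
  assumes "f \<in> Dmax S" "g \<in> Dmax S"
  shows "\<Gamma>0 (\<lambda>x. \<alpha> * f x + \<beta> * g x) = \<alpha> *s \<Gamma>0 f + \<beta> *s \<Gamma>0 g"
    and "\<Gamma>1 (\<lambda>x. \<alpha> * f x + \<beta> * g x) = \<alpha> *s \<Gamma>1 f + \<beta> *s \<Gamma>1 g"
  using bv_linear[OF assms] by (simp_all add: Gamma0_def Gamma1_def vec2_eq_iff algebra_simps)

lemma end_bracket_bv:
  assumes "f \<in> Dmax S" "g \<in> Dmax S"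
  shows "end_bracket S e f g = bv0 S v e f * cnj (bv1 S u e g) - bv1 S u e f * cnj (bv0 S v e g)"
  using end_bracket_Pluecker[OF assms UV_Dmax, of e e e] end_bracket_UV
  by (simp add: bv0_def bv1_def)

text \<open>The sign in the second component of \<open>Gamma1\<close> absorbs the minus sign between
  the two endpoint brackets.\<close>

lemma Green_Gamma:
  assumes "f \<in> Dmax S" "g \<in> Dmax S"
  shows "L2_inner S (ell S f) g - L2_inner S f (ell S g) = cinner2 (\<Gamma>1 f) (\<Gamma>0 g) - cinner2 (\<Gamma>0 f) (\<Gamma>1 g)"
  unfolding Green[OF assms, symmetric] end_bracket_bv[OF assms]
  by (simp add: cinner2_expand Gamma0_def Gamma1_def)

text \<open>Take \<open>f\<close> equal to \<open>\<alpha> * U e + \<beta> * V e\<close> near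
  \<open>e\<close> and to 0 near the other endpoint. Since \<open>[U,V] = 1\<close>,
  \<open>[V,U] = -1\<close> and the self-brackets vanish, the coefficients are the boundary
  values.\<close>

lemma exists_boundary_values_at_end:
  obtains f where "f \<in> Dmax S" "bv0 S v e f = \<alpha>" "bv1 S u e f = \<beta>"
    "\<And>e'. e' \<noteq> e \<Longrightarrow> bv0 S v e' f = 0 \<and> bv1 S u e' f = 0"
proof -
  have main: "bv0 S v e f = \<alpha> \<and> bv1 S u e f = \<beta>"
    if f: "f \<in> Dmax S" and ev: "\<forall>\<^sub>F x in end_filter S e. f x = \<alpha> * U e x + \<beta> * V e x \<and>
       quasi_deriv S f x = \<alpha> * quasi_deriv S (U e) x + \<beta> * quasi_deriv S (V e) x" for f
  proof -
    have eq: "end_bracket S e f h = \<alpha> * end_bracket S e (U e) h + \<beta> * end_bracket S e (V e) h" if h: "h \<in> Dmax S" for h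
    proof (rule end_bracket_eqI[OF f h])
      show "((\<lambda>x. \<alpha> * bracket S (U e) h x + \<beta> * bracket S (V e) h x) \<longlongrightarrow>
         \<alpha> * end_bracket S e (U e) h + \<beta> * end_bracket S e (V e) h) (end_filter S e)"
        by (intro tendsto_intros bracket_tendsto UV_Dmax h)
      show "\<forall>\<^sub>F x in end_filter S e. bracket S f h x = \<alpha> * bracket S (U e) h x + \<beta> * bracket S (V e) h x"
        using ev by eventually_elim (simp add: bracket_def algebra_simps)
    qed
    show ?thesis
      using eq[OF UV_Dmax(1)[of e]] eq[OF UV_Dmax(2)[of e]] end_bracket_UV end_bracket_VU
        end_bracket_self[OF UV_Dmax(1)[of e]] end_bracket_self[OF UV_Dmax(2)[of e]]
      by (simp add: bv0_def bv1_def)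
  qed
  have zero: "bv0 S v e' f = 0 \<and> bv1 S u e' f = 0"
    if f: "f \<in> Dmax S" and ev: "\<forall>\<^sub>F x in end_filter S e'. f x = 0 \<and> quasi_deriv S f x = 0" for f e'
    using end_bracket_eventually_zero[OF f _ ev] UV_Dmax by (simp add: bv0_def bv1_def)
  show ?thesis
  proof (cases e)
    case Lend
    obtain f c d where f: "f \<in> Dmax S" "c \<in> dom_int S" "d \<in> dom_int S"
      "\<And>x. x \<in> dom_int S \<Longrightarrow> x \<le> c \<Longrightarrow> f x = \<alpha> * U e x + \<beta> * V e x"
      "\<And>x. x \<in> dom_int S \<Longrightarrow> x \<le> c \<Longrightarrow> quasi_deriv S f x = \<alpha> * quasi_deriv S (U e) x + \<beta> * quasi_deriv S (V e) x"
      "\<And>x. x \<in> dom_int S \<Longrightarrow> d \<le> x \<Longrightarrow> f x = 0 * U e x + 0 * V e x"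
      "\<And>x. x \<in> dom_int S \<Longrightarrow> d \<le> x \<Longrightarrow> quasi_deriv S f x = 0 * quasi_deriv S (U e) x + 0 * quasi_deriv S (V e) x"
      by (rule Dmax_patch[OF UV_Dmax(1) UV_ell(1) UV_Dmax(2) UV_ell(2) bracket_UV]) blast+
    have a: "bv0 S v e f = \<alpha> \<and> bv1 S u e f = \<beta>"
      by (rule main[OF f(1)], unfold Lend, rule eventually_mono[OF end_filter_Lend_eventually[OF ends f(2)]])
         (use f(4,5) Lend in auto)
    have b: "bv0 S v Rend f = 0 \<and> bv1 S u Rend f = 0"
      by (rule zero[OF f(1)], rule eventually_mono[OF end_filter_Rend_eventually[OF ends f(3)]])
         (use f(6,7) in auto)
    show ?thesis
    proof (rule that[OF f(1)])
      fix e' assume "e' \<noteq> e"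
      then show "bv0 S v e' f = 0 \<and> bv1 S u e' f = 0" using b Lend by (cases e') auto
    qed (use a in auto)
  next
    case Rend
    obtain f c d where f: "f \<in> Dmax S" "c \<in> dom_int S" "d \<in> dom_int S"
      "\<And>x. x \<in> dom_int S \<Longrightarrow> x \<le> c \<Longrightarrow> f x = 0 * U e x + 0 * V e x"
      "\<And>x. x \<in> dom_int S \<Longrightarrow> x \<le> c \<Longrightarrow> quasi_deriv S f x = 0 * quasi_deriv S (U e) x + 0 * quasi_deriv S (V e) x"
      "\<And>x. x \<in> dom_int S \<Longrightarrow> d \<le> x \<Longrightarrow> f x = \<alpha> * U e x + \<beta> * V e x"
      "\<And>x. x \<in> dom_int S \<Longrightarrow> d \<le> x \<Longrightarrow> quasi_deriv S f x = \<alpha> * quasi_deriv S (U e) x + \<beta> * quasi_deriv S (V e) x"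
      by (rule Dmax_patch[OF UV_Dmax(1) UV_ell(1) UV_Dmax(2) UV_ell(2) bracket_UV]) blast+
    have a: "bv0 S v e f = \<alpha> \<and> bv1 S u e f = \<beta>"
      by (rule main[OF f(1)], unfold Rend, rule eventually_mono[OF end_filter_Rend_eventually[OF ends f(3)]])
         (use f(6,7) Rend in auto)
    have b: "bv0 S v Lend f = 0 \<and> bv1 S u Lend f = 0"
      by (rule zero[OF f(1)], rule eventually_mono[OF end_filter_Lend_eventually[OF ends f(2)]])
         (use f(4,5) in auto)
    show ?thesis
    proof (rule that[OF f(1)])
      fix e' assume "e' \<noteq> e"
      then show "bv0 S v e' f = 0 \<and> bv1 S u e' f = 0" using b Rend by (cases e') auto
    qed (use a in auto)
  qed
qed

lemma Gamma_surjective: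
  obtains f where "f \<in> Dmax S" "\<Gamma>0 f = a" "\<Gamma>1 f = b"
proof -
  obtain f where f: "f \<in> Dmax S" "bv0 S v Lend f = a $ 1" "bv1 S u Lend f = b $ 1"
    "bv0 S v Rend f = 0" "bv1 S u Rend f = 0"
    using exists_boundary_values_at_end[of Lend "a $ 1" "b $ 1"] by blast
  \<comment> \<open>The sign compensates the one in the second component of
    \<open>Gamma1\<close>.\<close>
  obtain g where g: "g \<in> Dmax S" "bv0 S v Rend g = a $ 2" "bv1 S u Rend g = - b $ 2"
    "bv0 S v Lend g = 0" "bv1 S u Lend g = 0"
    using exists_boundary_values_at_end[of Rend "a $ 2" "- b $ 2"] by blast
  show ?thesis
  proof (rule that[of "\<lambda>x. 1 * f x + 1 * g x"])
    show "(\<lambda>x. 1 * f x + 1 * g x) \<in> Dmax S" by (rule Dmax_linear[OF f(1) g(1)])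
    show "\<Gamma>0 (\<lambda>x. 1 * f x + 1 * g x) = a" "\<Gamma>1 (\<lambda>x. 1 * f x + 1 * g x) = b"
      unfolding Gamma_linear[OF f(1) g(1)] using f g by (simp_all add: Gamma0_def Gamma1_def vec2_eq_iff)
  qed
qed

end

section \<open>Resolvents of the extensions\<close>

lemma inner_eq_Re_cinner2: "inner x y = Re (cinner2 x y)"
  by (simp add: inner_vec_def sum_2 cinner2_expand inner_complex_def)

lemma cinner2_scale: "cinner2 (c *s x) y = c * cinner2 x y"
  by (simp add: cinner2_expand algebra_simps)

lemma of_real_smult: "complex_of_real r *s x = r *\<^sub>R (x :: complex ^ 2)"
  by (auto simp: vec_eq_iff) (simp_all add: scaleR_conv_of_real)

lemma cinner2_minus: "cinner2 (- x) y = - cinner2 x y" "cinner2 x (- y) = - cinner2 x y"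
  by (simp_all add: cinner2_expand)

text \<open>Complex linearity is weakened to real linearity because the dimension formulas applied
  later are those of real Euclidean spaces.\<close>

lemma linear_relation_subspace:
  assumes "linear_relation \<theta>"
  shows "subspace \<theta>"
  unfolding subspace_def
proof (intro conjI ballI allI)
  show "0 \<in> \<theta>" using assms by (simp add: linear_relation_def zero_prod_def)
  have "\<forall>p\<in>\<theta>. \<forall>q\<in>\<theta>. (fst p + fst q, snd p + snd q) \<in> \<theta>"
    and sc: "\<forall>c. \<forall>p\<in>\<theta>. (c *s fst p, c *s snd p) \<in> \<theta>"
    using assms by (simp_all add: linear_relation_def case_prod_beta)
  then show "p + q \<in> \<theta>" if "p \<in> \<theta>" "q \<in> \<theta>" for p q
    using that by (simp add: plus_prod_def)
  show "r *\<^sub>R p \<in> \<theta>" if "p \<in> \<theta>" for r p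
    using sc[rule_format, OF that, of "complex_of_real r"] by (simp add: of_real_smult scaleR_prod_def)
qed

text \<open>Self-adjointness says that \<open>\<theta>\<close> is the orthogonal complement of its
  image under the rotation \<open>J\<close>, so two equal dimensions add up to 8, the real dimension
  of the space of pairs. Real orthogonality is enough because \<open>\<theta>\<close> is closed
  under multiplication by \<open>\<i>\<close>.\<close>

lemma sa_relation_dim:
  assumes "\<theta> \<in> sa_relations"
  shows "dim \<theta> = 4"
proof -
  have lin: "linear_relation \<theta>" and adj: "adjoint_relation \<theta> = \<theta>"
    using assms by (auto simp: sa_relations_def)
  define J :: "(complex ^ 2) \<times> (complex ^ 2) \<Rightarrow> (complex ^ 2) \<times> (complex ^ 2)" where "J = (\<lambda>(x, y). (y, - x))"
  have J: "linear J" "inj J"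
    by (auto simp: J_def linear_iff inj_def split: prod.splits)
  have "\<theta> = {p \<in> UNIV. \<forall>q\<in>J ` \<theta>. orthogonal q p}"
  proof (intro set_eqI iffI)
    fix p assume "p \<in> \<theta>"
    then have "p \<in> adjoint_relation \<theta>" using adj by simp
    then show "p \<in> {p \<in> UNIV. \<forall>q\<in>J ` \<theta>. orthogonal q p}"
      by (cases p) (auto simp: adjoint_relation_def orthogonal_def J_def inner_eq_Re_cinner2 cinner2_minus)
  next
    fix p assume p: "p \<in> {p \<in> UNIV. \<forall>q\<in>J ` \<theta>. orthogonal q p}"
    have re: "Re (cinner2 y (fst p)) = Re (cinner2 x (snd p))" if "(x, y) \<in> \<theta>" for x y
    proof -
      have "orthogonal (J (x, y)) p" using p that by blast
      then show ?thesis by (cases p) (simp add: orthogonal_def J_def inner_eq_Re_cinner2 cinner2_minus)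
    qed
    have "cinner2 y (fst p) = cinner2 x (snd p)" if xy: "(x, y) \<in> \<theta>" for x y
    proof -
      have "\<forall>c. \<forall>p\<in>\<theta>. (c *s fst p, c *s snd p) \<in> \<theta>"
        using lin by (simp add: linear_relation_def case_prod_beta)
      then have "(\<i> *s x, \<i> *s y) \<in> \<theta>" using xy by fastforce
      then have "Re (cinner2 (\<i> *s y) (fst p)) = Re (cinner2 (\<i> *s x) (snd p))" by (rule re)
      then show ?thesis using re[OF xy] by (simp add: cinner2_scale complex_eq_iff)
    qed
    then have "p \<in> adjoint_relation \<theta>" by (cases p) (auto simp: adjoint_relation_def)
    then show "p \<in> \<theta>" using adj by simp
  qed
  moreover have "subspace (J ` \<theta>)"
    by (rule linear_subspace_image[OF J(1) linear_relation_subspace[OF lin]])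
  ultimately have "dim \<theta> + dim (J ` \<theta>) = dim (UNIV :: ((complex ^ 2) \<times> (complex ^ 2)) set)"
    using dim_subspace_orthogonal_to_vectors[of "J ` \<theta>" UNIV] by simp
  moreover have "dim (J ` \<theta>) = dim \<theta>"
    by (rule dim_image_eq[OF J(1)]) (use J(2) in \<open>auto intro: inj_on_subset\<close>)
  ultimately show ?thesis by simp
qed

text \<open>In matrix notation \<open>A = (y x^H + x y^H) / n - c x x^H / n^2\<close>. The first
  term sends \<open>x\<close> to \<open>y + (c / n) x\<close>, and the second removes the excess.
  \<open>A\<close> is Hermitian because \<open>c\<close> is real, which is the symmetry
  hypothesis.\<close>

lemma hermitian_matrix_exists:
  fixes x y :: "complex ^ 2"
  assumes x: "x \<noteq> 0" and sym: "cinner2 y x = cinner2 x y"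
  obtains A where "hermitian_matrix A" "A *v x = y"
proof -
  define n where "n = cinner2 x x"
  define c where "c = cinner2 y x"
  define A :: "complex ^ 2 ^ 2" where
    "A = (\<chi> i j. (y $ i * cnj (x $ j) + x $ i * cnj (y $ j)) / n - c * (x $ i * cnj (x $ j)) / (n * n))"
  define r where "r = (cmod (x $ 1))\<^sup>2 + (cmod (x $ 2))\<^sup>2"
  have "n = complex_of_real r"
    by (simp only: n_def r_def cinner2_expand of_real_add complex_norm_square)
  moreover have "r \<noteq> 0"
    using x by (auto simp: r_def vec2_eq_iff add_nonneg_eq_0_iff)
  ultimately have n: "n \<noteq> 0" "cnj n = n" by simp_all
  have "cnj c = cinner2 x y" by (simp add: c_def cinner2_expand mult.commute)
  then have c: "cnj c = c" using sym by (simp add: c_def)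
  show ?thesis
  proof (rule that)
    show "hermitian_matrix A"
      unfolding hermitian_matrix_def A_def using n c by (simp add: mult.commute add.commute)
    have eq: "(A *v x) $ i = y $ i" for i
    proof -
      have "(A *v x) $ i = (y $ i * (cnj (x $ 1) * x $ 1 + cnj (x $ 2) * x $ 2) + x $ i * (cnj (y $ 1) * x $ 1 + cnj (y $ 2) * x $ 2)) / n
         - c * x $ i * (cnj (x $ 1) * x $ 1 + cnj (x $ 2) * x $ 2) / (n * n)"
        by (simp add: A_def matrix_vector_mult_def sum_2 algebra_simps add_divide_distrib diff_divide_distrib)
      also have "cnj (x $ 1) * x $ 1 + cnj (x $ 2) * x $ 2 = n"
        by (simp add: n_def cinner2_expand mult.commute)
      also have "cnj (y $ 1) * x $ 1 + cnj (y $ 2) * x $ 2 = c"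
        using sym by (simp add: c_def cinner2_expand mult.commute)
      finally show ?thesis using n by (simp add: field_simps)
    qed
    then show "A *v x = y" by (simp add: vec_eq_iff)
  qed
qed

lemma eigenvalue_not_in_resolvent_set:
  assumes "eigenvalue S T z"
  shows "z \<notin> resolvent_set S T"
proof
  assume "z \<in> resolvent_set S T"
  then have *: "\<forall>(f, g)\<in>T. L2_eq S (\<lambda>x. g x - z * f x) (\<lambda>x. 0) \<longrightarrow> L2_eq S f (\<lambda>x. 0)"
    by (simp add: resolvent_set_def)
  obtain f g where "(f, g) \<in> T" "\<not> L2_eq S f (\<lambda>x. 0)" "L2_eq S g (\<lambda>x. z * f x)"
    using assms by (auto simp: eigenvalue_def)
  with * show False by (auto simp: L2_eq_def)
qed

section \<open>Null solutions and the transfer of resolvent points between extensions\<close>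

context sl_boundary
begin

definition null_solutions :: "complex \<Rightarrow> (real \<Rightarrow> complex) set" where
  "null_solutions z = {y \<in> Dmax S. AE x in \<mu>. ell S y x = z * y x}"

abbreviation "\<Gamma> f \<equiv> (\<Gamma>0 f, \<Gamma>1 f)"

lemma null_solutions_linear:
  assumes "f \<in> null_solutions z" "g \<in> null_solutions z"
  shows "(\<lambda>x. \<alpha> * f x + \<beta> * g x) \<in> null_solutions z"
proof -
  have f: "f \<in> Dmax S" "AE x in \<mu>. ell S f x = z * f x"
    and g: "g \<in> Dmax S" "AE x in \<mu>. ell S g x = z * g x"
    using assms by (auto simp: null_solutions_def)
  have "AE x in \<mu>. ell S (\<lambda>x. \<alpha> * f x + \<beta> * g x) x = z * (\<alpha> * f x + \<beta> * g x)"
    using f(2) g(2) sl_regular_linear(3)[OF DmaxD(1)[OF f(1)] DmaxD(1)[OF g(1)], where \<alpha> = \<alpha> and \<beta> = \<beta>]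
    by eventually_elim (simp add: algebra_simps)
  then show ?thesis
    using Dmax_linear[OF f(1) g(1)] by (simp add: null_solutions_def)
qed

text \<open>Values off the interval are irrelevant: by uniqueness of quasi-derivatives the chosen
  one vanishes on \<open>dom_int S\<close>, hence so do all brackets near the endpoints.\<close>

lemma Gamma_zero:
  assumes "f \<in> Dmax S" "\<And>x. x \<in> dom_int S \<Longrightarrow> f x = 0"
  shows "\<Gamma> f = 0"
proof -
  have z: "(\<lambda>x. 0) \<in> Dmax S" using Dmax_scale[OF assms(1), of 0] by simp
  have qd: "quasi_deriv S f x = 0" if "x \<in> dom_int S" for x
  proof (rule is_quasi_deriv_unique[OF is_quasi_deriv_quasi_deriv[OF DmaxD(1)[OF assms(1)]] _ that])
    have "AE x in \<mu>. 0 = of_real (cp S x) * vector_derivative f (at x)"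
      using AE_dom_int
    proof eventually_elim
      case (elim x)
      have "vector_derivative f (at x) = 0"
        by (rule vector_derivative_at, rule has_vector_derivative_cong_dom[of f "\<lambda>x. 0"]) (use assms(2) elim in auto)
      then show ?case by simp
    qed
    then show "is_quasi_deriv S f (\<lambda>x. 0)" by (simp only: is_quasi_deriv_def AC_loc_const)
  qed
  have "end_bracket S e f h = 0" if "h \<in> Dmax S" for e h
    by (rule end_bracket_eventually_zero[OF assms(1) that], rule eventually_mono[OF end_filter_eventually_dom_int[OF ends]])
       (use assms(2) qd in auto)
  then show ?thesis
    using UV_Dmax by (simp add: Gamma0_def Gamma1_def bv0_def bv1_def vec2_eq_iff zero_prod_def)
qed

text \<open>By continuity of members of \<open>Dmax\<close>; it makes boundary values depend only on
  the class modulo almost-everywhere equality.\<close>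

lemma Gamma_AE_zero:
  assumes "f \<in> Dmax S" "L2_eq S f (\<lambda>x. 0)"
  shows "\<Gamma> f = 0"
proof (rule Gamma_zero[OF assms(1)])
  fix x assume "x \<in> dom_int S"
  then show "f x = 0"
    using assms(2) AC_loc_continuous_on[OF AC_loc_regular[OF DmaxD(1)[OF assms(1)]]]
    by (intro continuous_AE_eq[OF open_einterval]) (auto simp: L2_eq_def)
qed

text \<open>Choose \<open>g\<close> with boundary values \<open>(a, b)\<close> and solve the
  equation with right-hand side \<open>ell g - z g\<close> by some \<open>f\<close> in the domain of
  the extension; then \<open>y = g - f\<close>. Hence boundary values of null solutions and
  \<open>\<theta>\<close> together span everything.\<close>

lemma null_solution_from_resolvent:
  assumes z: "z \<in> resolvent_set S (L_ext S u v \<theta>)"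
  obtains y f where "y \<in> null_solutions z" "f \<in> Dmax S" "\<Gamma> f \<in> \<theta>" "\<Gamma>0 y = a - \<Gamma>0 f" "\<Gamma>1 y = b - \<Gamma>1 f"
proof -
  obtain g where g: "g \<in> Dmax S" "\<Gamma>0 g = a" "\<Gamma>1 g = b" by (rule Gamma_surjective)
  have "(\<lambda>x. ell S g x + (- z) * g x) \<in> L2_space S"
    by (intro L2_space_add(1) L2_space_mult(1) DmaxD[OF g(1)])
  then have "(\<lambda>x. ell S g x - z * g x) \<in> L2_space S" by simp
  then obtain f where f: "f \<in> Dmax S" "\<Gamma> f \<in> \<theta>"
    and eq: "L2_eq S (\<lambda>x. ell S f x - z * f x) (\<lambda>x. ell S g x - z * g x)"
    using z by (fastforce simp: resolvent_set_def L_ext_def Lmax_def)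
  let ?y = "\<lambda>x. 1 * g x + (- 1) * f x"
  have "AE x in \<mu>. ell S ?y x = z * ?y x"
    using eq[unfolded L2_eq_def] sl_regular_linear(3)[OF DmaxD(1)[OF g(1)] DmaxD(1)[OF f(1)], where \<alpha> = 1 and \<beta> = "- 1"]
  proof eventually_elim
    case (elim x)
    show ?case unfolding elim(2) using elim(1) by (simp add: algebra_simps)
  qed
  then have y: "?y \<in> null_solutions z"
    using Dmax_linear[OF g(1) f(1)] unfolding null_solutions_def by blast
  show ?thesis
    by (rule that[OF y f]) (unfold Gamma_linear[OF g(1) f(1)], simp_all add: g)
qed

text \<open>Real coefficients match the real dimension count. The norm bound, linear in the
  coefficients, will keep the correction by null solutions bounded.\<close>

lemma null_solutions_sum:
  assumes "finite B" "\<And>b. b \<in> B \<Longrightarrow> y b \<in> null_solutions z"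
  shows "\<exists>K\<ge>0. \<forall>k :: 'b \<Rightarrow> real. (\<lambda>x. \<Sum>b\<in>B. of_real (k b) * y b x) \<in> null_solutions z \<and>
     \<Gamma> (\<lambda>x. \<Sum>b\<in>B. of_real (k b) * y b x) = (\<Sum>b\<in>B. k b *\<^sub>R \<Gamma> (y b)) \<and>
     L2_norm S (\<lambda>x. \<Sum>b\<in>B. of_real (k b) * y b x) \<le> K * (\<Sum>b\<in>B. \<bar>k b\<bar>)"
  using assms
proof (induction B rule: finite_induct)
  case empty
  obtain f where f: "f \<in> Dmax S" by (rule Gamma_surjective)
  have z: "(\<lambda>x. 0) \<in> Dmax S" using Dmax_scale[OF f, of 0] by simp
  have "AE x in \<mu>. ell S (\<lambda>x. 0) x = z * 0"
    using sl_regular_linear(3)[OF DmaxD(1)[OF f] DmaxD(1)[OF f], where \<alpha> = 0 and \<beta> = 0] by simp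
  then have "(\<lambda>x. 0) \<in> null_solutions z" using z by (simp add: null_solutions_def)
  moreover have "L2_norm S (\<lambda>x. 0) = 0" by (simp add: L2_norm_def)
  ultimately show ?case using Gamma_zero[OF z] by (intro exI[of _ 0]) simp
next
  case (insert a B)
  obtain K where K: "K \<ge> 0" "\<And>k. (\<lambda>x. \<Sum>b\<in>B. of_real (k b) * y b x) \<in> null_solutions z"
     "\<And>k. \<Gamma> (\<lambda>x. \<Sum>b\<in>B. of_real (k b) * y b x) = (\<Sum>b\<in>B. k b *\<^sub>R \<Gamma> (y b))"
     "\<And>k. L2_norm S (\<lambda>x. \<Sum>b\<in>B. of_real (k b) * y b x) \<le> K * (\<Sum>b\<in>B. \<bar>k b\<bar>)"
    using insert.IH insert.prems by auto
  have ya: "y a \<in> null_solutions z" using insert.prems by simp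
  then have yD: "y a \<in> Dmax S" by (simp add: null_solutions_def)
  define K' where "K' = 2 * (L2_norm S (y a) + K)"
  have "K' \<ge> 0" using K(1) L2_norm_nonneg by (simp add: K'_def)
  moreover have "(\<lambda>x. \<Sum>b\<in>insert a B. of_real (k b) * y b x) \<in> null_solutions z \<and>
     \<Gamma> (\<lambda>x. \<Sum>b\<in>insert a B. of_real (k b) * y b x) = (\<Sum>b\<in>insert a B. k b *\<^sub>R \<Gamma> (y b)) \<and>
     L2_norm S (\<lambda>x. \<Sum>b\<in>insert a B. of_real (k b) * y b x) \<le> K' * (\<Sum>b\<in>insert a B. \<bar>k b\<bar>)" for k :: "'b \<Rightarrow> real"
  proof -
    let ?s = "\<lambda>x. \<Sum>b\<in>B. of_real (k b) * y b x"
    have sD: "?s \<in> Dmax S" using K(2) by (simp add: null_solutions_def)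
    have split: "(\<lambda>x. \<Sum>b\<in>insert a B. of_real (k b) * y b x) = (\<lambda>x. of_real (k a) * y a x + 1 * ?s x)"
      using insert.hyps by (simp add: fun_eq_iff)
    have "\<Gamma> (\<lambda>x. of_real (k a) * y a x + 1 * ?s x) = k a *\<^sub>R \<Gamma> (y a) + \<Gamma> ?s"
      unfolding Gamma_linear[OF yD sD] by (simp add: of_real_smult plus_prod_def scaleR_prod_def)
    then have G: "\<Gamma> (\<lambda>x. of_real (k a) * y a x + 1 * ?s x) = (\<Sum>b\<in>insert a B. k b *\<^sub>R \<Gamma> (y b))"
      unfolding K(3) using insert.hyps by simp
    have "L2_norm S (\<lambda>x. of_real (k a) * y a x + 1 * ?s x) \<le> 2 * (\<bar>k a\<bar> * L2_norm S (y a) + L2_norm S ?s)"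
      using L2_space_add(2)[OF L2_space_mult(1)[OF DmaxD(2)[OF yD], of "of_real (k a)"] DmaxD(2)[OF sD]]
        L2_space_mult(2)[OF DmaxD(2)[OF yD], of "of_real (k a)"] by simp
    also have "\<dots> \<le> 2 * (\<bar>k a\<bar> * (L2_norm S (y a) + K) + (L2_norm S (y a) + K) * (\<Sum>b\<in>B. \<bar>k b\<bar>))"
    proof (intro mult_left_mono add_mono)
      have "K * (\<Sum>b\<in>B. \<bar>k b\<bar>) \<le> (L2_norm S (y a) + K) * (\<Sum>b\<in>B. \<bar>k b\<bar>)"
        using L2_norm_nonneg by (intro mult_right_mono sum_nonneg) auto
      then show "L2_norm S ?s \<le> (L2_norm S (y a) + K) * (\<Sum>b\<in>B. \<bar>k b\<bar>)"
        using K(4)[of k] by linarith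
    qed (use K(1) in auto)
    also have "\<dots> = K' * (\<Sum>b\<in>insert a B. \<bar>k b\<bar>)"
      using insert.hyps by (simp add: K'_def algebra_simps)
    finally show ?thesis
      unfolding split using null_solutions_linear[OF ya K(2)] G by blast
  qed
  ultimately show ?case by blast
qed

text \<open>Duality: surjectivity provides a \<open>g\<close> for which the real part of the right
  side of Green's formula is the coordinate of \<open>\<Gamma> f\<close> along \<open>b\<close>;
  Cauchy-Schwarz then bounds it by the graph norm of \<open>f\<close>.\<close>

lemma Gamma_bound:
  obtains G where "G \<ge> 0" "\<And>f b. f \<in> Dmax S \<Longrightarrow> b \<in> Basis \<Longrightarrow>
    \<bar>\<Gamma> f \<bullet> b\<bar> \<le> G * (L2_norm S (ell S f) + L2_norm S f)"
proof -
  have "\<exists>G\<ge>0. \<forall>f\<in>Dmax S. \<bar>\<Gamma> f \<bullet> b\<bar> \<le> G * (L2_norm S (ell S f) + L2_norm S f)"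
    for b :: "(complex ^ 2) \<times> (complex ^ 2)"
  proof -
    \<comment> \<open>The swap and the sign undo the symplectic form in Green's formula.\<close>
    obtain g where g: "g \<in> Dmax S" "\<Gamma>0 g = snd b" "\<Gamma>1 g = - fst b" by (rule Gamma_surjective)
    have "\<bar>\<Gamma> f \<bullet> b\<bar> \<le> (L2_norm S g + L2_norm S (ell S g)) * (L2_norm S (ell S f) + L2_norm S f)"
      if f: "f \<in> Dmax S" for f
    proof -
      have "cinner2 (\<Gamma>0 f) (- fst b) = - cinner2 (\<Gamma>0 f) (fst b)" by (simp add: cinner2_expand)
      then have "\<Gamma> f \<bullet> b = Re (cinner2 (\<Gamma>1 f) (\<Gamma>0 g) - cinner2 (\<Gamma>0 f) (\<Gamma>1 g))"
        unfolding g by (cases b) (simp add: inner_eq_Re_cinner2)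
      also have "\<dots> = Re (L2_inner S (ell S f) g - L2_inner S f (ell S g))"
        by (simp only: Green_Gamma[OF f g(1)])
      finally have "\<bar>\<Gamma> f \<bullet> b\<bar> \<le> cmod (L2_inner S (ell S f) g - L2_inner S f (ell S g))"
        using abs_Re_le_cmod by metis
      also have "\<dots> \<le> cmod (L2_inner S (ell S f) g) + cmod (L2_inner S f (ell S g))"
        by (rule norm_triangle_ineq4)
      also have "\<dots> \<le> L2_norm S (ell S f) * L2_norm S g + L2_norm S f * L2_norm S (ell S g)"
        by (intro add_mono L2_Cauchy_Schwarz DmaxD f g(1))
      also have "\<dots> \<le> (L2_norm S g + L2_norm S (ell S g)) * (L2_norm S (ell S f) + L2_norm S f)"
        using L2_norm_nonneg by (simp add: algebra_simps)
      finally show ?thesis .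
    qed
    then show ?thesis
      using L2_norm_nonneg by (intro exI[of _ "L2_norm S g + L2_norm S (ell S g)"]) auto
  qed
  then obtain G where G: "\<And>b. G b \<ge> 0" "\<And>b f. f \<in> Dmax S \<Longrightarrow> \<bar>\<Gamma> f \<bullet> b\<bar> \<le> G b * (L2_norm S (ell S f) + L2_norm S f)"
    by metis
  show ?thesis
  proof (rule that)
    show "(\<Sum>b\<in>Basis. G b) \<ge> 0" using G(1) by (simp add: sum_nonneg)
    fix f and b :: "(complex ^ 2) \<times> (complex ^ 2)" assume f: "f \<in> Dmax S" and b: "b \<in> Basis"
    have "G b \<le> (\<Sum>b\<in>Basis. G b)" using b G(1) by (intro member_le_sum) auto
    then have "G b * (L2_norm S (ell S f) + L2_norm S f) \<le> (\<Sum>b\<in>Basis. G b) * (L2_norm S (ell S f) + L2_norm S f)"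
      using L2_norm_nonneg by (intro mult_right_mono add_nonneg_nonneg) auto
    then show "\<bar>\<Gamma> f \<bullet> b\<bar> \<le> (\<Sum>b\<in>Basis. G b) * (L2_norm S (ell S f) + L2_norm S f)"
      using G(2)[OF f, of b] by linarith
  qed
qed

text \<open>Dimension count: \<open>\<Gamma>\<close> maps the null solutions onto a complement of \<open>\<theta>'\<close>, so resolving in
  \<open>L(\<theta>)\<close> and correcting by a null solution resolves in \<open>L(\<theta>')\<close>.\<close>

lemma resolvent_set_transfer:
  assumes \<theta>: "\<theta> \<in> sa_relations" and \<theta>': "\<theta>' \<in> sa_relations"
    and z: "z \<in> resolvent_set S (L_ext S u v \<theta>)" and ne: "\<not> eigenvalue S (L_ext S u v \<theta>') z"
  shows "z \<in> resolvent_set S (L_ext S u v \<theta>')"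
proof -
  let ?N = "\<Gamma> ` null_solutions z"
  have sub: "subspace \<theta>" "subspace \<theta>'"
    using \<theta> \<theta>' by (auto simp: sa_relations_def intro: linear_relation_subspace)
  obtain y0 where y0: "y0 \<in> null_solutions z" by (rule null_solution_from_resolvent[OF z])
  have N: "subspace ?N"
    unfolding subspace_def
  proof (intro conjI ballI allI)
    have lin: "\<alpha> *\<^sub>R \<Gamma> f + \<beta> *\<^sub>R \<Gamma> g \<in> ?N" if "f \<in> null_solutions z" "g \<in> null_solutions z" for \<alpha> \<beta> :: real and f g
    proof -
      have "f \<in> Dmax S" "g \<in> Dmax S" using that by (auto simp: null_solutions_def)
      then have "\<Gamma> (\<lambda>x. of_real \<alpha> * f x + of_real \<beta> * g x) = \<alpha> *\<^sub>R \<Gamma> f + \<beta> *\<^sub>R \<Gamma> g"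
        by (simp add: Gamma_linear of_real_smult)
      then show ?thesis
        by (intro image_eqI[OF _ null_solutions_linear[OF that, of "of_real \<alpha>" "of_real \<beta>"]]) (rule sym)
    qed
    show "0 \<in> ?N" using lin[OF y0 y0, of 0 0] by (simp add: zero_prod_def)
    show "p + q \<in> ?N" if "p \<in> ?N" "q \<in> ?N" for p q
      using that lin[of _ _ 1 1] by fastforce
    show "r *\<^sub>R p \<in> ?N" if "p \<in> ?N" for r p
      using that lin[of _ _ r 0] by fastforce
  qed
  have triv: "L2_eq S f (\<lambda>x. 0)" if "f \<in> null_solutions z" "\<Gamma> f \<in> \<theta>'" for f
  proof (rule ccontr)
    assume "\<not> L2_eq S f (\<lambda>x. 0)"
    moreover have "(f, ell S f) \<in> L_ext S u v \<theta>'"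
      using that by (auto simp: L_ext_def Lmax_def null_solutions_def)
    moreover have "L2_eq S (ell S f) (\<lambda>x. z * f x)"
      using that(1) by (simp add: null_solutions_def L2_eq_def)
    ultimately show False using ne unfolding eigenvalue_def by blast
  qed
  have full: "\<exists>n\<in>?N. \<exists>r\<in>\<theta>. c = n + r" for c
  proof -
    obtain y f where yf: "y \<in> null_solutions z" "\<Gamma> f \<in> \<theta>" "\<Gamma>0 y = fst c - \<Gamma>0 f" "\<Gamma>1 y = snd c - \<Gamma>1 f"
      by (rule null_solution_from_resolvent[OF z])
    then have "c = \<Gamma> y + \<Gamma> f" by (simp add: prod_eq_iff)
    then show ?thesis using yf(1,2) by blast
  qed
  have "{x + y |x y. x \<in> ?N \<and> y \<in> \<theta>} = UNIV" using full by blast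
  \<comment> \<open>The sum of \<open>?N\<close> and the 4-dimensional \<open>\<theta>\<close> is
    the whole space, of real dimension 8.\<close>
  then have "dim ?N \<ge> 4"
    using dim_sums_Int[OF N sub(1)] sa_relation_dim[OF \<theta>] by simp
  \<comment> \<open>Since \<open>z\<close> is not an eigenvalue for \<open>\<theta>'\<close>, the
    sum with \<open>\<theta>'\<close> is direct, and two dimensions of at least 4 fill the
    space.\<close>
  moreover have "?N \<inter> \<theta>' = {0}"
  proof
    show "?N \<inter> \<theta>' \<subseteq> {0}"
      using triv Gamma_AE_zero by (auto simp: null_solutions_def)
    show "{0} \<subseteq> ?N \<inter> \<theta>'" using N sub(2) by (simp add: subspace_0)
  qed
  ultimately have "dim {x + y |x y. x \<in> ?N \<and> y \<in> \<theta>'} \<ge> 8"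
    using dim_sums_Int[OF N sub(2)] sa_relation_dim[OF \<theta>'] by simp
  then have "dim {x + y |x y. x \<in> ?N \<and> y \<in> \<theta>'} = DIM((complex ^ 2) \<times> (complex ^ 2))"
    using dim_subset_UNIV[of "{x + y |x y. x \<in> ?N \<and> y \<in> \<theta>'}"] by simp
  then have UN: "{x + y |x y. x \<in> ?N \<and> y \<in> \<theta>'} = UNIV"
  proof -
    assume "dim {x + y |x y. x \<in> ?N \<and> y \<in> \<theta>'} = DIM((complex ^ 2) \<times> (complex ^ 2))"
    then have "span {x + y |x y. x \<in> ?N \<and> y \<in> \<theta>'} = UNIV" by (simp only: dim_eq_full)
    moreover have "span {x + y |x y. x \<in> ?N \<and> y \<in> \<theta>'} = {x + y |x y. x \<in> ?N \<and> y \<in> \<theta>'}"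
      using subspace_sums[OF N sub(2)] by (simp only: span_eq_iff)
    ultimately show ?thesis by (simp only:)
  qed
  have "\<exists>p. fst p \<in> null_solutions z \<and> snd p \<in> \<theta>' \<and> c = \<Gamma> (fst p) + snd p" for c
  proof -
    have "c \<in> {x + y |x y. x \<in> ?N \<and> y \<in> \<theta>'}" unfolding UN by (rule UNIV_I)
    then obtain y r where "y \<in> null_solutions z" "r \<in> \<theta>'" "c = \<Gamma> y + r" by blast
    then show ?thesis by (intro exI[of _ "(y, r)"]) simp
  qed
  then have "\<exists>P. \<forall>c. fst (P c) \<in> null_solutions z \<and> snd (P c) \<in> \<theta>' \<and> c = \<Gamma> (fst (P c)) + snd (P c)"
    by (intro choice allI)
  then obtain P where P: "\<forall>c. fst (P c) \<in> null_solutions z \<and> snd (P c) \<in> \<theta>' \<and> c = \<Gamma> (fst (P c)) + snd (P c)"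
    by blast
  define y r where "y = (\<lambda>c. fst (P c))" and "r = (\<lambda>c. snd (P c))"
  have yr: "y c \<in> null_solutions z" "r c \<in> \<theta>'" "c = \<Gamma> (y c) + r c" for c
    unfolding y_def r_def using P by blast+
  obtain K where K: "K \<ge> 0" "\<And>k. (\<lambda>x. \<Sum>b\<in>Basis. of_real (k b) * y b x) \<in> null_solutions z"
     "\<And>k. \<Gamma> (\<lambda>x. \<Sum>b\<in>Basis. of_real (k b) * y b x) = (\<Sum>b\<in>Basis. k b *\<^sub>R \<Gamma> (y b))"
     "\<And>k. L2_norm S (\<lambda>x. \<Sum>b\<in>Basis. of_real (k b) * y b x) \<le> K * (\<Sum>b\<in>Basis. \<bar>k b\<bar>)"
    using null_solutions_sum[of Basis y z] yr(1) by auto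
  \<comment> \<open>The chosen decompositions need not depend linearly on \<open>c\<close>; only
    those of the basis vectors are kept, and \<open>Y\<close> extends them linearly with control of
    the norm.\<close>
  define Y where "Y = (\<lambda>c x. \<Sum>b\<in>Basis. of_real (c \<bullet> b) * y b x)"
  have YN: "Y c \<in> null_solutions z" for c using K(2)[of "\<lambda>b. c \<bullet> b"] by (simp add: Y_def)
  then have YD: "Y c \<in> Dmax S" for c by (simp add: null_solutions_def)
  have Y\<theta>: "c - \<Gamma> (Y c) \<in> \<theta>'" for c
  proof -
    have "c = (\<Sum>b\<in>Basis. (c \<bullet> b) *\<^sub>R b)" by (simp add: euclidean_representation)
    also have "\<dots> = (\<Sum>b\<in>Basis. (c \<bullet> b) *\<^sub>R \<Gamma> (y b) + (c \<bullet> b) *\<^sub>R r b)"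
    proof (rule sum.cong[OF refl])
      fix b :: "(complex ^ 2) \<times> (complex ^ 2)"
      show "(c \<bullet> b) *\<^sub>R b = (c \<bullet> b) *\<^sub>R \<Gamma> (y b) + (c \<bullet> b) *\<^sub>R r b"
        using arg_cong[OF yr(3)[of b], of "\<lambda>t. (c \<bullet> b) *\<^sub>R t"] by (simp only: scaleR_add_right)
    qed
    also have "\<dots> = \<Gamma> (Y c) + (\<Sum>b\<in>Basis. (c \<bullet> b) *\<^sub>R r b)"
      using K(3)[of "\<lambda>b. c \<bullet> b"] by (simp add: sum.distrib Y_def)
    finally have "c - \<Gamma> (Y c) = (\<Sum>b\<in>Basis. (c \<bullet> b) *\<^sub>R r b)"
      by (intro diff_eq_eq[THEN iffD2]) (erule trans, rule add.commute)
    moreover have "(\<Sum>b\<in>Basis. (c \<bullet> b) *\<^sub>R r b) \<in> \<theta>'"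
      by (intro subspace_sum[OF sub(2)] subspace_scale[OF sub(2)] yr(2))
    ultimately show ?thesis by (simp only:)
  qed
  have YK: "L2_norm S (Y c) \<le> K * (\<Sum>b\<in>Basis. \<bar>c \<bullet> b\<bar>)" for c
    using K(4)[of "\<lambda>b. c \<bullet> b"] by (simp add: Y_def)
  obtain C0 where C0: "\<And>f. f \<in> Dmax S \<Longrightarrow> \<Gamma> f \<in> \<theta> \<Longrightarrow> L2_norm S f \<le> C0 * L2_norm S (\<lambda>x. ell S f x - z * f x)"
    using z by (fastforce simp: resolvent_set_def L_ext_def Lmax_def)
  define C1 where "C1 = \<bar>C0\<bar>"
  have C1: "L2_norm S f \<le> C1 * L2_norm S (\<lambda>x. ell S f x - z * f x)" if "f \<in> Dmax S" "\<Gamma> f \<in> \<theta>" for f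
  proof -
    have "C0 * L2_norm S (\<lambda>x. ell S f x - z * f x) \<le> C1 * L2_norm S (\<lambda>x. ell S f x - z * f x)"
      using L2_norm_nonneg by (intro mult_right_mono) (auto simp: C1_def)
    then show ?thesis using C0[OF that] by linarith
  qed
  obtain G where G: "G \<ge> 0" "\<And>f b. f \<in> Dmax S \<Longrightarrow> b \<in> Basis \<Longrightarrow>
    \<bar>\<Gamma> f \<bullet> b\<bar> \<le> G * (L2_norm S (ell S f) + L2_norm S f)"
    by (rule Gamma_bound, rule that; blast)
  let ?m = "real (DIM((complex ^ 2) \<times> (complex ^ 2)))"
  \<comment> \<open>Relative to the norm of the right-hand side, \<open>C1\<close> bounds the
    solution \<open>f0\<close> for \<open>\<theta>\<close> and
    \<open>2 * (1 + cmod z * C1) + C1\<close> its graph norm; \<open>G\<close> passes to each of the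
    \<open>?m\<close> coordinates of \<open>\<Gamma> f0\<close>, and \<open>K\<close> to the
    correction. The outer 2 is the factor for sums in \<open>L2_norm\<close>.\<close>
  define C2 where "C2 = 2 * (C1 + K * (?m * (G * (2 * (1 + cmod z * C1) + C1))))"
  have solve: "\<exists>f\<in>Dmax S. \<Gamma> f \<in> \<theta>' \<and> L2_eq S (\<lambda>x. ell S f x - z * f x) h \<and> L2_norm S f \<le> C2 * L2_norm S h"
    if h: "h \<in> L2_space S" for h
  proof -
    obtain f0 where f0: "f0 \<in> Dmax S" "\<Gamma> f0 \<in> \<theta>" and eq: "L2_eq S (\<lambda>x. ell S f0 x - z * f0 x) h"
      using z h by (fastforce simp: resolvent_set_def L_ext_def Lmax_def)
    let ?c = "\<Gamma> f0"
    \<comment> \<open>Subtracting the null solution \<open>Y ?c\<close> leaves the equation intact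
      and moves the boundary values from \<open>\<theta>\<close> into
      \<open>\<theta>'\<close>.\<close>
    let ?f = "\<lambda>x. 1 * f0 x + (- 1) * Y ?c x"
    have fD: "?f \<in> Dmax S" by (rule Dmax_linear[OF f0(1) YD])
    have "\<Gamma> ?f = ?c - \<Gamma> (Y ?c)"
      unfolding Gamma_linear[OF f0(1) YD] by (simp add: prod_eq_iff)
    then have f\<theta>: "\<Gamma> ?f \<in> \<theta>'" using Y\<theta> by metis
    have "AE x in \<mu>. ell S (Y ?c) x = z * Y ?c x"
      using YN by (simp add: null_solutions_def)
    with eq[unfolded L2_eq_def] sl_regular_linear(3)[OF DmaxD(1)[OF f0(1)] DmaxD(1)[OF YD[of ?c]], where \<alpha> = 1 and \<beta> = "- 1"]
    have fh: "L2_eq S (\<lambda>x. ell S ?f x - z * ?f x) h"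
      unfolding L2_eq_def
    proof eventually_elim
      case (elim x)
      show ?case unfolding elim(2) elim(3) using elim(1) by (simp add: algebra_simps)
    qed
    have m0: "(\<lambda>x. ell S f0 x - z * f0 x) \<in> borel_measurable \<mu>"
      using L2_space_measurable[OF DmaxD(3)[OF f0(1)]] L2_space_measurable[OF DmaxD(2)[OF f0(1)]] by simp
    have nh: "L2_norm S (\<lambda>x. ell S f0 x - z * f0 x) = L2_norm S h"
      using eq by (intro L2_norm_cong m0 L2_space_measurable[OF h]) (simp add: L2_eq_def)
    have n0: "L2_norm S f0 \<le> C1 * L2_norm S h" using C1[OF f0] nh by simp
    have "L2_norm S (ell S f0) = L2_norm S (\<lambda>x. h x + z * f0 x)"
    proof (rule L2_norm_cong)
      show "AE x in \<mu>. ell S f0 x = h x + z * f0 x"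
        using eq[unfolded L2_eq_def] by eventually_elim (simp add: algebra_simps)
    qed (use L2_space_measurable h DmaxD[OF f0(1)] L2_space_add(1) L2_space_mult(1) in blast)+
    also have "\<dots> \<le> 2 * (L2_norm S h + cmod z * L2_norm S f0)"
      using L2_space_add(2)[OF h L2_space_mult(1)[OF DmaxD(2)[OF f0(1)], of z]] L2_space_mult(2)[OF DmaxD(2)[OF f0(1)], of z]
      by simp
    also have "\<dots> \<le> 2 * (L2_norm S h + cmod z * (C1 * L2_norm S h))"
      using n0 by (intro mult_left_mono add_left_mono) auto
    finally have nl: "L2_norm S (ell S f0) + L2_norm S f0 \<le> (2 * (1 + cmod z * C1) + C1) * L2_norm S h"
      using n0 by (simp add: algebra_simps)
    have "\<bar>?c \<bullet> b\<bar> \<le> G * ((2 * (1 + cmod z * C1) + C1) * L2_norm S h)" if "b \<in> Basis" for b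
    proof -
      have "G * (L2_norm S (ell S f0) + L2_norm S f0) \<le> G * ((2 * (1 + cmod z * C1) + C1) * L2_norm S h)"
        by (rule mult_left_mono[OF nl G(1)])
      then show ?thesis using G(2)[OF f0(1) that] by linarith
    qed
    then have "(\<Sum>b\<in>Basis. \<bar>?c \<bullet> b\<bar>) \<le> (\<Sum>b\<in>(Basis :: ((complex ^ 2) \<times> (complex ^ 2)) set). G * ((2 * (1 + cmod z * C1) + C1) * L2_norm S h))"
      by (intro sum_mono)
    then have sm: "(\<Sum>b\<in>Basis. \<bar>?c \<bullet> b\<bar>) \<le> ?m * (G * ((2 * (1 + cmod z * C1) + C1) * L2_norm S h))"
      by simp
    have "L2_norm S (Y ?c) \<le> K * (?m * (G * ((2 * (1 + cmod z * C1) + C1) * L2_norm S h)))"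
      using YK[of ?c] mult_left_mono[OF sm K(1)] by linarith
    moreover have "L2_norm S ?f \<le> 2 * (L2_norm S f0 + L2_norm S (Y ?c))"
      using L2_space_add(2)[OF DmaxD(2)[OF f0(1)] L2_space_mult(1)[OF DmaxD(2)[OF YD], of "- 1"]]
        L2_space_mult(2)[OF DmaxD(2)[OF YD], of "- 1"] by simp
    ultimately have "L2_norm S ?f \<le> C2 * L2_norm S h"
      using n0 by (simp add: C2_def algebra_simps)
    with fD f\<theta> fh show ?thesis by blast
  qed
  show ?thesis
    unfolding resolvent_set_def
  proof (intro CollectI conjI ballI)
    show "\<exists>(f, g)\<in>L_ext S u v \<theta>'. L2_eq S (\<lambda>x. g x - z * f x) h" if "h \<in> L2_space S" for h
      using solve[OF that] by (fastforce simp: L_ext_def Lmax_def)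
    show "case p of (f, g) \<Rightarrow> L2_eq S (\<lambda>x. g x - z * f x) (\<lambda>x. 0) \<longrightarrow> L2_eq S f (\<lambda>x. 0)"
      if "p \<in> L_ext S u v \<theta>'" for p
    proof -
      obtain f where f: "p = (f, ell S f)" "f \<in> Dmax S" "\<Gamma> f \<in> \<theta>'"
        using \<open>p \<in> L_ext S u v \<theta>'\<close> by (auto simp: L_ext_def Lmax_def)
      have "L2_eq S f (\<lambda>x. 0)" if "L2_eq S (\<lambda>x. ell S f x - z * f x) (\<lambda>x. 0)"
      proof (rule triv[OF _ f(3)])
        show "f \<in> null_solutions z"
          using that f(2) by (simp add: L2_eq_def null_solutions_def)
      qed
      then show ?thesis by (simp add: f(1))
    qed
    show "\<exists>C. \<forall>(f, g)\<in>L_ext S u v \<theta>'. L2_norm S f \<le> C * L2_norm S (\<lambda>x. g x - z * f x)"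
    proof (intro exI[of _ C2] ballI, clarify)
      fix f g assume "(f, g) \<in> L_ext S u v \<theta>'"
      then have f: "f \<in> Dmax S" "\<Gamma> f \<in> \<theta>'" and g: "g = ell S f" by (auto simp: L_ext_def Lmax_def)
      have "(\<lambda>x. ell S f x + (- z) * f x) \<in> L2_space S"
        by (intro L2_space_add(1) L2_space_mult(1) DmaxD[OF f(1)])
      then have "(\<lambda>x. ell S f x - z * f x) \<in> L2_space S" by simp
      from solve[OF this] obtain k where k: "k \<in> Dmax S" "\<Gamma> k \<in> \<theta>'"
        "L2_eq S (\<lambda>x. ell S k x - z * k x) (\<lambda>x. ell S f x - z * f x)"
        "L2_norm S k \<le> C2 * L2_norm S (\<lambda>x. ell S f x - z * f x)" by blast
      \<comment> \<open>The bound is known for the constructed solution \<open>k\<close>. Any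
        \<open>f\<close> with the same right-hand side differs from it by a null solution with
        boundary values in \<open>\<theta>'\<close>, which is zero almost everywhere.\<close>
      let ?d = "\<lambda>x. 1 * f x + (- 1) * k x"
      have "AE x in \<mu>. ell S ?d x = z * ?d x"
        using k(3)[unfolded L2_eq_def] sl_regular_linear(3)[OF DmaxD(1)[OF f(1)] DmaxD(1)[OF k(1)], where \<alpha> = 1 and \<beta> = "- 1"]
      proof eventually_elim
        case (elim x)
        show ?case unfolding elim(2) using elim(1) by (simp add: algebra_simps)
      qed
      then have "?d \<in> null_solutions z"
        using Dmax_linear[OF f(1) k(1)] unfolding null_solutions_def by blast
      moreover have "\<Gamma> ?d = \<Gamma> f - \<Gamma> k"
        unfolding Gamma_linear[OF f(1) k(1)] by (simp add: prod_eq_iff)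
      then have "\<Gamma> ?d \<in> \<theta>'" using subspace_diff[OF sub(2) f(2) k(2)] by metis
      ultimately have "L2_eq S ?d (\<lambda>x. 0)" by (rule triv)
      then have "L2_norm S f = L2_norm S k"
        by (intro L2_norm_cong L2_space_measurable DmaxD(2) f(1) k(1)) (simp add: L2_eq_def)
      then show "L2_norm S f \<le> C2 * L2_norm S (\<lambda>x. g x - z * f x)"
        using k(4) g by simp
    qed
  qed
qed

section \<open>Real eigenvalues, and membership in \<open>Sigma_M\<close>\<close>

lemma eigenvalue_L_ext:
  assumes "eigenvalue S (L_ext S u v \<theta>) z"
  obtains f where "f \<in> null_solutions z" "\<not> L2_eq S f (\<lambda>x. 0)" "\<Gamma> f \<in> \<theta>"
  using assms by (auto simp: eigenvalue_def L_ext_def Lmax_def null_solutions_def L2_eq_def)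

lemma Green_null_solutions:
  assumes f: "f \<in> null_solutions z" and g: "g \<in> null_solutions z"
  shows "(z - cnj z) * L2_inner S f g = cinner2 (\<Gamma>1 f) (\<Gamma>0 g) - cinner2 (\<Gamma>0 f) (\<Gamma>1 g)"
proof -
  have fD: "f \<in> Dmax S" and fe: "AE x in \<mu>. ell S f x = z * f x"
    and gD: "g \<in> Dmax S" and ge: "AE x in \<mu>. ell S g x = z * g x"
    using f g by (auto simp: null_solutions_def)
  note m = L2_space_measurable[OF DmaxD(2)] L2_space_measurable[OF DmaxD(3)]
  have mz: "(\<lambda>x. z * h x) \<in> borel_measurable \<mu>" if "h \<in> Dmax S" for h
    using m(1)[OF that] by simp
  have "L2_inner S (ell S f) g = L2_inner S (\<lambda>x. z * f x) g"
    by (rule L2_inner_cong[OF m(2)[OF fD] mz[OF fD] m(1)[OF gD] m(1)[OF gD] fe]) simp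
  also have "\<dots> = z * L2_inner S f g"
    by (simp add: L2_inner_def mult.assoc)
  finally have 1: "L2_inner S (ell S f) g = z * L2_inner S f g" .
  have "L2_inner S f (ell S g) = L2_inner S f (\<lambda>x. z * g x)"
    by (rule L2_inner_cong[OF m(1)[OF fD] m(1)[OF fD] m(2)[OF gD] mz[OF gD] _ ge]) simp
  also have "\<dots> = (LINT x|\<mu>. cnj z * (f x * cnj (g x) * of_real (cw S x)))"
    by (simp add: L2_inner_def ac_simps)
  also have "\<dots> = cnj z * L2_inner S f g"
    by (simp add: L2_inner_def)
  finally have 2: "L2_inner S f (ell S g) = cnj z * L2_inner S f g" .
  show ?thesis
    using Green_Gamma[OF fD gD] 1 2 by (simp add: algebra_simps)
qed

text \<open>Boundary values in a self-adjoint relation make the boundary form vanish, leaving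
  \<open>z - cnj z\<close> times the positive squared norm of \<open>f\<close>.\<close>

lemma eigenvalue_real:
  assumes \<theta>: "\<theta> \<in> sa_relations" and f: "f \<in> null_solutions z" "\<not> L2_eq S f (\<lambda>x. 0)" "\<Gamma> f \<in> \<theta>"
  shows "cnj z = z"
proof -
  have fL: "f \<in> L2_space S" using f(1) DmaxD(2) by (auto simp: null_solutions_def)
  have "\<Gamma> f \<in> adjoint_relation \<theta>" using \<theta> f(3) by (simp add: sa_relations_def)
  then have "\<forall>p\<in>\<theta>. cinner2 (snd p) (\<Gamma>0 f) = cinner2 (fst p) (\<Gamma>1 f)"
    by (simp add: adjoint_relation_def case_prod_beta)
  then have "cinner2 (\<Gamma>1 f) (\<Gamma>0 f) = cinner2 (\<Gamma>0 f) (\<Gamma>1 f)"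
    using f(3) by fastforce
  then have "(z - cnj z) * L2_inner S f f = 0"
    using Green_null_solutions[OF f(1) f(1)] by simp
  moreover have "L2_inner S f f = complex_of_real ((L2_norm S f)\<^sup>2)"
    unfolding L2_norm_square L2_inner_def integral_complex_of_real[symmetric]
    by (simp only: complex_norm_square of_real_mult)
  moreover have "L2_norm S f \<noteq> 0" using L2_norm_zero_iff[OF fL] f(2) by simp
  ultimately show ?thesis by simp
qed

lemma null_solution_in_Sigma_M:
  assumes z: "cnj z = z" and y: "y \<in> null_solutions z" "\<Gamma>0 y \<noteq> 0"
  shows "z \<in> Sigma_M S u v"
proof -
  have yD: "y \<in> Dmax S" using y by (simp add: null_solutions_def)
  have "cinner2 (\<Gamma>1 y) (\<Gamma>0 y) = cinner2 (\<Gamma>0 y) (\<Gamma>1 y)"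
    using Green_null_solutions[OF y(1) y(1)] z by simp
  then obtain A where A: "hermitian_matrix A" "A *v \<Gamma>0 y = \<Gamma>1 y"
    by (rule hermitian_matrix_exists[OF y(2)])
  have "(y, ell S y) \<in> L_ext S u v (matrix_graph A)"
    using yD A(2) by (auto simp: L_ext_def Lmax_def matrix_graph_def)
  \<comment> \<open>A solution vanishing almost everywhere has zero boundary values, so
    \<open>\<Gamma>0 y \<noteq> 0\<close> makes \<open>y\<close> a genuine eigenfunction.\<close>
  moreover have "\<not> L2_eq S y (\<lambda>x. 0)"
    using Gamma_AE_zero[OF yD] y(2) by (auto simp: zero_prod_def)
  ultimately have "eigenvalue S (L_ext S u v (matrix_graph A)) z"
    using y(1) unfolding eigenvalue_def by (fastforce simp: null_solutions_def L2_eq_def)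
  then have "z \<in> spectrum S (L_ext S u v (matrix_graph A))"
    using eigenvalue_not_in_resolvent_set by (simp add: spectrum_def)
  then show ?thesis using A(1) by (auto simp: Sigma_M_def hermitian_graphs_def)
qed

lemma L_zero_eq: "L_zero S v = L_ext S u v ({0} \<times> UNIV)"
  by (auto simp: L_zero_def L_ext_def)

lemma L_infty_eq: "L_infty S u = L_ext S u v (UNIV \<times> {0})"
  by (auto simp: L_infty_def L_ext_def)

text \<open>If all solutions satisfied \<open>\<Gamma>0 y = 0\<close>, all their Wronskians would vanish, so two solutions
  with independent values of \<open>\<Gamma>1\<close> would have a combination with zero initial data.\<close>

lemma exists_Gamma0_nonzero:
  assumes z: "cnj z = z" and res: "z \<in> resolvent_set S (L_infty S u)"
  shows "\<exists>y\<in>null_solutions z. \<Gamma>0 y \<noteq> 0"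
proof (rule ccontr)
  assume "\<not> ?thesis"
  then have G0: "\<Gamma>0 y = 0" if "y \<in> null_solutions z" for y using that by blast
  have ex: "\<exists>y\<in>null_solutions z. \<Gamma>1 y = b" for b
  proof -
    obtain y f where "y \<in> null_solutions z" "\<Gamma> f \<in> UNIV \<times> {0}" "\<Gamma>1 y = b - \<Gamma>1 f"
      by (rule null_solution_from_resolvent[OF res[unfolded L_infty_eq]])
    then show ?thesis by auto
  qed
  obtain f where f: "f \<in> null_solutions z" "\<Gamma>1 f = vector [1, 0]" using ex by blast
  obtain g where g: "g \<in> null_solutions z" "\<Gamma>1 g = vector [0, 1]" using ex by blast
  have D: "h \<in> Dmax S" "AE x in \<mu>. ell S h x = of_real (Re z) * h x"
    if "h \<in> null_solutions z" for h
  proof -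
    have "complex_of_real (Re z) = z" using z by (simp add: complex_eq_iff)
    then show "h \<in> Dmax S" "AE x in \<mu>. ell S h x = of_real (Re z) * h x"
      using that by (simp_all add: null_solutions_def)
  qed
  obtain x0 where x0: "x0 \<in> dom_int S" using dom_int_nonempty by blast
  \<comment> \<open>Here separation enters: the first component of \<open>\<Gamma>0\<close> alone
    makes the bracket vanish at the left endpoint, and for real \<open>z\<close> the bracket is
    constant.\<close>
  have br: "bracket S h k x0 = 0" if h: "h \<in> null_solutions z" and k: "k \<in> null_solutions z" for h k
  proof -
    have "end_bracket S Lend h k = bracket S h k x0"
    proof (rule end_bracket_eqI[OF D(1)[OF h] D(1)[OF k] tendsto_const])
      show "\<forall>\<^sub>F t in end_filter S Lend. bracket S h k t = bracket S h k x0"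
        using end_filter_eventually_dom_int[OF ends]
        by eventually_elim
          (rule bracket_constant[OF DmaxD(1)[OF D(1)[OF h]] D(2)[OF h] DmaxD(1)[OF D(1)[OF k]] D(2)[OF k] _ x0])
    qed
    moreover have "bv0 S v Lend h = 0" "bv0 S v Lend k = 0"
      using G0[OF h] G0[OF k] by (simp_all add: Gamma0_def vec2_eq_iff)
    ultimately show ?thesis using end_bracket_bv[OF D(1)[OF h] D(1)[OF k], of Lend] by simp
  qed
  define a b c d where "a = f x0" and "b = quasi_deriv S f x0" and "c = g x0" and "d = quasi_deriv S g x0"
  have cd: "c * cnj d = d * cnj c" and ad: "a * cnj d = b * cnj c"
    using br[OF g(1) g(1)] br[OF f(1) g(1)] by (simp_all add: bracket_def a_def b_def c_def d_def)
  \<comment> \<open>The bracket of \<open>f\<close> and \<open>g\<close> only gives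
    \<open>a * cnj d = b * cnj c\<close>; the self-bracket of \<open>g\<close> trades
    \<open>c * cnj d\<close> for \<open>d * cnj c\<close>, which removes the conjugation.\<close>
  have det: "a * d = b * c"
  proof (cases "d = 0")
    case True
    then show ?thesis using ad by simp
  next
    case False
    have "a * d * cnj d = b * (d * cnj c)" using ad by (simp add: ac_simps)
    also have "\<dots> = b * c * cnj d" using cd by (simp add: ac_simps)
    finally show ?thesis using False by simp
  qed
  obtain \<alpha> \<beta> where ab: "\<alpha> \<noteq> 0 \<or> \<beta> \<noteq> 0" "\<alpha> * a + \<beta> * c = 0" "\<alpha> * b + \<beta> * d = 0"
  proof (cases "a = 0 \<and> b = 0")
    case True
    then show ?thesis by (intro that[of 1 0]) auto
  next
    case ab: False
    show ?thesis
    proof (cases "a = 0")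
      case True
      then show ?thesis using ab det by (intro that[of "- d" b]) (auto simp: algebra_simps)
    next
      case False
      then show ?thesis using det by (intro that[of "- c" a]) (auto simp: algebra_simps)
    qed
  qed
  let ?y = "\<lambda>x. \<alpha> * f x + \<beta> * g x"
  have y: "?y \<in> null_solutions z" by (rule null_solutions_linear[OF f(1) g(1)])
  have yD: "?y \<in> Dmax S" by (rule D(1)[OF y])
  have "?y x = 0" if "x \<in> dom_int S" for x
  proof (rule solution_unique[OF DmaxD(1)[OF yD] _ x0 _ _ that, where z = z])
    show "AE x in \<mu>. ell S ?y x = z * ?y x"
      using y unfolding null_solutions_def by blast
    show "?y x0 = 0" using ab(2) by (simp add: a_def c_def)
    show "quasi_deriv S ?y x0 = 0"
      using sl_regular_linear(2)[OF DmaxD(1)[OF D(1)[OF f(1)]] DmaxD(1)[OF D(1)[OF g(1)]] x0] ab(3)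
      by (simp add: b_def d_def)
  qed
  then have "\<Gamma> ?y = 0" by (rule Gamma_zero[OF yD])
  then have "\<alpha> *s \<Gamma>1 f + \<beta> *s \<Gamma>1 g = 0"
    unfolding Gamma_linear[OF D(1)[OF f(1)] D(1)[OF g(1)]] by (simp add: zero_prod_def)
  then show False using ab(1) f(2) g(2) by (simp add: vec2_eq_iff)
qed

lemma eigenvalue_in_Sigma_M:
  assumes \<theta>: "\<theta> \<in> sa_relations" and ev: "eigenvalue S (L_ext S u v \<theta>) z"
    and res: "z \<in> resolvent_set S (L_zero S v) \<union> resolvent_set S (L_infty S u)"
  shows "z \<in> Sigma_M S u v"
proof -
  obtain f where f: "f \<in> null_solutions z" "\<not> L2_eq S f (\<lambda>x. 0)" "\<Gamma> f \<in> \<theta>"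
    by (rule eigenvalue_L_ext[OF ev])
  have z: "cnj z = z" by (rule eigenvalue_real[OF \<theta> f])
  have "\<exists>y\<in>null_solutions z. \<Gamma>0 y \<noteq> 0"
  proof (cases "\<Gamma>0 f = 0")
    case True
    then have "(f, ell S f) \<in> L_zero S v"
      using f(1) by (auto simp: L_zero_def Lmax_def null_solutions_def)
    then have "eigenvalue S (L_zero S v) z"
      using f(1,2) unfolding eigenvalue_def by (fastforce simp: null_solutions_def L2_eq_def)
    then have "z \<in> resolvent_set S (L_infty S u)"
      using res eigenvalue_not_in_resolvent_set by blast
    then show ?thesis by (rule exists_Gamma0_nonzero[OF z])
  qed (use f in blast)
  then show ?thesis using null_solution_in_Sigma_M[OF z] by blast
qed

text \<open>These relations give \<open>L_zero\<close> and \<open>L_infty\<close>, so the transfer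
  between self-adjoint relations can start from either operator.\<close>

lemma sa_relation_axes: "{0} \<times> UNIV \<in> sa_relations" "UNIV \<times> {0} \<in> sa_relations"
proof -
  have pos: "x = 0" if "\<And>y. cinner2 y x = 0" for x
    using that[of "axis 1 1"] that[of "axis 2 1"] by (simp add: cinner2_expand vec2_eq_iff axis_def)
  have pos': "x = 0" if "\<And>y. 0 = cinner2 y x" for x using pos that by metis
  have z: "cinner2 0 x = 0" "cinner2 x 0 = 0" for x by (simp_all add: cinner2_expand)
  show "{0} \<times> UNIV \<in> sa_relations"
    using pos by (auto simp: sa_relations_def linear_relation_def adjoint_relation_def z)
  show "UNIV \<times> {0} \<in> sa_relations"
    using pos' by (auto simp: sa_relations_def linear_relation_def adjoint_relation_def z)
qed

text \<open>A point outside \<open>Sigma_E\<close> lies in one of the two reference resolvent sets.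
  If it were not an eigenvalue of \<open>L(\<theta>)\<close>, the transfer would put it into the
  resolvent set of \<open>L(\<theta>)\<close>; so it is one, and lies in
  \<open>Sigma_M\<close>.\<close>

lemma Sigma_R_empty: "Sigma_R S u v = {}"
proof (rule ccontr)
  assume "Sigma_R S u v \<noteq> {}"
  then obtain z \<theta> where \<theta>: "\<theta> \<in> sa_relations" "z \<in> spectrum S (L_ext S u v \<theta>)"
    and nM: "z \<notin> Sigma_M S u v" and nE: "z \<notin> Sigma_E S u v"
    by (auto simp: Sigma_R_def)
  have res: "z \<in> resolvent_set S (L_zero S v) \<union> resolvent_set S (L_infty S u)"
    using nE by (auto simp: Sigma_E_def spectrum_def)
  then obtain \<theta>' where "\<theta>' \<in> sa_relations" "z \<in> resolvent_set S (L_ext S u v \<theta>')"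
    using sa_relation_axes unfolding L_zero_eq L_infty_eq by blast
  then have "eigenvalue S (L_ext S u v \<theta>) z"
    using resolvent_set_transfer[OF _ \<theta>(1)] \<theta>(2) by (auto simp: spectrum_def)
  then show False using eigenvalue_in_Sigma_M[OF \<theta>(1) _ res] nM by blast
qed

end

theorem corollary3p15:
  fixes S :: sl_data
    and K l0 :: real
    and u v :: "endpoint \<Rightarrow> real \<Rightarrow> real"
  assumes "sl_coefficients S"
    and "limit_circle S Lend" and "limit_circle S Rend"
    and "bounded_below S (Lmin S) K"
    and "boundary_basis S l0 u v"
  shows "(\<forall>\<theta>\<in>sa_relations. (\<nexists>A. \<theta> = matrix_graph A) \<longrightarrow>
            (\<forall>z. eigenvalue S (L_ext S u v \<theta>) z \<longrightarrow>
                 z \<in> resolvent_set S (L_zero S v) \<union> resolvent_set S (L_infty S u) \<longrightarrow>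
                 z \<in> Sigma_M S u v)) \<and>
         Sigma_R S u v = {}"
proof -
  interpret sl_boundary S l0 u v
    by unfold_locales (use assms in auto)
  show ?thesis
    using eigenvalue_in_Sigma_M Sigma_R_empty by blast
qed

end
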